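(* Let the parameters be regular, admissible for $\boldsymbol\sigma_q(N)$ for every $N\in\mathbb N_0$, and assume all leading principal truncations of the moment matrix $\mathscr M$ are nonsingular. Let $T=(T_{N,M})_{N,M\ge0}$ be the step-line recurrence matrix and $t_{N,k}=T_{N,N+k}$. Then for $k\in\{-p,\dots,q\}$ and $N+k\ge0$, $$t_{N,k}=\mathscr P^{(\boldsymbol\sigma_p(N+k+1),\,\boldsymbol\sigma_q(N+k))}_{1,(\boldsymbol\sigma_p(N),\,\boldsymbol\sigma_q(N+1))} .$$ Consequently the entries appearing in the dual recurrence $z\mathbf A_N=\sum_{k=-q,\,N+k\ge0}^{p}t_{N+k,-k}\mathbf A_{N+k}$ are $$t_{N+k,-k}=\mathscr P^{(\boldsymbol\sigma_p(N+1),\,\boldsymbol\sigma_q(N))}_{1,(\boldsymbol\sigma_p(N+k),\,\boldsymbol\sigma_q(N+k+1))},\qquad k\in\{-q,\dots,p\},\ N+k\ge0 .$$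
   Context: Notation. $\mathbf 1_d$: all-ones vector; $\boldsymbol e_j$: standard basis vector; $|\boldsymbol n|=\sum n_i$; $\boldsymbol c^{*i}$: $\boldsymbol c$ with its $i$-th component removed. $(x)_n=\Gamma(x+n)/\Gamma(x)$ for $n\in\mathbb Z$; for vectors $\Gamma(\boldsymbol v)=\prod_h\Gamma(v_h)$, $(\boldsymbol c)_{\boldsymbol m}=\prod_h(c_h)_{m_h}$, a scalar subscript is applied to each component; empty products are $1$. $\mathbb T$: positively oriented unit circle. $\mathbb Z_{\le0}=\{0,-1,\dots\}$. Parameters: $p,q\ge1$, $0\le r<q$, $\boldsymbol a\in\mathbb C^r$, $\boldsymbol b\in\mathbb C^q$, $\boldsymbol\kappa\in\mathbb C^p$; regular: $b_j-b_h\notin\mathbb Z$ $(j\ne h)$, $\kappa_i-\kappa_h\notin\mathbb Z$ $(i\ne h)$. Weights: $C_{j,i}(z)=\sum_{k\ge0}\frac{\Gamma((k+\kappa_i)\mathbf 1_r+\boldsymbol a+\mathbf 1_r)}{\Gamma((k+\kappa_i)\mathbf 1_q+\boldsymbol b+\boldsymbol e_j+\mathbf 1_q)}z^{-k-1}$. Pairing: $\langle\mathbf B,\mathbf A\rangle=\sum_{j,i}\oint_{\mathbb T}B^{(j)}C_{j,i}A^{(i)}\frac{\mathrm dz}{2\pi\mathrm i}$. $\boldsymbol m\in\mathbb N_0^q$ near the diagonal: $|m_j-m_h|\le1$ for all $j,h$; $m_{\min}=\min_hm_h$, $j_{\min}=\min\{j:m_j=m_{\min}\}$, $m_{\max}=\max_hm_h$,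 $j_{\max}=\max\{j:m_j=m_{\max}\}$. Admissible for $\boldsymbol m$: for all $i,j,\rho$, $\kappa_i+a_\rho+1\notin\mathbb Z_{\le0}$, $\kappa_i+b_j+1\notin\mathbb Z_{\le0}$; $a_\rho-b_j-m_j+1\notin\mathbb Z_{\le0}$ whenever $m_j\ge1$; $a_\rho-b_{j_{\min}}-m_{\min}\notin\mathbb Z_{\le0}$. Step-line. For $N=da+s$, $0\le s<d$, $\boldsymbol\sigma_d(N)\in\mathbb N_0^d$ has its first $s$ components equal to $a+1$ and the others equal to $a$. $\mathbf B_N=\mathbf B_{\boldsymbol\sigma_p(N),\boldsymbol\sigma_q(N+1)}$ and $\mathbf A_N=\mathbf A_{\boldsymbol\sigma_p(N+1),\boldsymbol\sigma_q(N)}$, with the normalized vectors below. Recurrence matrix. $\mathscr M$ is the semi-infinite matrix with entries $\mathscr M_{(u,j),(v,i)}=\oint_{\mathbb T}z^{u+v}C_{j,i}(z)\frac{\mathrm dz}{2\pi\mathrm i}$, rows $(u,j)$, $u\ge0,1\le j\le q$ and columns $(v,i)$, $v\ge0,1\le i\le p$, each ordered lexicographically. Under the nonsingularity assumption $\mathscr M=S^{-1}H\bar S^{-\mathsf T}$ with $S,\bar S$ lower unitriangular and $H$ diagonal; $T=S\Lambda_{[q]}S^{-1}$, where $\Lambda_{[q]}$ is the block shift with $q\times q$ identity blocks on the first block superdiagonal. $T$ has $p$ subdiagonals and $q$ superdiagonals, and it is the matrix for which $z\mathbf B_N=\sum_{k=-p,\,N+k\ge0}^{q}t_{N,k}\mathbf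 B_{N+k}$; moreover $\langle\mathbf B_N,\mathbf A_M\rangle=\delta_{N,M}$ and $t_{N,k}=\langle z\mathbf B_N,\mathbf A_{N+k}\rangle$. Normalized vectors. For $|\boldsymbol n|=|\boldsymbol m|+1$: $A^{(i)}_{\boldsymbol n,\boldsymbol m}=0$ if $n_i=0$, else $$A^{(i)}_{\boldsymbol n,\boldsymbol m}(z)=\nu^AC_{\boldsymbol n,\boldsymbol m;i}\sum_{k=0}^{n_i-1}\frac{(1-n_i)_k(\kappa_i\mathbf 1_q+\boldsymbol b+\boldsymbol m+\mathbf 1_q)_k(\kappa_i\mathbf 1_{p-1}-\boldsymbol\kappa^{*i}-\boldsymbol n^{*i}+\mathbf 1_{p-1})_k}{(\kappa_i\mathbf 1_r+\boldsymbol a+\mathbf 1_r)_k(\kappa_i\mathbf 1_{p-1}-\boldsymbol\kappa^{*i}+\mathbf 1_{p-1})_k}\frac{z^k}{k!},$$ $$C_{\boldsymbol n,\boldsymbol m;i}=(-1)^{|\boldsymbol n|}\frac{\Gamma(\kappa_i\mathbf 1_q+\boldsymbol b+\mathbf 1_q)}{\Gamma(\kappa_i\mathbf 1_r+\boldsymbol a+\mathbf 1_r)}\frac{\prod_j(\kappa_i+b_j+1)_{m_j}}{(-1)^{n_i-1}(n_i-1)!\prod_{\ell\ne i}(\kappa_i-\kappa_\ell-n_\ell+1)_{n_\ell}},$$ $$\nu^A=-\frac{\prod_i(\kappa_i+b_{j_{\min}}+m_{\min}+1)_{n_i}}{(\boldsymbol a-b_{j_{\min}}\mathbf 1_r-m_{\min}\mathbf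 1_r)_{m_{\min}}\prod_{h:m_h=m_{\min}+1}(b_h-b_{j_{\min}})}.$$ For $|\boldsymbol m|=|\boldsymbol n|+1$: $B^{(j)}_{\boldsymbol n,\boldsymbol m}=0$ if $m_j=0$, else $$B^{(j)}_{\boldsymbol n,\boldsymbol m}(z)=\nu^B\Bigg[\pi_{j,0}+\frac{(\boldsymbol a-b_j\mathbf 1_r)_1}{(\boldsymbol b^{*j}-b_j\mathbf 1_{q-1})_1}\sum_{H=1}^q\sum_{K=1}^{m_H-1}\pi_{H,K}\frac{(\boldsymbol b^{*j}-(b_H+K)\mathbf 1_{q-1})_1}{(\boldsymbol a-(b_H+K)\mathbf 1_r)_1}\sum_{d=0}^{K-1+\delta_{j,H}}\frac{(\boldsymbol b-(b_H+K)\mathbf 1_q+\mathbf 1_q-\boldsymbol e_j)_d}{(\boldsymbol a-(b_H+K)\mathbf 1_r+\mathbf 1_r)_d}z^d\Bigg],$$ $$\pi_{H,K}=-\frac{\prod_i(\kappa_i+b_H+K+1)_{n_i}}{(-1)^KK!(m_H-K-1)!\prod_{I\ne H}(b_I-b_H-K)_{m_I}},$$ $$\nu^B=-\frac{(\boldsymbol a-b_{j_{\max}}\mathbf 1_r-(m_{\max}-1)\mathbf 1_r)_{m_{\max}}\prod_{h\ne j_{\max},m_h=m_{\max}}(b_h-b_{j_{\max}})}{(\boldsymbol a-b_{j_{\max}}\mathbf 1_r)_1\prod_i(\kappa_i+b_{j_{\max}}+m_{\max})_{n_i}}.$$ Pairing block, for $|\boldsymbol\mu|=|\boldsymbol\nu|+1$,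 $|\boldsymbol\lambda|=|\boldsymbol\eta|+1$, $\boldsymbol\mu,\boldsymbol\eta$ near the diagonal, $d\in\{0,1\}$. Put $\eta_-=\min_h\eta_h$, $j_-=\min\{h:\eta_h=\eta_-\}$, $\mu_+=\max_h\mu_h$, $j_+=\max\{h:\mu_h=\mu_+\}$, $K_+=\mu_+-1$, $$\mathcal N=\frac{(\boldsymbol\kappa+(b_{j_-}+\eta_-+1)\mathbf 1_p)_{\boldsymbol\lambda}\,(\boldsymbol a-(b_{j_+}+K_+)\mathbf 1_r)_{K_+}}{(\boldsymbol a-(b_{j_-}+\eta_-)\mathbf 1_r)_{\eta_-}\prod_{h:\eta_h=\eta_-+1}(b_h-b_{j_-})}\prod_{h\ne j_+,\,\mu_h=\mu_+}(b_h-b_{j_+}).$$ For $0\le\alpha\le\lambda_i-1$: if $H=j$, $0\le K\le\mu_H-1$, $0\le\beta\le K$, $$\begin{aligned}\mathcal S_{d;i,H,H,K}(\alpha,\beta)=&\frac{(-1)^{|\boldsymbol\lambda|-\lambda_i+\alpha+\beta-K}}{\alpha!(\lambda_i-1-\alpha)!(K-\beta)!(\mu_H-K-1)!}\\&\times\frac{(\kappa_i\mathbf 1_r+\boldsymbol a+(\alpha+1)\mathbf 1_r)_{d+\beta}\,(\boldsymbol a-(b_H+K)\mathbf 1_r+(\beta+1)\mathbf 1_r)_{K-\beta}}{(\kappa_i\mathbf 1_{p-1}-\boldsymbol\kappa^{*i}-\boldsymbol\lambda^{*i}+(\alpha+1)\mathbf 1_{p-1})_{\boldsymbol\lambda^{*i}}\,(\boldsymbol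 a-(b_H+K)\mathbf 1_r)_K}\cdot\frac{(\boldsymbol\kappa+(b_H+K+1)\mathbf 1_p)_{\boldsymbol\nu}}{(\boldsymbol\kappa+(b_{j_+}+K_++1)\mathbf 1_p)_{\boldsymbol\nu}}\\&\times\frac{(\kappa_i\mathbf 1_q+\boldsymbol b+(d+\alpha+\beta+1)\mathbf 1_q+\boldsymbol e_H)_{\boldsymbol\eta-(d+\beta)\mathbf 1_q-\boldsymbol e_H}}{(\boldsymbol b^{*H}-b_H\mathbf 1_{q-1})_1\,(\boldsymbol b^{*H}-(b_H+K)\mathbf 1_{q-1}+(\beta+1)\mathbf 1_{q-1})_{\boldsymbol\mu^{*H}-(\beta+1)\mathbf 1_{q-1}}};\end{aligned}$$ if $H\ne j$, $1\le K\le\mu_H-1$, $0\le\beta\le K-1$, $$\begin{aligned}\mathcal S_{d;i,j,H,K}(\alpha,\beta)=&\frac{(-1)^{|\boldsymbol\lambda|-\lambda_i+1+\alpha+K+\beta}}{\alpha!(\lambda_i-1-\alpha)!(K-1-\beta)!(\mu_H-K-1)!}\\&\times\frac{(\boldsymbol a-b_j\mathbf 1_r)_1\,(\kappa_i\mathbf 1_r+\boldsymbol a+(\alpha+1)\mathbf 1_r)_{d+\beta}}{(\kappa_i\mathbf 1_{p-1}-\boldsymbol\kappa^{*i}-\boldsymbol\lambda^{*i}+(\alpha+1)\mathbf 1_{p-1})_{\boldsymbol\lambda^{*i}}\,(\boldsymbol a-(b_H+K)\mathbf 1_r)_{\beta+1}}\cdot\frac{(\boldsymbol\kappa+(b_H+K+1)\mathbf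 1_p)_{\boldsymbol\nu}}{(\boldsymbol\kappa+(b_{j_+}+K_++1)\mathbf 1_p)_{\boldsymbol\nu}}\\&\times\frac{(\kappa_i\mathbf 1_q+\boldsymbol b+(d+\alpha+\beta+1)\mathbf 1_q+\boldsymbol e_j)_{\boldsymbol\eta-(d+\beta)\mathbf 1_q-\boldsymbol e_j}}{(\boldsymbol b^{*j}-b_j\mathbf 1_{q-1})_1\,(\boldsymbol b^{*H}-(b_H+K)\mathbf 1_{q-1}+(\beta+1)\mathbf 1_{q-1}-\boldsymbol e_j^{*H})_{\boldsymbol\mu^{*H}-(\beta+1)\mathbf 1_{q-1}+\boldsymbol e_j^{*H}}};\end{aligned}$$ and $\mathcal S=0$ otherwise. Then $\mathscr P^{(\boldsymbol\lambda,\boldsymbol\eta)}_{d,(\boldsymbol\nu,\boldsymbol\mu)}=\mathcal N\sum_{j=1}^q\sum_{i=1}^p\sum_{\beta=0}^{\mu_j-1}\sum_{\alpha=0}^{\lambda_i-1}\sum_{H=1}^q\sum_{K=0}^{\mu_H-1}\mathcal S_{d;i,j,H,K}(\alpha,\beta)$. *)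

theory Defs
  imports
    "HOL-Complex_Analysis.Complex_Analysis"
    "HOL-Library.Groups_Big_Fun"
    "Jordan_Normal_Form.Determinant"
begin

text \<open>
  A vector with \<open>d\<close> components is a function on \<open>nat\<close> of which only the values at
  \<open>0, \<dots>, d - 1\<close> are used: the mathematical index \<open>j\<close> in \<open>1, \<dots>, d\<close> is the index \<open>j - 1\<close> here.
  Products over \<open>h \<in> {..<d} - {i}\<close> correspond to a vector with its \<open>i\<close>-th component removed.
\<close>

text \<open>
  \<open>(x)\<^sub>n = \<Gamma>(x + n) / \<Gamma>(x)\<close> for integer \<open>n\<close>. The quotient of Gamma values is continued to the
  poles of \<open>\<Gamma>\<close>, so that for instance \<open>(1 - n)\<^sub>k\<close> with \<open>k, n\<close> natural is the usual finite product;
  for negative \<open>n\<close> one has \<open>(x)\<^sub>n = 1 / (x + n)\<^bsub>-n\<^esub>\<close>.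
\<close>
definition gpoch :: "complex \<Rightarrow> int \<Rightarrow> complex" where
  "gpoch x n = (if 0 \<le> n then pochhammer x (nat n)
                else 1 / pochhammer (x + of_int n) (nat (- n)))"


section \<open>Multi-indices\<close>

definition vsum :: "nat \<Rightarrow> (nat \<Rightarrow> nat) \<Rightarrow> nat" where
  "vsum d n = (\<Sum>i<d. n i)"

definition vmin :: "nat \<Rightarrow> (nat \<Rightarrow> nat) \<Rightarrow> nat" where
  "vmin d m = Min (m ` {..<d})"

definition vmax :: "nat \<Rightarrow> (nat \<Rightarrow> nat) \<Rightarrow> nat" where
  "vmax d m = Max (m ` {..<d})"

definition first_min :: "nat \<Rightarrow> (nat \<Rightarrow> nat) \<Rightarrow> nat" where
  "first_min d m = Min {j. j < d \<and> m j = vmin d m}"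

definition last_max :: "nat \<Rightarrow> (nat \<Rightarrow> nat) \<Rightarrow> nat" where
  "last_max d m = Max {j. j < d \<and> m j = vmax d m}"

definition stepline :: "nat \<Rightarrow> nat \<Rightarrow> nat \<Rightarrow> nat" where
  "stepline d N i = N div d + of_bool (i < N mod d)"


section \<open>Parameters\<close>

definition regular_parameters ::
    "nat \<Rightarrow> nat \<Rightarrow> (nat \<Rightarrow> complex) \<Rightarrow> (nat \<Rightarrow> complex) \<Rightarrow> bool" where
  "regular_parameters p q b \<kappa> \<longleftrightarrow>
     (\<forall>j<q. \<forall>h<q. j \<noteq> h \<longrightarrow> b j - b h \<notin> \<int>) \<and>
     (\<forall>i<p. \<forall>h<p. i \<noteq> h \<longrightarrow> \<kappa> i - \<kappa> h \<notin> \<int>)"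

definition admissible ::
    "nat \<Rightarrow> nat \<Rightarrow> nat \<Rightarrow> (nat \<Rightarrow> complex) \<Rightarrow> (nat \<Rightarrow> complex) \<Rightarrow> (nat \<Rightarrow> complex) \<Rightarrow>
     (nat \<Rightarrow> nat) \<Rightarrow> bool" where
  "admissible p q r a b \<kappa> m \<longleftrightarrow>
     (\<forall>i<p. \<forall>\<rho><r. \<kappa> i + a \<rho> + 1 \<notin> \<int>\<^sub>\<le>\<^sub>0) \<and>
     (\<forall>i<p. \<forall>j<q. \<kappa> i + b j + 1 \<notin> \<int>\<^sub>\<le>\<^sub>0) \<and>
     (\<forall>j<q. \<forall>\<rho><r. 1 \<le> m j \<longrightarrow> a \<rho> - b j - of_nat (m j) + 1 \<notin> \<int>\<^sub>\<le>\<^sub>0) \<and>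
     (\<forall>\<rho><r. a \<rho> - b (first_min q m) - of_nat (vmin q m) \<notin> \<int>\<^sub>\<le>\<^sub>0)"


section \<open>Weights and moment matrix\<close>

definition weight ::
    "nat \<Rightarrow> nat \<Rightarrow> (nat \<Rightarrow> complex) \<Rightarrow> (nat \<Rightarrow> complex) \<Rightarrow> (nat \<Rightarrow> complex) \<Rightarrow>
     nat \<Rightarrow> nat \<Rightarrow> complex \<Rightarrow> complex" where
  "weight q r a b \<kappa> j i z =
     suminf (\<lambda>k. (\<Prod>\<rho><r. Gamma (of_nat k + \<kappa> i + a \<rho> + 1))
          / (\<Prod>h<q. Gamma (of_nat k + \<kappa> i + b h + of_bool (h = j) + 1))
          * z powi (- int k - 1))"

definition moment ::
    "nat \<Rightarrow> nat \<Rightarrow> (nat \<Rightarrow> complex) \<Rightarrow> (nat \<Rightarrow> complex) \<Rightarrow> (nat \<Rightarrow> complex) \<Rightarrow>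
     nat \<times> nat \<Rightarrow> nat \<times> nat \<Rightarrow> complex" where
  "moment q r a b \<kappa> = (\<lambda>(u, j) (v, i).
     contour_integral (circlepath 0 1)
       (\<lambda>z. z ^ (u + v) * weight q r a b \<kappa> j i z / (2 * of_real pi * \<i>)))"

text \<open>
  In the lexicographic order the row \<open>(u, j)\<close> has position \<open>u * q + j\<close> and the column \<open>(v, i)\<close>
  has position \<open>v * p + i\<close>.
\<close>
definition moment_matrix ::
    "nat \<Rightarrow> nat \<Rightarrow> nat \<Rightarrow> (nat \<Rightarrow> complex) \<Rightarrow> (nat \<Rightarrow> complex) \<Rightarrow> (nat \<Rightarrow> complex) \<Rightarrow>
     nat \<Rightarrow> nat \<Rightarrow> complex" where
  "moment_matrix p q r a b \<kappa> N M =
     moment q r a b \<kappa> (N div q, N mod q) (M div p, M mod p)"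

definition leading_truncation :: "(nat \<Rightarrow> nat \<Rightarrow> complex) \<Rightarrow> nat \<Rightarrow> complex mat" where
  "leading_truncation X n = mat n n (\<lambda>(N, M). X N M)"


section \<open>Semi-infinite matrices and the recurrence matrix\<close>

text \<open>
  All products formed below have a row-finite left factor, so that the sum defining an entry has
  finitely many nonzero terms.
\<close>
definition sm_mult ::
    "(nat \<Rightarrow> nat \<Rightarrow> complex) \<Rightarrow> (nat \<Rightarrow> nat \<Rightarrow> complex) \<Rightarrow> nat \<Rightarrow> nat \<Rightarrow> complex" where
  "sm_mult X Y N M = Sum_any (\<lambda>k. X N k * Y k M)"

definition sm_one :: "nat \<Rightarrow> nat \<Rightarrow> complex" where
  "sm_one N M = of_bool (N = M)"

definition sm_transpose :: "(nat \<Rightarrow> nat \<Rightarrow> complex) \<Rightarrow> nat \<Rightarrow> nat \<Rightarrow> complex" where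
  "sm_transpose X N M = X M N"

definition lower_unitriangular :: "(nat \<Rightarrow> nat \<Rightarrow> complex) \<Rightarrow> bool" where
  "lower_unitriangular X \<longleftrightarrow> (\<forall>N. X N N = 1) \<and> (\<forall>N M. N < M \<longrightarrow> X N M = 0)"

definition sm_diagonal :: "(nat \<Rightarrow> nat \<Rightarrow> complex) \<Rightarrow> bool" where
  "sm_diagonal X \<longleftrightarrow> (\<forall>N M. N \<noteq> M \<longrightarrow> X N M = 0)"

text \<open>Only applied to lower unitriangular matrices, whose inverse is of the same kind and unique.\<close>
definition sm_inverse :: "(nat \<Rightarrow> nat \<Rightarrow> complex) \<Rightarrow> nat \<Rightarrow> nat \<Rightarrow> complex" where
  "sm_inverse X =
     (THE Y. lower_unitriangular Y \<and> sm_mult X Y = sm_one \<and> sm_mult Y X = sm_one)"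

text \<open>\<open>X = S\<^sup>-\<^sup>1 H S'\<^sup>-\<^sup>T\<close>\<close>
definition gauss_borel ::
    "(nat \<Rightarrow> nat \<Rightarrow> complex) \<Rightarrow> (nat \<Rightarrow> nat \<Rightarrow> complex) \<Rightarrow> (nat \<Rightarrow> nat \<Rightarrow> complex) \<Rightarrow>
     (nat \<Rightarrow> nat \<Rightarrow> complex) \<Rightarrow> bool" where
  "gauss_borel X S H S' \<longleftrightarrow>
     lower_unitriangular S \<and> sm_diagonal H \<and> lower_unitriangular S' \<and>
     X = sm_mult (sm_mult (sm_inverse S) H) (sm_transpose (sm_inverse S'))"

text \<open>Unique when all leading truncations of \<open>X\<close> are nonsingular.\<close>
definition gauss_borel_left :: "(nat \<Rightarrow> nat \<Rightarrow> complex) \<Rightarrow> nat \<Rightarrow> nat \<Rightarrow> complex" where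
  "gauss_borel_left X = (THE S. \<exists>H S'. gauss_borel X S H S')"

text \<open>
  Identity blocks of size \<open>q\<close> on the first block superdiagonal are ones at the positions
  \<open>(N, N + q)\<close>.
\<close>
definition block_shift :: "nat \<Rightarrow> nat \<Rightarrow> nat \<Rightarrow> complex" where
  "block_shift q N M = of_bool (M = N + q)"

definition recurrence_matrix ::
    "nat \<Rightarrow> nat \<Rightarrow> nat \<Rightarrow> (nat \<Rightarrow> complex) \<Rightarrow> (nat \<Rightarrow> complex) \<Rightarrow> (nat \<Rightarrow> complex) \<Rightarrow>
     nat \<Rightarrow> nat \<Rightarrow> complex" where
  "recurrence_matrix p q r a b \<kappa> =
     (let S = gauss_borel_left (moment_matrix p q r a b \<kappa>)
      in sm_mult (sm_mult S (block_shift q)) (sm_inverse S))"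

text \<open>\<open>t\<^bsub>N,k\<^esub> = T\<^bsub>N,N+k\<^esub>\<close>; only meaningful for \<open>N + k \<ge> 0\<close>.\<close>
definition band_entry :: "(nat \<Rightarrow> nat \<Rightarrow> complex) \<Rightarrow> nat \<Rightarrow> int \<Rightarrow> complex" where
  "band_entry T N k = T N (nat (int N + k))"


section \<open>The normalized vectors of type A\<close>

definition nu_A ::
    "nat \<Rightarrow> nat \<Rightarrow> nat \<Rightarrow> (nat \<Rightarrow> complex) \<Rightarrow> (nat \<Rightarrow> complex) \<Rightarrow> (nat \<Rightarrow> complex) \<Rightarrow>
     (nat \<Rightarrow> nat) \<Rightarrow> (nat \<Rightarrow> nat) \<Rightarrow> complex" where
  "nu_A p q r a b \<kappa> n m =
     (let mm = vmin q m; jm = first_min q m in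
      - (\<Prod>i<p. gpoch (\<kappa> i + b jm + of_nat mm + 1) (int (n i)))
      / ((\<Prod>\<rho><r. gpoch (a \<rho> - b jm - of_nat mm) (int mm))
         * (\<Prod>h | h < q \<and> m h = mm + 1. b h - b jm)))"

definition C_A ::
    "nat \<Rightarrow> nat \<Rightarrow> nat \<Rightarrow> (nat \<Rightarrow> complex) \<Rightarrow> (nat \<Rightarrow> complex) \<Rightarrow> (nat \<Rightarrow> complex) \<Rightarrow>
     (nat \<Rightarrow> nat) \<Rightarrow> (nat \<Rightarrow> nat) \<Rightarrow> nat \<Rightarrow> complex" where
  "C_A p q r a b \<kappa> n m i =
     (-1) ^ vsum p n
     * ((\<Prod>h<q. Gamma (\<kappa> i + b h + 1)) / (\<Prod>\<rho><r. Gamma (\<kappa> i + a \<rho> + 1)))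
     * ((\<Prod>j<q. gpoch (\<kappa> i + b j + 1) (int (m j)))
        / ((-1) ^ (n i - 1) * fact (n i - 1)
           * (\<Prod>l\<in>{..<p} - {i}. gpoch (\<kappa> i - \<kappa> l - of_nat (n l) + 1) (int (n l)))))"

definition A_vec ::
    "nat \<Rightarrow> nat \<Rightarrow> nat \<Rightarrow> (nat \<Rightarrow> complex) \<Rightarrow> (nat \<Rightarrow> complex) \<Rightarrow> (nat \<Rightarrow> complex) \<Rightarrow>
     (nat \<Rightarrow> nat) \<Rightarrow> (nat \<Rightarrow> nat) \<Rightarrow> nat \<Rightarrow> complex \<Rightarrow> complex" where
  "A_vec p q r a b \<kappa> n m i z =
     (if n i = 0 then 0 else
      nu_A p q r a b \<kappa> n m * C_A p q r a b \<kappa> n m i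
      * (\<Sum>k = 0..n i - 1.
           gpoch (1 - of_nat (n i)) (int k)
           * (\<Prod>h<q. gpoch (\<kappa> i + b h + of_nat (m h) + 1) (int k))
           * (\<Prod>l\<in>{..<p} - {i}. gpoch (\<kappa> i - \<kappa> l - of_nat (n l) + 1) (int k))
           / ((\<Prod>\<rho><r. gpoch (\<kappa> i + a \<rho> + 1) (int k))
              * (\<Prod>l\<in>{..<p} - {i}. gpoch (\<kappa> i - \<kappa> l + 1) (int k)))
           * (z ^ k / fact k)))"

definition A_step ::
    "nat \<Rightarrow> nat \<Rightarrow> nat \<Rightarrow> (nat \<Rightarrow> complex) \<Rightarrow> (nat \<Rightarrow> complex) \<Rightarrow> (nat \<Rightarrow> complex) \<Rightarrow>
     nat \<Rightarrow> nat \<Rightarrow> complex \<Rightarrow> complex" where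
  "A_step p q r a b \<kappa> N = A_vec p q r a b \<kappa> (stepline p (N + 1)) (stepline q N)"


section \<open>The pairing block\<close>

definition pairing_norm ::
    "nat \<Rightarrow> nat \<Rightarrow> nat \<Rightarrow> (nat \<Rightarrow> complex) \<Rightarrow> (nat \<Rightarrow> complex) \<Rightarrow> (nat \<Rightarrow> complex) \<Rightarrow>
     (nat \<Rightarrow> nat) \<Rightarrow> (nat \<Rightarrow> nat) \<Rightarrow> (nat \<Rightarrow> nat) \<Rightarrow> complex" where
  "pairing_norm p q r a b \<kappa> lam \<eta> \<mu> =
     (let em = vmin q \<eta>; jm = first_min q \<eta>; mp = vmax q \<mu>; jp = last_max q \<mu>; Kp = mp - 1 in
      (\<Prod>i<p. gpoch (\<kappa> i + (b jm + of_nat em + 1)) (int (lam i)))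
      * (\<Prod>\<rho><r. gpoch (a \<rho> - (b jp + of_nat Kp)) (int Kp))
      / ((\<Prod>\<rho><r. gpoch (a \<rho> - (b jm + of_nat em)) (int em))
         * (\<Prod>h | h < q \<and> \<eta> h = em + 1. b h - b jm))
      * (\<Prod>h | h < q \<and> h \<noteq> jp \<and> \<mu> h = mp. b h - b jp))"

definition pairing_ratio ::
    "nat \<Rightarrow> nat \<Rightarrow> (nat \<Rightarrow> complex) \<Rightarrow> (nat \<Rightarrow> complex) \<Rightarrow>
     (nat \<Rightarrow> nat) \<Rightarrow> (nat \<Rightarrow> nat) \<Rightarrow> nat \<Rightarrow> nat \<Rightarrow> complex" where
  "pairing_ratio p q b \<kappa> \<nu> \<mu> H K =
     (let jp = last_max q \<mu>; Kp = vmax q \<mu> - 1 in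
      (\<Prod>i<p. gpoch (\<kappa> i + (b H + of_nat K + 1)) (int (\<nu> i)))
      / (\<Prod>i<p. gpoch (\<kappa> i + (b jp + of_nat Kp + 1)) (int (\<nu> i))))"

text \<open>The summand for \<open>H = j\<close>.\<close>
definition S_diag ::
    "nat \<Rightarrow> nat \<Rightarrow> nat \<Rightarrow> (nat \<Rightarrow> complex) \<Rightarrow> (nat \<Rightarrow> complex) \<Rightarrow> (nat \<Rightarrow> complex) \<Rightarrow> nat \<Rightarrow>
     (nat \<Rightarrow> nat) \<Rightarrow> (nat \<Rightarrow> nat) \<Rightarrow> (nat \<Rightarrow> nat) \<Rightarrow> (nat \<Rightarrow> nat) \<Rightarrow>
     nat \<Rightarrow> nat \<Rightarrow> nat \<Rightarrow> nat \<Rightarrow> nat \<Rightarrow> complex" where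
  "S_diag p q r a b \<kappa> d lam \<eta> \<nu> \<mu> i H K \<alpha> \<beta> =
     (-1) powi (int (vsum p lam) - int (lam i) + int \<alpha> + int \<beta> - int K)
     / (fact \<alpha> * fact (lam i - 1 - \<alpha>) * fact (K - \<beta>) * fact (\<mu> H - K - 1))
     * ((\<Prod>\<rho><r. gpoch (\<kappa> i + a \<rho> + (of_nat \<alpha> + 1)) (int d + int \<beta>))
        * (\<Prod>\<rho><r. gpoch (a \<rho> - (b H + of_nat K) + (of_nat \<beta> + 1)) (int K - int \<beta>))
        / ((\<Prod>l\<in>{..<p} - {i}.
              gpoch (\<kappa> i - \<kappa> l - of_nat (lam l) + (of_nat \<alpha> + 1)) (int (lam l)))
           * (\<Prod>\<rho><r. gpoch (a \<rho> - (b H + of_nat K)) (int K))))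
     * pairing_ratio p q b \<kappa> \<nu> \<mu> H K
     * ((\<Prod>h<q. gpoch (\<kappa> i + b h + (of_nat d + of_nat \<alpha> + of_nat \<beta> + 1) + of_bool (h = H))
                   (int (\<eta> h) - (int d + int \<beta>) - of_bool (h = H)))
        / ((\<Prod>h\<in>{..<q} - {H}. gpoch (b h - b H) 1)
           * (\<Prod>h\<in>{..<q} - {H}. gpoch (b h - (b H + of_nat K) + (of_nat \<beta> + 1))
                                   (int (\<mu> h) - (int \<beta> + 1)))))"

text \<open>The summand for \<open>H \<noteq> j\<close>.\<close>
definition S_offdiag ::
    "nat \<Rightarrow> nat \<Rightarrow> nat \<Rightarrow> (nat \<Rightarrow> complex) \<Rightarrow> (nat \<Rightarrow> complex) \<Rightarrow> (nat \<Rightarrow> complex) \<Rightarrow> nat \<Rightarrow>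
     (nat \<Rightarrow> nat) \<Rightarrow> (nat \<Rightarrow> nat) \<Rightarrow> (nat \<Rightarrow> nat) \<Rightarrow> (nat \<Rightarrow> nat) \<Rightarrow>
     nat \<Rightarrow> nat \<Rightarrow> nat \<Rightarrow> nat \<Rightarrow> nat \<Rightarrow> nat \<Rightarrow> complex" where
  "S_offdiag p q r a b \<kappa> d lam \<eta> \<nu> \<mu> i j H K \<alpha> \<beta> =
     (-1) powi (int (vsum p lam) - int (lam i) + 1 + int \<alpha> + int K + int \<beta>)
     / (fact \<alpha> * fact (lam i - 1 - \<alpha>) * fact (K - 1 - \<beta>) * fact (\<mu> H - K - 1))
     * ((\<Prod>\<rho><r. gpoch (a \<rho> - b j) 1)
        * (\<Prod>\<rho><r. gpoch (\<kappa> i + a \<rho> + (of_nat \<alpha> + 1)) (int d + int \<beta>))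
        / ((\<Prod>l\<in>{..<p} - {i}.
              gpoch (\<kappa> i - \<kappa> l - of_nat (lam l) + (of_nat \<alpha> + 1)) (int (lam l)))
           * (\<Prod>\<rho><r. gpoch (a \<rho> - (b H + of_nat K)) (int \<beta> + 1))))
     * pairing_ratio p q b \<kappa> \<nu> \<mu> H K
     * ((\<Prod>h<q. gpoch (\<kappa> i + b h + (of_nat d + of_nat \<alpha> + of_nat \<beta> + 1) + of_bool (h = j))
                   (int (\<eta> h) - (int d + int \<beta>) - of_bool (h = j)))
        / ((\<Prod>h\<in>{..<q} - {j}. gpoch (b h - b j) 1)
           * (\<Prod>h\<in>{..<q} - {H}.
                gpoch (b h - (b H + of_nat K) + (of_nat \<beta> + 1) - of_bool (h = j))
                      (int (\<mu> h) - (int \<beta> + 1) + of_bool (h = j)))))"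

definition S_term ::
    "nat \<Rightarrow> nat \<Rightarrow> nat \<Rightarrow> (nat \<Rightarrow> complex) \<Rightarrow> (nat \<Rightarrow> complex) \<Rightarrow> (nat \<Rightarrow> complex) \<Rightarrow> nat \<Rightarrow>
     (nat \<Rightarrow> nat) \<Rightarrow> (nat \<Rightarrow> nat) \<Rightarrow> (nat \<Rightarrow> nat) \<Rightarrow> (nat \<Rightarrow> nat) \<Rightarrow>
     nat \<Rightarrow> nat \<Rightarrow> nat \<Rightarrow> nat \<Rightarrow> nat \<Rightarrow> nat \<Rightarrow> complex" where
  "S_term p q r a b \<kappa> d lam \<eta> \<nu> \<mu> i j H K \<alpha> \<beta> =
     (if \<alpha> < lam i \<and> H = j \<and> K < \<mu> H \<and> \<beta> \<le> K
      then S_diag p q r a b \<kappa> d lam \<eta> \<nu> \<mu> i H K \<alpha> \<beta>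
      else if \<alpha> < lam i \<and> H \<noteq> j \<and> 1 \<le> K \<and> K < \<mu> H \<and> \<beta> < K
      then S_offdiag p q r a b \<kappa> d lam \<eta> \<nu> \<mu> i j H K \<alpha> \<beta>
      else 0)"

text \<open>
  \<open>pairing_block p q r a b \<kappa> d lam \<eta> \<nu> \<mu>\<close> has the upper pair of multi-indices \<open>(lam, \<eta>)\<close> before
  the lower pair \<open>(\<nu>, \<mu>)\<close>. It is meant for \<open>|lam| = |\<eta>| + 1\<close>, \<open>|\<mu>| = |\<nu>| + 1\<close>, \<open>d \<le> 1\<close>.
\<close>
definition pairing_block ::
    "nat \<Rightarrow> nat \<Rightarrow> nat \<Rightarrow> (nat \<Rightarrow> complex) \<Rightarrow> (nat \<Rightarrow> complex) \<Rightarrow> (nat \<Rightarrow> complex) \<Rightarrow> nat \<Rightarrow>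
     (nat \<Rightarrow> nat) \<Rightarrow> (nat \<Rightarrow> nat) \<Rightarrow> (nat \<Rightarrow> nat) \<Rightarrow> (nat \<Rightarrow> nat) \<Rightarrow> complex" where
  "pairing_block p q r a b \<kappa> d lam \<eta> \<nu> \<mu> =
     pairing_norm p q r a b \<kappa> lam \<eta> \<mu>
     * (\<Sum>j<q. \<Sum>i<p. \<Sum>\<beta><\<mu> j. \<Sum>\<alpha><lam i. \<Sum>H<q. \<Sum>K<\<mu> H.
          S_term p q r a b \<kappa> d lam \<eta> \<nu> \<mu> i j H K \<alpha> \<beta>)"

end

theory Submission
  imports Defs
begin

text \<open>
  Put \<open>s = \<kappa> i + v\<close> and let \<open>W s\<close> be the quotient of products of Gamma values, so that the moments
  are \<open>W (s + u) / (s + u + b j + 1)\<close>. Dividing by \<open>W s\<close> turns both orthogonality problems into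
  statements about rational functions of \<open>s\<close>. On the type A side the coefficients times \<open>W\<close> are the
  values of a polynomial over the derivative of the node polynomial at the nodes \<open>\<kappa> i + v\<close>, so that
  orthogonality is the vanishing of a divided difference and the normalization is the residue at the
  single remaining pole. On the type B side the linear form divided by \<open>W\<close> has poles
  \<open>- b H - K - 1\<close> and must vanish at the nodes, which determines its partial fractions; each partial
  fraction is telescoped into the moment functions.

  The resulting systems are biorthogonal, hence they realise the Gauss--Borel factorization: the rows
  of \<open>S\<close> are the type B coefficients, the moment matrix applied to the type A coefficients is the
  inverse of \<open>S\<close>, and the entries of \<open>T\<close> are pairings of \<open>z\<close> times type B with type A. The pairing
  block is this pairing, term by term. The Hankel symmetry of the moments gives the dual recurrence.
\<close>

section \<open>Semi-infinite matrices\<close>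

text \<open>The inequality r < q acts at three places: the coefficients of the weights are
  absolutely summable, the quotient of the factors t + a + 1 by the factors t + b + 1 has no
  polynomial part and is determined by its residues, and the degrees in the type A sums stay below
  the number of nodes. On the type B side N zeros at nodes face N + 1 poles, which leaves one free
  scalar; leading coefficient 1, forced by unitriangularity of \<open>S\<close>, fixes it. The
  constant in front of the pairing block comes from there: it is minus the type A constant over the
  type B leading coefficient, except that one product over the \<kappa> is kept in the summands.
  \<open>S\<close> and its inverse are given by descriptions, so their entries become accessible
  only through uniqueness: a biorthogonal partner exhibits the inverse, and any other left factor
  must coincide with \<open>S\<close>. The first minimum of the step-line vector at N and the last
  maximum of the one at N + 1 are both the component N mod q. Hence the pole left over in the type A
  normalization and the leading type B coefficient belong to the same position N.\<close>

definition lower_triangular :: "(nat \<Rightarrow> nat \<Rightarrow> complex) \<Rightarrow> bool" where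
  "lower_triangular X \<longleftrightarrow> (\<forall>N M. N < M \<longrightarrow> X N M = 0)"

lemma lower_unitriangular_imp_lower_triangular: "lower_unitriangular X \<Longrightarrow> lower_triangular X"
  by (simp add: lower_unitriangular_def lower_triangular_def)

lemma sm_diagonal_imp_lower_triangular: "sm_diagonal X \<Longrightarrow> lower_triangular X"
  by (simp add: sm_diagonal_def lower_triangular_def)

lemma lower_triangular_sm_one: "lower_triangular sm_one"
  by (simp add: sm_one_def lower_triangular_def)

lemma sm_mult_eq_sum:
  assumes "\<And>k. k \<ge> n \<Longrightarrow> X N k = 0"
  shows "sm_mult X Y N M = (\<Sum>k<n. X N k * Y k M)"
  unfolding sm_mult_def
proof (rule Sum_any.expand_superset)
  show "{k. X N k * Y k M \<noteq> 0} \<subseteq> {..<n}"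
    using assms by (auto simp: not_le intro: ccontr)
qed simp

lemma sm_mult_lower:
  assumes "lower_triangular X" "N < n"
  shows "sm_mult X Y N M = (\<Sum>k<n. X N k * Y k M)"
  using assms by (intro sm_mult_eq_sum) (auto simp: lower_triangular_def)

lemma lower_triangular_sm_mult:
  assumes "lower_triangular X" "lower_triangular Y"
  shows "lower_triangular (sm_mult X Y)"
  unfolding lower_triangular_def
proof (intro allI impI)
  fix N M :: nat assume "N < M"
  have "sm_mult X Y N M = (\<Sum>k<Suc N. X N k * Y k M)"
    using assms by (intro sm_mult_lower) auto
  also have "\<dots> = 0"
    using assms \<open>N < M\<close> by (intro sum.neutral) (auto simp: lower_triangular_def)
  finally show "sm_mult X Y N M = 0" .
qed

text \<open>Row-finiteness of the two left factors already makes all sums finite, so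
  \<open>Z\<close> is arbitrary. This allows full matrices such as the moment matrix on the
  right.\<close>

lemma sm_mult_assoc:
  assumes "lower_triangular X" "lower_triangular Y"
  shows "sm_mult (sm_mult X Y) Z = sm_mult X (sm_mult Y Z)"
proof (intro ext)
  fix N M
  let ?n = "Suc N"
  have "sm_mult (sm_mult X Y) Z N M = (\<Sum>k<?n. sm_mult X Y N k * Z k M)"
    using assms by (intro sm_mult_lower lower_triangular_sm_mult) auto
  also have "\<dots> = (\<Sum>k<?n. (\<Sum>l<?n. X N l * Y l k) * Z k M)"
    using assms by (intro sum.cong refl arg_cong2[where f = "(*)"] sm_mult_lower) auto
  also have "\<dots> = (\<Sum>l<?n. X N l * (\<Sum>k<?n. Y l k * Z k M))"
    by (simp only: sum_distrib_left sum_distrib_right mult.assoc) (rule sum.swap)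
  also have "\<dots> = (\<Sum>l<?n. X N l * sm_mult Y Z l M)"
    using assms by (intro sum.cong refl arg_cong2[where f = "(*)"] sm_mult_lower[symmetric]) auto
  also have "\<dots> = sm_mult X (sm_mult Y Z) N M"
    using assms by (intro sm_mult_lower[symmetric]) auto
  finally show "sm_mult (sm_mult X Y) Z N M = sm_mult X (sm_mult Y Z) N M" .
qed

lemma sm_mult_one_left [simp]: "sm_mult sm_one X = X"
proof (intro ext)
  fix N M
  have "sm_mult sm_one X N M = (\<Sum>k<Suc N. if k = N then X k M else 0)"
    by (subst sm_mult_lower[where n = "Suc N"])
      (auto simp: lower_triangular_sm_one sm_one_def intro!: sum.cong)
  then show "sm_mult sm_one X N M = X N M"
    by simp
qed

lemma sm_mult_one_right:
  assumes "lower_triangular X"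
  shows "sm_mult X sm_one = X"
proof (intro ext)
  fix N M
  have "sm_mult X sm_one N M = (\<Sum>k<Suc (N + M). if k = M then X N k else 0)"
    using assms
    by (subst sm_mult_lower[where n = "Suc (N + M)"]) (auto simp: sm_one_def intro!: sum.cong)
  then show "sm_mult X sm_one N M = X N M"
    by simp
qed

section \<open>Inverses of lower unitriangular matrices\<close>

fun forward_substitution :: "(nat \<Rightarrow> nat \<Rightarrow> complex) \<Rightarrow> nat \<Rightarrow> nat \<Rightarrow> complex" where
  "forward_substitution X N M = of_bool (N = M) - (\<Sum>k<N. X N k * forward_substitution X k M)"

declare forward_substitution.simps [simp del]

lemma forward_substitution_upper: "N < M \<Longrightarrow> forward_substitution X N M = 0"
proof (induction N rule: less_induct)
  case (less N)
  then show ?case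
    by (subst forward_substitution.simps) (auto intro!: sum.neutral)
qed

lemma lower_unitriangular_forward_substitution: "lower_unitriangular (forward_substitution X)"
  unfolding lower_unitriangular_def
proof (intro conjI allI impI)
  fix N
  show "forward_substitution X N N = 1"
    by (subst forward_substitution.simps) (auto intro!: sum.neutral simp: forward_substitution_upper)
qed (rule forward_substitution_upper)

lemma sm_mult_forward_substitution:
  assumes "lower_unitriangular X"
  shows "sm_mult X (forward_substitution X) = sm_one"
proof (intro ext)
  fix N M
  have "sm_mult X (forward_substitution X) N M =
      (\<Sum>k<Suc N. X N k * forward_substitution X k M)"
    using assms by (intro sm_mult_lower lower_unitriangular_imp_lower_triangular) auto
  also have "\<dots> = (\<Sum>k<N. X N k * forward_substitution X k M) + forward_substitution X N M"
    using assms by (simp add: lower_unitriangular_def)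
  also have "\<dots> = sm_one N M"
    by (subst (2) forward_substitution.simps) (simp add: sm_one_def)
  finally show "sm_mult X (forward_substitution X) N M = sm_one N M" .
qed

text \<open>The right inverse \<open>?Y\<close> has a right inverse \<open>?Z\<close> of its own,
  and associativity forces \<open>X = ?Z\<close>.\<close>

lemma sm_mult_forward_substitution_left:
  assumes "lower_unitriangular X"
  shows "sm_mult (forward_substitution X) X = sm_one"
proof -
  let ?Y = "forward_substitution X"
  let ?Z = "forward_substitution ?Y"
  have low: "lower_triangular X" "lower_triangular ?Y"
    using assms by (auto intro: lower_unitriangular_imp_lower_triangular
        lower_unitriangular_forward_substitution)
  have YZ: "sm_mult ?Y ?Z = sm_one"
    by (intro sm_mult_forward_substitution lower_unitriangular_forward_substitution)
  have "X = sm_mult X (sm_mult ?Y ?Z)"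
    using low by (simp add: YZ sm_mult_one_right)
  also have "\<dots> = sm_mult (sm_mult X ?Y) ?Z"
    using low by (simp add: sm_mult_assoc)
  finally have "X = ?Z"
    using assms by (simp add: sm_mult_forward_substitution)
  then show ?thesis
    using YZ by simp
qed

text \<open>Reduces the two-sided description behind \<open>sm_inverse\<close> to a one-sided
  check.\<close>

lemma sm_inverse_unique:
  assumes "lower_unitriangular X" "lower_unitriangular Y" "sm_mult X Y = sm_one"
  shows "sm_inverse X = Y"
proof -
  have uniq: "Z = forward_substitution X"
    if "lower_unitriangular Z" "sm_mult X Z = sm_one" for Z
  proof -
    have "Z = sm_mult (sm_mult (forward_substitution X) X) Z"
      using assms(1) by (simp add: sm_mult_forward_substitution_left)
    also have "\<dots> = sm_mult (forward_substitution X) (sm_mult X Z)"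
      using assms(1) by (intro sm_mult_assoc lower_unitriangular_imp_lower_triangular
          lower_unitriangular_forward_substitution)
    also have "\<dots> = forward_substitution X"
      unfolding that(2) by (intro sm_mult_one_right lower_unitriangular_imp_lower_triangular
          lower_unitriangular_forward_substitution)
    finally show ?thesis .
  qed
  show ?thesis
    unfolding sm_inverse_def
  proof (rule the_equality)
    show "lower_unitriangular Y \<and> sm_mult X Y = sm_one \<and> sm_mult Y X = sm_one"
      using assms uniq[of Y] sm_mult_forward_substitution_left[of X] by simp
  next
    fix Z assume "lower_unitriangular Z \<and> sm_mult X Z = sm_one \<and> sm_mult Z X = sm_one"
    then show "Z = Y"
      using uniq[of Y] uniq[of Z] assms by simp
  qed
qed

lemma
  assumes "lower_unitriangular X"
  shows lower_unitriangular_sm_inverse: "lower_unitriangular (sm_inverse X)"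
    and sm_mult_inverse_right: "sm_mult X (sm_inverse X) = sm_one"
    and sm_mult_inverse_left: "sm_mult (sm_inverse X) X = sm_one"
proof -
  have "sm_inverse X = forward_substitution X"
    using assms by (intro sm_inverse_unique lower_unitriangular_forward_substitution
        sm_mult_forward_substitution)
  then show "lower_unitriangular (sm_inverse X)" "sm_mult X (sm_inverse X) = sm_one"
      "sm_mult (sm_inverse X) X = sm_one"
    using assms by (auto simp: lower_unitriangular_forward_substitution
        sm_mult_forward_substitution sm_mult_forward_substitution_left)
qed

lemma sm_inverse_inverse:
  assumes "lower_unitriangular X"
  shows "sm_inverse (sm_inverse X) = X"
  using assms by (intro sm_inverse_unique lower_unitriangular_sm_inverse sm_mult_inverse_left)

text \<open>
  \<open>S\<close> collects the coefficient rows of monic polynomial vectors and \<open>A\<close> those of their duals;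
  biorthogonality exhibits the inverse of \<open>S\<close> as a product of the moment matrix \<open>X\<close> with \<open>A\<close>.
\<close>
locale biorthogonal_system =
  fixes X S A :: "nat \<Rightarrow> nat \<Rightarrow> complex"
  assumes S: "lower_unitriangular S"
    and S_orth: "v < N \<Longrightarrow> (\<Sum>L<Suc N. S N L * X L v) = 0"
    and A: "lower_triangular A"
    and A_orth: "L < N \<Longrightarrow> (\<Sum>v<Suc N. X L v * A N v) = 0"
    and A_norm: "(\<Sum>v<Suc N. X N v * A N v) = 1"
begin

lemma S_lower: "lower_triangular S"
  using S by (rule lower_unitriangular_imp_lower_triangular)

text \<open>The product of \<open>X\<close> with the transpose of \<open>A\<close>. It is lower
  unitriangular by biorthogonality, although \<open>X\<close> is a full matrix.\<close>

definition Y :: "nat \<Rightarrow> nat \<Rightarrow> complex" where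
  "Y L M = (\<Sum>v<Suc M. X L v * A M v)"

lemma Y_eq: "M < n \<Longrightarrow> Y L M = (\<Sum>v<n. X L v * A M v)"
  unfolding Y_def using A by (intro sum.mono_neutral_left) (auto simp: lower_triangular_def)

lemma Y_unitriangular: "lower_unitriangular Y"
  unfolding lower_unitriangular_def Y_def using A_orth A_norm by auto

text \<open>Below the diagonal the product is regrouped so that \<open>S\<close> meets
  \<open>X\<close> first and \<open>S_orth\<close> applies; elsewhere triangularity of
  \<open>Y\<close> leaves one term.\<close>

lemma sm_mult_S_Y: "sm_mult S Y = sm_one"
proof (intro ext)
  fix N M
  have eq: "sm_mult S Y N M = (\<Sum>L<Suc N. S N L * Y L M)"
    using S_lower by (intro sm_mult_lower) auto
  show "sm_mult S Y N M = sm_one N M"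
  proof (cases "M < N")
    case True
    have "sm_mult S Y N M = (\<Sum>v<Suc M. (\<Sum>L<Suc N. S N L * X L v) * A M v)"
      unfolding eq Y_def
      by (simp only: sum_distrib_left sum_distrib_right mult.assoc) (rule sum.swap)
    also have "\<dots> = 0"
      using True S_orth by (intro sum.neutral) auto
    finally show ?thesis
      using True by (simp add: sm_one_def)
  next
    case False
    have "(\<Sum>L<N. S N L * Y L M) = 0"
      using False Y_unitriangular by (intro sum.neutral) (auto simp: lower_unitriangular_def)
    then have "sm_mult S Y N M = Y N M"
      using S by (simp add: eq lower_unitriangular_def)
    then show ?thesis
      using False Y_unitriangular
      by (cases "N = M") (auto simp: sm_one_def lower_unitriangular_def)
  qed
qed

lemma sm_inverse_S: "sm_inverse S = Y"
  by (intro sm_inverse_unique S Y_unitriangular sm_mult_S_Y)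

lemma sm_mult_S_X_upper: "v < N \<Longrightarrow> sm_mult S X N v = 0"
  using sm_mult_lower[OF S_lower, of N "Suc N"] S_orth by simp

text \<open>\<open>S\<close> times \<open>X\<close> is upper and \<open>A\<close> lower triangular,
  so the diagonal entry 1 of \<open>S\<close> times \<open>Y\<close> is this pivot times
  \<open>A N N\<close>.\<close>

lemma sm_mult_S_X_diag: "sm_mult S X N N \<noteq> 0"
proof -
  have "1 = (\<Sum>L<Suc N. S N L * Y L N)"
    using sm_mult_lower[OF S_lower, of N "Suc N" Y N] fun_cong[OF fun_cong[OF sm_mult_S_Y], of N N]
    by (simp add: sm_one_def)
  also have "\<dots> = (\<Sum>v<Suc N. sm_mult S X N v * A N v)"
    unfolding Y_def sm_mult_lower[OF S_lower lessI]
    by (simp only: sum_distrib_left sum_distrib_right mult.assoc) (rule sum.swap)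
  also have "\<dots> = sm_mult S X N N * A N N"
    using sm_mult_S_X_upper by simp
  finally show ?thesis
    by auto
qed

text \<open>Back substitution from the last index downwards, since \<open>S\<close> times
  \<open>X\<close> is upper triangular with nonzero pivots.\<close>

lemma null_vector:
  assumes D: "\<And>v. v \<ge> n \<Longrightarrow> D v = 0" and null: "\<And>L. (\<Sum>v<n. X L v * D v) = 0"
  shows "D v = 0"
proof (induction "n - v" arbitrary: v rule: less_induct)
  case less
  show ?case
  proof (cases "v < n")
    case True
    have "0 = (\<Sum>L<Suc v. S v L * (\<Sum>w<n. X L w * D w))"
      by (simp add: null)
    also have "\<dots> = (\<Sum>w<n. sm_mult S X v w * D w)"
      unfolding sm_mult_lower[OF S_lower lessI]
      by (simp only: sum_distrib_left sum_distrib_right mult.assoc) (rule sum.swap)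
    also have "\<dots> = (\<Sum>w<n. if w = v then sm_mult S X v v * D v else 0)"
    proof (intro sum.cong refl)
      fix w assume "w \<in> {..<n}"
      then show "sm_mult S X v w * D w = (if w = v then sm_mult S X v v * D v else 0)"
        using less[of w] sm_mult_S_X_upper[of w v] by (cases w v rule: linorder_cases) auto
    qed
    also have "\<dots> = sm_mult S X v v * D v"
      using True by simp
    finally show ?thesis
      using sm_mult_S_X_diag[of v] by simp
  qed (use D in auto)
qed

section \<open>Existence and uniqueness of the Gauss-Borel factorization\<close>

definition pivot :: "nat \<Rightarrow> nat \<Rightarrow> complex" where
  "pivot N M = (if N = M then sm_mult S X N N else 0)"

definition right_factor :: "nat \<Rightarrow> nat \<Rightarrow> complex" where
  "right_factor M N = sm_mult S X N M / sm_mult S X N N"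

lemma right_factor_unitriangular: "lower_unitriangular right_factor"
  using sm_mult_S_X_diag sm_mult_S_X_upper
  by (auto simp: lower_unitriangular_def right_factor_def)

lemma pivot_mult: "sm_mult pivot Z N M = sm_mult S X N N * Z N M"
proof -
  have "sm_mult pivot Z N M = (\<Sum>k<Suc N. pivot N k * Z k M)"
    by (intro sm_mult_lower sm_diagonal_imp_lower_triangular) (auto simp: sm_diagonal_def pivot_def)
  also have "\<dots> = (\<Sum>k<Suc N. if k = N then sm_mult S X N N * Z N M else 0)"
    by (intro sum.cong) (auto simp: pivot_def)
  finally show ?thesis
    by simp
qed

text \<open>\<open>gauss_borel\<close> inverts its last factor, so the inverse of
  \<open>right_factor\<close> is supplied and the two inversions cancel.\<close>

lemma gauss_borel_S: "gauss_borel X S pivot (sm_inverse right_factor)"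
proof -
  have Sinv: "lower_triangular (sm_inverse S)"
    using S by (intro lower_unitriangular_imp_lower_triangular lower_unitriangular_sm_inverse)
  have diag: "sm_diagonal pivot"
    by (auto simp: sm_diagonal_def pivot_def)
  have "sm_mult pivot (sm_transpose right_factor) = sm_mult S X"
    using sm_mult_S_X_diag
    by (intro ext) (simp add: pivot_mult sm_transpose_def right_factor_def)
  then have "sm_mult (sm_mult (sm_inverse S) pivot) (sm_transpose right_factor) =
      sm_mult (sm_inverse S) (sm_mult S X)"
    using Sinv diag by (simp add: sm_mult_assoc sm_diagonal_imp_lower_triangular)
  also have "\<dots> = X"
    using sm_mult_assoc[OF Sinv S_lower, of X] S by (simp add: sm_mult_inverse_left)
  finally have "sm_mult (sm_mult (sm_inverse S) pivot) (sm_transpose right_factor) = X" .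
  then show ?thesis
    using S diag right_factor_unitriangular
    by (simp add: gauss_borel_def lower_unitriangular_sm_inverse sm_inverse_inverse)
qed

text \<open>Another left factor \<open>Z\<close> is compared with \<open>S\<close> through
  \<open>L\<close>, the product of \<open>Z\<close> with the inverse of \<open>S\<close>.
  \<open>L\<close> is lower triangular, while \<open>L\<close> times the upper triangular
  \<open>S X\<close> is the upper triangular \<open>Z X\<close>; with nonzero pivots this forces
  \<open>L\<close> to be the identity.\<close>

lemma gauss_borel_left_eq: "gauss_borel_left X = S"
  unfolding gauss_borel_left_def
proof (rule the_equality)
  show "\<exists>H S'. gauss_borel X S H S'"
    using gauss_borel_S by blast
next
  fix Z assume "\<exists>H S'. gauss_borel X Z H S'"
  then obtain H S' where Z: "lower_unitriangular Z" and H: "sm_diagonal H"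
    and S': "lower_unitriangular S'"
    and X: "X = sm_mult (sm_mult (sm_inverse Z) H) (sm_transpose (sm_inverse S'))"
    by (auto simp: gauss_borel_def)
  have Zlow: "lower_triangular Z" "lower_triangular (sm_inverse Z)"
    using Z by (auto intro: lower_unitriangular_imp_lower_triangular lower_unitriangular_sm_inverse)
  have "sm_mult Z X = sm_mult (sm_mult (sm_mult Z (sm_inverse Z)) H) (sm_transpose (sm_inverse S'))"
    by (subst X) (use Zlow H in \<open>simp add: sm_mult_assoc lower_triangular_sm_mult
        sm_diagonal_imp_lower_triangular\<close>)
  then have ZX: "sm_mult Z X = sm_mult H (sm_transpose (sm_inverse S'))"
    using Z by (simp add: sm_mult_inverse_right)
  have ZX_upper: "sm_mult Z X N v = 0" if "v < N" for N v
  proof -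
    have "sm_mult Z X N v = (\<Sum>k<Suc N. H N k * sm_inverse S' v k)"
      unfolding ZX using H
      by (subst sm_mult_lower[where n = "Suc N"])
        (auto simp: sm_transpose_def sm_diagonal_imp_lower_triangular)
    also have "\<dots> = 0"
      using H lower_unitriangular_sm_inverse[OF S'] that
      by (intro sum.neutral) (auto simp: sm_diagonal_def lower_unitriangular_def less_Suc_eq)
    finally show ?thesis .
  qed
  define L where "L = sm_mult Z (sm_inverse S)"
  have Slow: "lower_triangular (sm_inverse S)"
    using S by (intro lower_unitriangular_imp_lower_triangular lower_unitriangular_sm_inverse)
  have Llow: "lower_triangular L"
    unfolding L_def using Zlow Slow by (intro lower_triangular_sm_mult)
  have LS: "sm_mult L S = Z"
    unfolding L_def using Zlow Slow S
    by (simp add: sm_mult_assoc sm_mult_inverse_left sm_mult_one_right)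
  have LSX: "sm_mult L (sm_mult S X) = sm_mult Z X"
    using sm_mult_assoc[OF Llow S_lower, of X] LS by simp
  \<comment> \<open>Columns are treated from left to right: indices k < v drop out by induction,
    indices k > v because \<open>S X\<close> is upper triangular.\<close>
  have L0: "L N v = 0" if "v < N" for N v
    using that
  proof (induction v rule: less_induct)
    case (less v)
    have "0 = sm_mult L (sm_mult S X) N v"
      using ZX_upper less.prems by (simp add: LSX)
    also have "\<dots> = (\<Sum>k<Suc N. L N k * sm_mult S X k v)"
      using Llow by (intro sm_mult_lower) auto
    also have "\<dots> = (\<Sum>k<Suc N. if k = v then L N v * sm_mult S X v v else 0)"
    proof (intro sum.cong refl)
      fix k
      show "L N k * sm_mult S X k v = (if k = v then L N v * sm_mult S X v v else 0)"
        using less sm_mult_S_X_upper[of v k] by (cases k v rule: linorder_cases) auto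
    qed
    also have "\<dots> = L N v * sm_mult S X v v"
      using less.prems by simp
    finally show ?case
      using sm_mult_S_X_diag[of v] by simp
  qed
  have L1: "L N N = 1" for N
  proof -
    have "Z N N = (\<Sum>k<Suc N. L N k * S k N)"
      unfolding LS[symmetric] using Llow by (intro sm_mult_lower) auto
    also have "\<dots> = L N N"
      using L0 S by (simp add: lower_unitriangular_def)
    finally show ?thesis
      using Z by (simp add: lower_unitriangular_def)
  qed
  have "L = sm_one"
  proof (intro ext)
    fix N M show "L N M = sm_one N M"
      using L0 L1 Llow by (cases N M rule: linorder_cases) (auto simp: sm_one_def lower_triangular_def)
  qed
  then show "Z = S"
    using LS by simp
qed

text \<open>Row \<open>N\<close> of \<open>S\<close> shifted by \<open>q\<close> positions is the
  coefficient row of z times the type B vector; its support is finite, so pairing it with the dual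
  vectors is a finite sum.\<close>

lemma shifted_eq:
  assumes "T = sm_mult (sm_mult S (block_shift q)) (sm_inverse S)"
  shows "T N M = (\<Sum>L<Suc N. S N L * Y (L + q) M)"
proof -
  have SL: "sm_mult S (block_shift q) N k = (if q \<le> k then S N (k - q) else 0)" for N k
  proof -
    have "sm_mult S (block_shift q) N k = (\<Sum>L<Suc (N + k). S N L * block_shift q L k)"
      using S_lower by (intro sm_mult_lower) auto
    also have "\<dots> = (\<Sum>L<Suc (N + k). if L = k - q then S N L * of_bool (q \<le> k) else 0)"
      by (intro sum.cong refl) (auto simp: block_shift_def)
    also have "\<dots> = S N (k - q) * of_bool (q \<le> k)"
      by (subst sum.delta) auto
    finally show ?thesis
      by simp
  qed
  have "T N M = (\<Sum>k<Suc N + q. sm_mult S (block_shift q) N k * Y k M)"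
    unfolding assms sm_inverse_S
  proof (rule sm_mult_eq_sum)
    fix k assume "k \<ge> Suc N + q"
    then show "sm_mult S (block_shift q) N k = 0"
      using S_lower by (auto simp: SL lower_triangular_def)
  qed
  also have "\<dots> = (\<Sum>k\<in>{q..<Suc N + q}. S N (k - q) * Y k M)"
    by (rule sum.mono_neutral_cong_right) (auto simp: SL)
  also have "\<dots> = (\<Sum>L<Suc N. S N L * Y (L + q) M)"
    by (rule sum.reindex_bij_witness[where i = "\<lambda>L. L + q" and j = "\<lambda>k. k - q"]) auto
  finally show ?thesis .
qed

lemma shifted_eq_sm_mult:
  assumes "T = sm_mult (sm_mult S (block_shift q)) (sm_inverse S)"
  shows "T = sm_mult S (\<lambda>L. Y (L + q))"
  using S_lower by (intro ext) (simp only: shifted_eq[OF assms] sm_mult_lower[OF _ lessI])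

text \<open>
  The Hankel symmetry turns multiplication by \<open>z\<close> on the dual side, a shift by \<open>p\<close> columns, into
  the shift by \<open>q\<close> rows that defines \<open>T\<close>.
\<close>
context
  fixes T :: "nat \<Rightarrow> nat \<Rightarrow> complex" and p q :: nat
  assumes T: "T = sm_mult (sm_mult S (block_shift q)) (sm_inverse S)"
    and hankel: "\<And>L v. X (L + q) v = X L (v + p)"
begin

lemma T_below_band:
  assumes "M + q < N"
  shows "T M N = 0"
  unfolding shifted_eq[OF T]
  using assms Y_unitriangular by (intro sum.neutral) (auto simp: lower_unitriangular_def)

text \<open>The Hankel symmetry moves the shift from rows to columns, where upper triangularity of
  \<open>S\<close> times \<open>X\<close> annihilates every column v + p < M.\<close>

lemma T_above_band:
  assumes "N + p < M"
  shows "T M N = 0"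
proof -
  have "T M N = (\<Sum>v<Suc N. sm_mult S X M (v + p) * A N v)"
    unfolding shifted_eq[OF T] Y_def hankel sm_mult_lower[OF S_lower lessI]
    by (simp only: sum_distrib_left sum_distrib_right mult.assoc) (rule sum.swap)
  also have "\<dots> = 0"
    using assms sm_mult_S_X_upper by (intro sum.neutral) auto
  finally show ?thesis .
qed

text \<open>Both sides are finitely supported vectors with the same image under \<open>X\<close>:
  the left one by the Hankel symmetry, the right one because \<open>Y\<close> inverts
  \<open>S\<close>. On such vectors \<open>X\<close> is injective by
  \<open>null_vector\<close>.\<close>

lemma dual_recurrence:
  "(if p \<le> v then A N (v - p) else 0) = (\<Sum>M<Suc (N + p). T M N * A M v)"
proof -
  \<comment> \<open>One past the last index of all supports: shifting row \<open>N\<close> of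
    \<open>A\<close> by \<open>p\<close> reaches N + p, as do the rows M <= N + p.\<close>
  define n where "n = Suc (N + p)"
  define Z where "Z = (\<lambda>L. Y (L + q))"
  define D where "D = (\<lambda>v. (if p \<le> v then A N (v - p) else 0) - (\<Sum>M<n. T M N * A M v))"
  have Ylow: "lower_triangular Y"
    using Y_unitriangular by (rule lower_unitriangular_imp_lower_triangular)
  have "sm_mult Y S = sm_one"
    using sm_mult_inverse_left[OF S] by (simp add: sm_inverse_S)
  then have YT: "sm_mult Y T = Z"
    using sm_mult_assoc[OF Ylow S_lower, of Z] by (simp add: shifted_eq_sm_mult[OF T] Z_def)
  have "D v = 0"
  proof (rule null_vector)
    fix v assume "n \<le> v"
    then show "D v = 0"
      using A by (auto simp: D_def n_def lower_triangular_def intro!: sum.neutral)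
  next
    fix L
    have "(\<Sum>v<n. X L v * (if p \<le> v then A N (v - p) else 0)) =
        (\<Sum>v\<in>{p..<n}. X L v * A N (v - p))"
      by (rule sum.mono_neutral_cong_right) auto
    also have "\<dots> = (\<Sum>v<Suc N. X L (v + p) * A N v)"
      by (rule sum.reindex_bij_witness[where i = "\<lambda>v. v + p" and j = "\<lambda>v. v - p"])
        (auto simp: n_def)
    finally have shift: "(\<Sum>v<n. X L v * (if p \<le> v then A N (v - p) else 0)) = Z L N"
      by (simp add: Z_def Y_def hankel)
    have "(\<Sum>v<n. X L v * (\<Sum>M<n. T M N * A M v)) = (\<Sum>M<n. (\<Sum>v<n. X L v * A M v) * T M N)"
      by (simp only: sum_distrib_left sum_distrib_right mult_ac) (rule sum.swap)
    also have "\<dots> = (\<Sum>M<n. Y L M * T M N)"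
      by (intro sum.cong refl) (auto simp: Y_eq[of _ n])
    \<comment> \<open>The added terms vanish by \<open>T_above_band\<close>; the longer range covers
      the whole support of row \<open>L\<close> of \<open>Y\<close>.\<close>
    also have "\<dots> = (\<Sum>M<n + Suc L. Y L M * T M N)"
      by (rule sum.mono_neutral_left) (auto simp: T_above_band n_def)
    also have "\<dots> = sm_mult Y T L N"
      using Ylow by (intro sm_mult_lower[symmetric]) auto
    finally have "(\<Sum>v<n. X L v * (\<Sum>M<n. T M N * A M v)) = Z L N"
      by (simp add: YT)
    then show "(\<Sum>v<n. X L v * D v) = 0"
      using shift by (simp add: D_def right_diff_distrib sum_subtractf)
  qed
  then show ?thesis
    by (simp add: D_def n_def)
qed

end

end

section \<open>Lagrange interpolation\<close>

text \<open>The points are an injective family instead of a set, because nodes and poles will be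
  indexed by pairs.\<close>

lemma lagrange_interpolation:
  fixes f :: "'i \<Rightarrow> complex"
  assumes "finite I" "inj_on f I" "degree P < card I"
  shows "poly P x =
    (\<Sum>i\<in>I. poly P (f i) / (\<Prod>k\<in>I - {i}. f i - f k) * (\<Prod>k\<in>I - {i}. x - f k))"
proof -
  define L where "L = (\<Sum>i\<in>I. Polynomial.smult (poly P (f i) / (\<Prod>k\<in>I - {i}. f i - f k))
    (\<Prod>k\<in>I - {i}. [:- f k, 1:]))"
  have polyL: "poly L x =
      (\<Sum>i\<in>I. poly P (f i) / (\<Prod>k\<in>I - {i}. f i - f k) * (\<Prod>k\<in>I - {i}. x - f k))" for x
    by (simp add: L_def poly_sum poly_prod algebra_simps)
  have card: "card (f ` I) = card I"
    using assms by (simp add: card_image)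
  have I: "I \<noteq> {}"
    using assms(3) by auto
  have "P = L"
  proof (rule poly_eqI_degree)
    fix x assume "x \<in> f ` I"
    then obtain i where i: "i \<in> I" "x = f i"
      by auto
    have "poly L x = (\<Sum>l\<in>I. if l = i then poly P (f i) else 0)"
      unfolding polyL
    proof (intro sum.cong refl)
      fix l assume l: "l \<in> I"
      show "poly P (f l) / (\<Prod>k\<in>I - {l}. f l - f k) * (\<Prod>k\<in>I - {l}. x - f k) =
          (if l = i then poly P (f i) else 0)"
      proof (cases "l = i")
        case True
        have "(\<Prod>k\<in>I - {i}. f i - f k) \<noteq> 0"
          using assms i by (auto simp: inj_on_def)
        then show ?thesis
          using True i by simp
      next
        case False
        then have "(\<Prod>k\<in>I - {l}. x - f k) = 0"
          using assms(1) i by (auto intro!: prod_zero)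
        then show ?thesis
          using False by simp
      qed
    qed
    then show "poly P x = poly L x"
      using i assms(1) by simp
  next
    have deg: "degree (Polynomial.smult c (\<Prod>k\<in>I - {i}. [:- f k, 1:])) \<le> card I - 1"
      if "i \<in> I" for i c
    proof -
      have "degree (\<Prod>k\<in>I - {i}. [:- f k, 1:]) \<le> sum (degree \<circ> (\<lambda>k. [:- f k, 1:])) (I - {i})"
        using assms(1) by (intro degree_prod_sum_le) auto
      also have "\<dots> = card I - 1"
        using assms(1) that by simp
      finally show ?thesis
        using degree_smult_le order_trans by blast
    qed
    have "degree L \<le> card I - 1"
      unfolding L_def using assms(1) deg by (intro degree_sum_le)
    moreover have "card I > 0"
      using assms(1) I by (simp add: card_gt_0_iff)
    ultimately show "degree L < card (f ` I)"
      unfolding card by linarith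
  qed (use assms card in simp)
  then have "poly P x = poly L x"
    by (rule arg_cong)
  also note polyL
  finally show ?thesis .
qed

lemma lagrange_partial_fractions:
  fixes f :: "'i \<Rightarrow> complex"
  assumes "finite I" "inj_on f I" "degree P < card I" "x \<notin> f ` I"
  shows "(\<Sum>i\<in>I. poly P (f i) / (\<Prod>k\<in>I - {i}. f i - f k) / (x - f i)) =
    poly P x / (\<Prod>k\<in>I. x - f k)"
proof -
  have nz: "(\<Prod>k\<in>I - {i}. x - f k) \<noteq> 0" "x - f i \<noteq> 0" if "i \<in> I" for i
    using assms that by auto
  have "poly P x / (\<Prod>k\<in>I. x - f k) =
      (\<Sum>i\<in>I. poly P (f i) / (\<Prod>k\<in>I - {i}. f i - f k) *
        (\<Prod>k\<in>I - {i}. x - f k) / (\<Prod>k\<in>I. x - f k))"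
    by (simp only: lagrange_interpolation[OF assms(1-3), of x] sum_divide_distrib)
  also have "\<dots> = (\<Sum>i\<in>I. poly P (f i) / (\<Prod>k\<in>I - {i}. f i - f k) / (x - f i))"
  proof (intro sum.cong refl)
    fix i assume i: "i \<in> I"
    show "poly P (f i) / (\<Prod>k\<in>I - {i}. f i - f k) * (\<Prod>k\<in>I - {i}. x - f k) / (\<Prod>k\<in>I. x - f k) =
        poly P (f i) / (\<Prod>k\<in>I - {i}. f i - f k) / (x - f i)"
      using nz[OF i] by (simp add: prod.remove[OF assms(1) i])
  qed
  finally show ?thesis ..
qed

text \<open>Partial fractions over all points except one, evaluated at the omitted point, give minus
  the omitted summand. The point spent this way accounts for the stricter degree bound.\<close>

lemma lagrange_sum_eq_0:
  fixes f :: "'i \<Rightarrow> complex"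
  assumes "finite I" "inj_on f I" "degree P + 1 < card I"
  shows "(\<Sum>i\<in>I. poly P (f i) / (\<Prod>k\<in>I - {i}. f i - f k)) = 0"
proof -
  obtain l where l: "l \<in> I"
    using assms(3) by fastforce
  define J where "J = I - {l}"
  have J: "finite J" "inj_on f J" "degree P < card J" "f l \<notin> f ` J"
    using assms l by (auto simp: J_def inj_on_def)
  have "(\<Sum>i\<in>J. poly P (f i) / (\<Prod>k\<in>I - {i}. f i - f k)) =
      - (\<Sum>i\<in>J. poly P (f i) / (\<Prod>k\<in>J - {i}. f i - f k) / (f l - f i))"
    unfolding sum_negf[symmetric]
  proof (intro sum.cong refl)
    fix i assume i: "i \<in> J"
    have "(\<Prod>k\<in>I - {i}. f i - f k) = (f i - f l) * (\<Prod>k\<in>I - {i} - {l}. f i - f k)"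
      using assms(1) l i by (intro prod.remove) (auto simp: J_def)
    moreover have "I - {i} - {l} = J - {i}"
      by (auto simp: J_def)
    moreover have "f i - f l = - (f l - f i)"
      by simp
    ultimately show "poly P (f i) / (\<Prod>k\<in>I - {i}. f i - f k) =
        - (poly P (f i) / (\<Prod>k\<in>J - {i}. f i - f k) / (f l - f i))"
      by (simp only: mult_minus_left divide_minus_right divide_divide_eq_left mult.commute)
  qed
  also have "\<dots> = - (poly P (f l) / (\<Prod>k\<in>J. f l - f k))"
    using lagrange_partial_fractions[OF J] by simp
  finally show ?thesis
    using assms(1) l by (simp add: sum.remove J_def)
qed

section \<open>Moments\<close>

lemma has_contour_integral_powi_unit_circle:
  "((\<lambda>z. z powi n) has_contour_integral (if n = - 1 then 2 * of_real pi * \<i> else 0)) (circlepath 0 1)"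
proof (cases "n = - 1")
  case True
  have "((\<lambda>z. 1 / (z - 0)) has_contour_integral 2 * of_real pi * \<i> * 1) (circlepath 0 1)"
    by (rule Cauchy_integral_circlepath_simple) auto
  then show ?thesis
    using True by (simp add: power_int_minus field_simps)
next
  case False
  then have nz: "of_int (n + 1) \<noteq> (0 :: complex)"
    by (metis add.commute add_cancel_right_left add_diff_cancel_left' diff_0 of_int_eq_0_iff)
  have "((\<lambda>z. z powi n) has_contour_integral
      (pathfinish (circlepath 0 1) powi (n + 1) / of_int (n + 1)
        - pathstart (circlepath 0 1) powi (n + 1) / of_int (n + 1))) (circlepath 0 1)"
  proof (rule contour_integral_primitive[where S = "- {0}"])
    fix x :: complex assume x: "x \<in> - {0}"
    show "((\<lambda>z. z powi (n + 1) / of_int (n + 1)) has_field_derivative x powi n) (at x within - {0})"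
      using nz x by (auto intro!: derivative_eq_intros simp del: of_int_add)
  qed auto
  then show ?thesis
    using False by simp
qed

text \<open>Termwise integration leaves only the power with exponent -1. It is justified by the
  M-test, as each term is bounded on the unit circle by the norm of its coefficient.\<close>

lemma contour_integral_principal_part:
  fixes c :: "nat \<Rightarrow> complex"
  assumes "summable (\<lambda>k. norm (c k))"
  shows "contour_integral (circlepath 0 1)
    (\<lambda>z. z ^ m * suminf (\<lambda>k. c k * z powi (- int k - 1)) / (2 * of_real pi * \<i>)) = c m"
proof -
  let ?C = "2 * of_real pi * \<i> :: complex"
  define f where "f = (\<lambda>k z. z ^ m * (c k * z powi (- int k - 1)) / ?C)"
  have norm_f: "norm (f k z) \<le> norm (c k)" if "norm z = 1" for k z
  proof -
    have "norm (f k z) = norm (c k) / (2 * pi)"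
      using that by (simp add: f_def norm_mult norm_divide norm_power norm_power_int)
    also have "\<dots> \<le> norm (c k) / 1"
      using pi_gt3 by (intro divide_left_mono) auto
    finally show ?thesis
      by simp
  qed
  have f_int: "(f k has_contour_integral (if k = m then c m else 0)) (circlepath 0 1)" for k
  proof -
    have "((\<lambda>z. c k / ?C * z powi (int m - int k - 1)) has_contour_integral
        c k / ?C * (if int m - int k - 1 = - 1 then ?C else 0)) (circlepath 0 1)"
      by (intro has_contour_integral_lmul has_contour_integral_powi_unit_circle)
    then have "((\<lambda>z. c k / ?C * z powi (int m - int k - 1)) has_contour_integral
        (if k = m then c m else 0)) (circlepath 0 1)"
      by (auto split: if_splits)
    then show ?thesis
    proof (rule has_contour_integral_eq)
      fix z :: complex assume "z \<in> path_image (circlepath 0 1)"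
      then have "z \<noteq> 0"
        by auto
      then have "z powi (int m - int k - 1) = z ^ m * z powi (- int k - 1)"
        using power_int_add[of z "int m" "- int k - 1"] by (simp add: algebra_simps)
      then show "c k / ?C * z powi (int m - int k - 1) = f k z"
        by (simp add: f_def)
    qed
  qed
  have lim: "uniform_limit (sphere 0 1) (\<lambda>n z. \<Sum>k<n. f k z) (\<lambda>z. suminf (\<lambda>k. f k z)) sequentially"
    using assms norm_f by (intro Weierstrass_m_test) auto
  have int_sum: "((\<lambda>z. \<Sum>k<n. f k z) has_contour_integral (\<Sum>k<n. if k = m then c m else 0))
      (circlepath 0 1)" for n
    using f_int by (intro has_contour_integral_sum) auto
  have "(\<lambda>n. contour_integral (circlepath 0 1) (\<lambda>z. \<Sum>k<n. f k z)) \<longlonglongrightarrow>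
      contour_integral (circlepath 0 1) (\<lambda>z. suminf (\<lambda>k. f k z))"
  proof (rule contour_integral_uniform_limit_circlepath)
    show "\<forall>\<^sub>F n in sequentially. (\<lambda>z. \<Sum>k<n. f k z) contour_integrable_on circlepath 0 1"
      using int_sum by (auto simp: contour_integrable_on_def intro!: always_eventually)
  qed (use lim in auto)
  moreover have "(\<lambda>n. contour_integral (circlepath 0 1) (\<lambda>z. \<Sum>k<n. f k z)) \<longlonglongrightarrow> c m"
  proof (rule tendsto_eventually)
    show "\<forall>\<^sub>F n in sequentially. contour_integral (circlepath 0 1) (\<lambda>z. \<Sum>k<n. f k z) = c m"
      using eventually_gt_at_top[of m]
      by eventually_elim (simp add: contour_integral_unique[OF int_sum])
  qed
  ultimately have "contour_integral (circlepath 0 1) (\<lambda>z. suminf (\<lambda>k. f k z)) = c m"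
    using LIMSEQ_unique by blast
  moreover have "contour_integral (circlepath 0 1) (\<lambda>z. suminf (\<lambda>k. f k z)) =
      contour_integral (circlepath 0 1)
        (\<lambda>z. z ^ m * suminf (\<lambda>k. c k * z powi (- int k - 1)) / ?C)"
  proof (rule contour_integral_eq)
    fix z :: complex assume "z \<in> path_image (circlepath 0 1)"
    then have z: "norm z = 1"
      by auto
    have "summable (\<lambda>k. c k * z powi (- int k - 1))"
      by (rule summable_norm_cancel) (use z assms in \<open>simp add: norm_mult norm_power_int\<close>)
    then show "(suminf (\<lambda>k. f k z)) = z ^ m * suminf (\<lambda>k. c k * z powi (- int k - 1)) / ?C"
      by (simp only: f_def suminf_mult suminf_divide[OF summable_mult])
  qed
  ultimately show ?thesis
    by simp
qed

lemma of_nat_add_notin_nonpos_Ints: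
  fixes x :: "'a::ring_char_0"
  assumes "x \<notin> \<int>\<^sub>\<le>\<^sub>0"
  shows "of_nat k + x \<notin> \<int>\<^sub>\<le>\<^sub>0"
proof
  assume "of_nat k + x \<in> \<int>\<^sub>\<le>\<^sub>0"
  then obtain n where "of_nat k + x = - of_nat n"
    by (elim nonpos_Ints_cases')
  then have "x = - of_nat (n + k)"
    by (simp add: algebra_simps eq_neg_iff_add_eq_0)
  then show False
    using assms by (metis minus_of_nat_in_nonpos_Ints)
qed

text \<open>Ratio test: in the ratio of consecutive terms r quotients of linear factors tend to 1,
  and the remaining q - r inverse factors, at least one, tend to 0.\<close>

lemma summable_Gamma_quotient:
  fixes x y :: "nat \<Rightarrow> complex"
  assumes "r < q" and x: "\<And>\<rho>. \<rho> < r \<Longrightarrow> x \<rho> \<notin> \<int>\<^sub>\<le>\<^sub>0" and y: "\<And>h. h < q \<Longrightarrow> y h \<notin> \<int>\<^sub>\<le>\<^sub>0"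
  shows "summable (\<lambda>k. norm ((\<Prod>\<rho><r. Gamma (of_nat k + x \<rho>)) / (\<Prod>h<q. Gamma (of_nat k + y h))))"
proof -
  define g where "g = (\<lambda>k. (\<Prod>\<rho><r. Gamma (of_nat k + x \<rho>)) / (\<Prod>h<q. Gamma (of_nat k + y h)))"
  define R where "R = (\<lambda>k. (\<Prod>\<rho><r. of_nat k + x \<rho>) / (\<Prod>h<q. of_nat k + y h))"
  have step: "g (Suc k) = R k * g k" for k
  proof -
    have G: "Gamma (of_nat (Suc k) + w) = (of_nat k + w) * Gamma (of_nat k + w)"
      if "w \<notin> \<int>\<^sub>\<le>\<^sub>0" for w :: complex
      using Gamma_plus1[OF of_nat_add_notin_nonpos_Ints[OF that], of k] by (simp add: algebra_simps)
    have "(\<Prod>\<rho><r. Gamma (of_nat (Suc k) + x \<rho>)) =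
        (\<Prod>\<rho><r. (of_nat k + x \<rho>) * Gamma (of_nat k + x \<rho>))"
      using x by (intro prod.cong G refl) auto
    moreover have "(\<Prod>h<q. Gamma (of_nat (Suc k) + y h)) =
        (\<Prod>h<q. (of_nat k + y h) * Gamma (of_nat k + y h))"
      using y by (intro prod.cong G refl) auto
    ultimately show ?thesis
      by (simp add: g_def R_def prod.distrib)
  qed
  have inv: "(\<lambda>k. inverse (of_nat k + w)) \<longlonglongrightarrow> 0" for w :: complex
  proof -
    have "filterlim (\<lambda>k. w + of_nat k) at_infinity sequentially"
      by (rule tendsto_add_filterlim_at_infinity[OF tendsto_const tendsto_of_nat])
    then show ?thesis
      by (intro filterlim_compose[OF tendsto_inverse_0]) (simp add: add.commute)
  qed
  have quot: "(\<lambda>k. (of_nat k + v) / (of_nat k + w)) \<longlonglongrightarrow> 1" if w: "w \<notin> \<int>\<^sub>\<le>\<^sub>0" for v w :: complex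
  proof -
    have "(\<lambda>k. 1 + (v - w) * inverse (of_nat k + w)) \<longlonglongrightarrow> 1 + (v - w) * 0"
      by (intro tendsto_intros inv)
    moreover have "1 + (v - w) * inverse (of_nat k + w) = (of_nat k + v) / (of_nat k + w)" for k
    proof -
      have "of_nat k + w \<noteq> 0"
        using of_nat_add_notin_nonpos_Ints[OF w, of k] by auto
      then show ?thesis
        by (simp add: field_simps)
    qed
    ultimately show ?thesis
      by simp
  qed
  have "(\<lambda>k. (\<Prod>\<rho><r. (of_nat k + x \<rho>) / (of_nat k + y \<rho>)) * (\<Prod>h\<in>{r..<q}. inverse (of_nat k + y h)))
      \<longlonglongrightarrow> (\<Prod>\<rho><r. 1) * (\<Prod>h\<in>{r..<q}. 0)"
    using assms by (intro tendsto_mult tendsto_prod quot inv) auto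
  moreover have "(\<Prod>\<rho><r. (of_nat k + x \<rho>) / (of_nat k + y \<rho>)) * (\<Prod>h\<in>{r..<q}. inverse (of_nat k + y h))
      = R k" for k
  proof -
    have "(\<Prod>h<q. of_nat k + y h) = (\<Prod>h<r. of_nat k + y h) * (\<Prod>h\<in>{r..<q}. of_nat k + y h)"
      using prod.union_disjoint[of "{..<r}" "{r..<q}" "\<lambda>h. of_nat k + y h"] \<open>r < q\<close>
      by (simp add: ivl_disj_un ivl_disj_int)
    moreover have "(\<Prod>h\<in>{r..<q}. inverse (of_nat k + y h)) = inverse (\<Prod>h\<in>{r..<q}. of_nat k + y h)"
      using prod_inversef[of "\<lambda>h. of_nat k + y h" "{r..<q}"] by (simp add: comp_def)
    ultimately show ?thesis
      by (simp only: R_def prod_dividef) (simp add: divide_inverse)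
  qed
  ultimately have "R \<longlonglongrightarrow> 0"
    using \<open>r < q\<close> by (simp add: zero_power)
  then have "(\<lambda>k. norm (R k)) \<longlonglongrightarrow> 0"
    by (rule tendsto_norm_zero)
  then have "\<forall>\<^sub>F k in sequentially. norm (R k) < 1 / 2"
    by (rule order_tendstoD) simp
  then obtain N where N: "\<And>k. k \<ge> N \<Longrightarrow> norm (R k) < 1 / 2"
    by (auto simp: eventually_sequentially)
  have "summable (\<lambda>k. norm (g k))"
  proof (rule summable_ratio_test)
    fix k assume "k \<ge> N"
    then show "norm (norm (g (Suc k))) \<le> 1 / 2 * norm (norm (g k))"
      using mult_right_mono[of "norm (R k)" "1 / 2" "norm (g k)"] N[of k]
      by (simp add: step norm_mult)
  qed simp
  then show ?thesis
    by (simp add: g_def)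
qed

text \<open>\<open>a_b\<close> is what admissibility along the whole step-line yields, see
  \<open>hypergeometric_weightsI\<close>. It keeps every Pochhammer symbol of a - b - K
  nonzero.\<close>

locale hypergeometric_weights =
  fixes p q r :: nat and a b \<kappa> :: "nat \<Rightarrow> complex"
  assumes p: "0 < p" and q: "0 < q" and rq: "r < q"
    and b_diff: "\<And>j h. j < q \<Longrightarrow> h < q \<Longrightarrow> j \<noteq> h \<Longrightarrow> b j - b h \<notin> \<int>"
    and kappa_diff: "\<And>i l. i < p \<Longrightarrow> l < p \<Longrightarrow> i \<noteq> l \<Longrightarrow> \<kappa> i - \<kappa> l \<notin> \<int>"
    and kappa_a: "\<And>i \<rho>. i < p \<Longrightarrow> \<rho> < r \<Longrightarrow> \<kappa> i + a \<rho> + 1 \<notin> \<int>\<^sub>\<le>\<^sub>0"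
    and kappa_b: "\<And>i j. i < p \<Longrightarrow> j < q \<Longrightarrow> \<kappa> i + b j + 1 \<notin> \<int>\<^sub>\<le>\<^sub>0"
    and a_b: "\<And>\<rho> j. \<rho> < r \<Longrightarrow> j < q \<Longrightarrow> a \<rho> - b j \<notin> \<int>"
begin

definition W :: "complex \<Rightarrow> complex" where
  "W s = (\<Prod>\<rho><r. Gamma (s + a \<rho> + 1)) / (\<Prod>h<q. Gamma (s + b h + 1))"

definition node :: "nat \<Rightarrow> nat \<Rightarrow> complex" where
  "node i v = \<kappa> i + of_nat v"

lemma node_a: "i < p \<Longrightarrow> \<rho> < r \<Longrightarrow> node i v + a \<rho> + 1 \<notin> \<int>\<^sub>\<le>\<^sub>0"
  using of_nat_add_notin_nonpos_Ints[OF kappa_a, of i \<rho> v] by (simp add: node_def algebra_simps)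

lemma node_b: "i < p \<Longrightarrow> j < q \<Longrightarrow> node i v + b j + 1 \<notin> \<int>\<^sub>\<le>\<^sub>0"
  using of_nat_add_notin_nonpos_Ints[OF kappa_b, of i j v] by (simp add: node_def algebra_simps)

lemma node_b_nonzero: "i < p \<Longrightarrow> j < q \<Longrightarrow> node i v + b j + 1 + of_nat k \<noteq> 0"
  using node_b[of i j "v + k"] by (auto simp: node_def algebra_simps)

lemma node_a_nonzero: "i < p \<Longrightarrow> j < r \<Longrightarrow> node i v + a j + 1 + of_nat k \<noteq> 0"
  using node_a[of i j "v + k"] by (auto simp: node_def algebra_simps)

lemma W_node_nonzero: "i < p \<Longrightarrow> W (node i v) \<noteq> 0"
  by (auto simp: W_def Gamma_eq_zero_iff node_a node_b)

text \<open>The integral selects the coefficient of index u + v; raising the Gamma argument of h = j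
  by one produces the linear denominator.\<close>

lemma moment_eq:
  assumes "j < q" "i < p"
  shows "moment q r a b \<kappa> (u, j) (v, i) = W (node i (u + v)) / (node i (u + v) + b j + 1)"
proof -
  define c where "c = (\<lambda>k. (\<Prod>\<rho><r. Gamma (of_nat k + \<kappa> i + a \<rho> + 1))
          / (\<Prod>h<q. Gamma (of_nat k + \<kappa> i + b h + of_bool (h = j) + 1)))"
  have "summable (\<lambda>k. norm ((\<Prod>\<rho><r. Gamma (of_nat k + (\<kappa> i + a \<rho> + 1)))
          / (\<Prod>h<q. Gamma (of_nat k + (\<kappa> i + b h + of_bool (h = j) + 1)))))"
  proof (rule summable_Gamma_quotient[OF rq])
    fix h assume "h < q"
    then show "\<kappa> i + b h + of_bool (h = j) + 1 \<notin> \<int>\<^sub>\<le>\<^sub>0"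
      using kappa_b[of i h] of_nat_add_notin_nonpos_Ints[of "\<kappa> i + b h + 1" 1] assms
      by (auto simp: algebra_simps)
  qed (use kappa_a assms in auto)
  then have "summable (\<lambda>k. norm (c k))"
    by (simp add: c_def add.assoc)
  then have "moment q r a b \<kappa> (u, j) (v, i) = c (u + v)"
    using contour_integral_principal_part[of c "u + v"] by (simp add: moment_def weight_def c_def)
  also have "\<dots> = W (node i (u + v)) / (node i (u + v) + b j + 1)"
  proof -
    let ?s = "node i (u + v)"
    have "(\<Prod>h<q. Gamma (of_nat (u + v) + \<kappa> i + b h + of_bool (h = j) + 1)) =
        (\<Prod>h<q. Gamma (?s + b h + 1) * (if h = j then ?s + b j + 1 else 1))"
    proof (intro prod.cong refl)
      fix h assume "h \<in> {..<q}"
      then show "Gamma (of_nat (u + v) + \<kappa> i + b h + of_bool (h = j) + 1) =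
          Gamma (?s + b h + 1) * (if h = j then ?s + b j + 1 else 1)"
        using Gamma_plus1[OF node_b[of i h "u + v"]] assms
        by (auto simp: node_def algebra_simps)
    qed
    also have "\<dots> = (\<Prod>h<q. Gamma (?s + b h + 1)) * (?s + b j + 1)"
      using assms by (simp add: prod.distrib)
    finally show ?thesis
      by (simp add: c_def W_def node_def algebra_simps)
  qed
  finally show ?thesis .
qed

lemma W_ratio:
  assumes "i < p"
  shows "W (node i (v + k)) = W (node i v) * (\<Prod>\<rho><r. pochhammer (node i v + a \<rho> + 1) k)
    / (\<Prod>h<q. pochhammer (node i v + b h + 1) k)"
proof -
  have G: "Gamma (node i (v + k) + x + 1) =
      pochhammer (node i v + x + 1) k * Gamma (node i v + x + 1)"
    if "node i v + x + 1 \<notin> \<int>\<^sub>\<le>\<^sub>0" for x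
    using pochhammer_Gamma[OF that, of k] Gamma_eq_zero_iff[of "node i v + x + 1"] that
    by (simp add: node_def algebra_simps)
  have "(\<Prod>\<rho><r. Gamma (node i (v + k) + a \<rho> + 1)) =
      (\<Prod>\<rho><r. pochhammer (node i v + a \<rho> + 1) k * Gamma (node i v + a \<rho> + 1))"
    using assms node_a by (intro prod.cong G refl) auto
  moreover have "(\<Prod>h<q. Gamma (node i (v + k) + b h + 1)) =
      (\<Prod>h<q. pochhammer (node i v + b h + 1) k * Gamma (node i v + b h + 1))"
    using assms node_b by (intro prod.cong G refl) auto
  ultimately show ?thesis
    by (simp add: W_def prod.distrib mult.commute)
qed

end

section \<open>Pochhammer symbols\<close>

lemma gpoch_of_nat [simp]: "gpoch x (int n) = pochhammer x n"
  by (simp add: gpoch_def)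

lemma pochhammer_swap:
  "pochhammer x m * pochhammer (x + of_nat m) k = pochhammer x k * pochhammer (x + of_nat k) m"
  by (simp add: add.commute flip: pochhammer_product')

lemma pochhammer_nonzeroI:
  fixes x :: "'a::field_char_0"
  shows "(\<And>k. k < n \<Longrightarrow> x + of_nat k \<noteq> 0) \<Longrightarrow> pochhammer x n \<noteq> 0"
  by (metis add.left_inverse pochhammer_eq_0_iff)

lemma prod_diff_of_nat: "(\<Prod>w<n. x - of_nat w :: 'a::comm_ring_1) = pochhammer (x - of_nat n + 1) n"
proof -
  have "pochhammer (x - of_nat n + 1) n = (\<Prod>w<n. x - of_nat n + 1 + of_nat (n - Suc w))"
    unfolding pochhammer_prod lessThan_atLeast0[symmetric]
    by (rule prod.nat_diff_reindex[symmetric])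
  also have "\<dots> = (\<Prod>w<n. x - of_nat w)"
    by (intro prod.cong refl) (auto simp: of_nat_diff)
  finally show ?thesis ..
qed

text \<open>The derivative of x (x - 1) ... (x - n + 1) at v, the source of the factorials in the
  closed forms of both types.\<close>

lemma prod_diff_of_nat_except:
  assumes "v < n"
  shows "(\<Prod>w\<in>{..<n} - {v}. of_nat v - of_nat w :: 'a::field_char_0) =
    (- 1) ^ (n - 1 - v) * fact v * fact (n - 1 - v)"
proof -
  have "(\<Prod>w\<in>{..<Suc v + k} - {v}. of_nat v - of_nat w :: 'a) = (- 1) ^ k * fact v * fact k" for k
  proof (induction k)
    case 0
    have "{..<Suc v} - {v} = {..<v}"
      by auto
    moreover have "(\<Prod>w<v. of_nat v - of_nat w :: 'a) = fact v"
      by (simp add: prod_diff_of_nat pochhammer_fact)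
    ultimately show ?case
      by simp
  next
    case (Suc k)
    have "{..<Suc v + Suc k} - {v} = insert (Suc v + k) ({..<Suc v + k} - {v})"
      by auto
    then have "(\<Prod>w\<in>{..<Suc v + Suc k} - {v}. of_nat v - of_nat w :: 'a) =
        (of_nat v - of_nat (Suc v + k)) * (\<Prod>w\<in>{..<Suc v + k} - {v}. of_nat v - of_nat w)"
      by simp
    also have "\<dots> = (of_nat v - of_nat (Suc v + k)) * ((- 1) ^ k * fact v * fact k)"
      using Suc.IH by (simp only:)
    also have "\<dots> = (- 1) ^ Suc k * fact v * fact (Suc k)"
      by (simp add: algebra_simps)
    finally show ?case .
  qed
  from this[of "n - 1 - v"] show ?thesis
    using assms by simp
qed

lemma pochhammer_one_minus_of_nat:
  assumes "v < n"
  shows "pochhammer (1 - of_nat n :: 'a::field_char_0) v = (- 1) ^ v * fact (n - 1) / fact (n - 1 - v)"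
  using assms
proof (induction v)
  case (Suc v)
  define d where "d = n - 2 - v"
  have n: "n = Suc (Suc d) + v"
    using Suc.prems by (simp add: d_def)
  have "pochhammer (1 - of_nat n :: 'a) (Suc v) = (- 1) ^ v * fact (n - 1) / fact (Suc d) * - of_nat (Suc d)"
  proof -
    have "1 - of_nat n + of_nat v = (- of_nat (Suc d) :: 'a)" "n - 1 - v = Suc d"
      by (simp_all add: n)
    then show ?thesis
      using Suc by (simp only: pochhammer_Suc)
  qed
  also have "\<dots> = (- 1) ^ Suc v * fact (n - 1) / fact d"
    by (simp del: of_nat_Suc)
  finally show ?case
    by (simp add: n)
qed simp

text \<open>Splits a derivative of a node polynomial into the arithmetic progression containing the
  point and the other progressions.\<close>

lemma prod_Sigma_remove:
  assumes "finite A" "\<And>l. l \<in> A \<Longrightarrow> finite (B l)" "i \<in> A" "v \<in> B i"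
  shows "(\<Prod>x\<in>Sigma A B - {(i, v)}. g x) =
    (\<Prod>w\<in>B i - {v}. g (i, w)) * (\<Prod>l\<in>A - {i}. \<Prod>w\<in>B l. g (l, w))"
proof -
  define B' where "B' = (\<lambda>l. if l = i then B i - {v} else B l)"
  have "Sigma A B - {(i, v)} = Sigma A B'"
    by (auto simp: B'_def split: if_splits)
  also have "prod g (Sigma A B') = (\<Prod>l\<in>A. \<Prod>w\<in>B' l. g (l, w))"
    using assms by (subst prod.Sigma) (auto simp: B'_def)
  also have "\<dots> = (\<Prod>w\<in>B' i. g (i, w)) * (\<Prod>l\<in>A - {i}. \<Prod>w\<in>B' l. g (l, w))"
    using assms by (intro prod.remove)
  also have "(\<Prod>l\<in>A - {i}. \<Prod>w\<in>B' l. g (l, w)) = (\<Prod>l\<in>A - {i}. \<Prod>w\<in>B l. g (l, w))"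
    by (intro prod.cong) (auto simp: B'_def)
  finally show ?thesis
    by (simp add: B'_def)
qed

definition pochhammer_poly :: "complex \<Rightarrow> nat \<Rightarrow> complex poly" where
  "pochhammer_poly x n = (\<Prod>k<n. [:x + of_nat k, 1:])"

lemma poly_pochhammer_poly: "poly (pochhammer_poly x n) s = pochhammer (s + x) n"
  by (simp add: pochhammer_poly_def poly_prod pochhammer_prod atLeast0LessThan add_ac)

lemma degree_pochhammer_poly: "degree (pochhammer_poly x n) \<le> n"
  unfolding pochhammer_poly_def
  by (rule order_trans[OF degree_prod_sum_le]) (auto simp: comp_def)

lemma degree_prod_le:
  fixes f :: "'i \<Rightarrow> complex poly"
  assumes "finite I" "\<And>i. i \<in> I \<Longrightarrow> degree (f i) \<le> g i"
  shows "degree (prod f I) \<le> sum g I"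
  using degree_prod_sum_le[OF assms(1), of f] sum_mono[of I "degree \<circ> f" g] assms(2)
  by (simp add: comp_def)

section \<open>The step-line\<close>

text \<open>The dictionary between linear positions and pairs of block and component:
  \<open>stepline d N j\<close> counts the positions below \<open>N\<close> with residue
  \<open>j\<close>.\<close>

lemma stepline_less_iff:
  "L div d < stepline d N (L mod d) \<longleftrightarrow> L < N"
proof (cases "L div d" "N div d" rule: linorder_cases)
  case less
  then have "L < N"
    by (meson div_le_mono leD leI)
  then show ?thesis
    using less by (simp add: stepline_def)
next
  case equal
  have "L = d * (L div d) + L mod d" "N = d * (N div d) + N mod d"
    by simp_all
  then have "L < N \<longleftrightarrow> L mod d < N mod d"
    using equal by (metis nat_add_left_cancel_less)
  then show ?thesis
    using equal by (simp add: stepline_def)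
next
  case greater
  then show ?thesis
    using div_le_mono[of L N d] by (auto simp: stepline_def)
qed

lemma sum_stepline:
  assumes "0 < d"
  shows "(\<Sum>L<N. f (L mod d) (L div d)) = (\<Sum>j<d. \<Sum>u<stepline d N j. f j u)"
proof -
  have "(\<Sum>j<d. \<Sum>u<stepline d N j. f j u) =
      (\<Sum>(j, u)\<in>(SIGMA j:{..<d}. {..<stepline d N j}). f j u)"
    by (rule sum.Sigma) auto
  also have "\<dots> = (\<Sum>L<N. f (L mod d) (L div d))"
  proof (rule sum.reindex_bij_witness[where j = "\<lambda>(j, u). u * d + j" and i = "\<lambda>L. (L mod d, L div d)"])
    fix x assume x: "x \<in> (SIGMA j:{..<d}. {..<stepline d N j})"
    then show "(case x of (j, u) \<Rightarrow> u * d + j) \<in> {..<N}"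
      using stepline_less_iff[of "snd x * d + fst x" d N] by auto
  qed (use assms in \<open>auto simp: stepline_less_iff\<close>)
  finally show ?thesis ..
qed

lemma vsum_stepline: "0 < d \<Longrightarrow> vsum d (stepline d N) = N"
  using sum_stepline[of d "\<lambda>_ _. 1 :: nat" N] by (simp add: vsum_def)

lemma stepline_ge: "N div d \<le> stepline d N h"
  by (simp add: stepline_def)

lemma vmin_stepline: "0 < d \<Longrightarrow> vmin d (stepline d N) = N div d"
  unfolding vmin_def
proof (rule Min_eqI)
  assume "0 < d"
  then show "N div d \<in> stepline d N ` {..<d}"
    by (intro image_eqI[of _ _ "N mod d"]) (auto simp: stepline_def)
qed (auto simp: stepline_ge)

lemma first_min_stepline: "0 < d \<Longrightarrow> first_min d (stepline d N) = N mod d"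
  unfolding first_min_def vmin_stepline
  by (rule Min_eqI) (auto simp: stepline_def split: if_splits)

text \<open>Using quotient and remainder of \<open>N\<close> itself avoids a case split when
  \<open>d\<close> divides \<open>Suc N\<close> and makes \<open>N mod d\<close> visibly the last
  maximal component.\<close>

lemma stepline_Suc:
  assumes "0 < d" "h < d"
  shows "stepline d (Suc N) h = N div d + of_bool (h \<le> N mod d)"
proof -
  let ?L = "(N div d) * d + h"
  have "k < stepline d (Suc N) h \<longleftrightarrow> k * d + h \<le> N" for k
    using stepline_less_iff[of "k * d + h" d "Suc N"] assms by auto
  moreover have "k * d + h \<le> N \<longleftrightarrow> k < N div d + of_bool (h \<le> N mod d)" for k
  proof (cases k "N div d" rule: linorder_cases)
    case less
    then have "(k + 1) * d \<le> N div d * d"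
      by (intro mult_le_mono1) simp
    also have "\<dots> \<le> N"
      by simp
    finally show ?thesis
      using less assms by auto
  next
    case equal
    have "k * d + h \<le> N \<longleftrightarrow> h \<le> N mod d"
      by (metis add_le_cancel_left div_mult_mod_eq equal)
    then show ?thesis
      using equal by auto
  next
    case greater
    then have "(N div d + 1) * d \<le> k * d"
      by (intro mult_le_mono1) simp
    moreover have "N < (N div d + 1) * d"
      using assms by (simp add: dividend_less_div_times)
    ultimately show ?thesis
      using greater by auto
  qed
  ultimately have "\<And>k. k < stepline d (Suc N) h \<longleftrightarrow> k < N div d + of_bool (h \<le> N mod d)"
    by simp
  then show ?thesis
    by (metis linorder_neqE_nat less_irrefl)
qed

lemma vmax_stepline_Suc: "0 < d \<Longrightarrow> vmax d (stepline d (Suc N)) = Suc (N div d)"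
  unfolding vmax_def
proof (rule Max_eqI)
  assume "0 < d"
  then show "Suc (N div d) \<in> stepline d (Suc N) ` {..<d}"
    by (intro image_eqI[of _ _ "N mod d"]) (auto simp: stepline_Suc)
next
  fix y assume "0 < d" "y \<in> stepline d (Suc N) ` {..<d}"
  then show "y \<le> Suc (N div d)"
    using stepline_Suc by fastforce
qed auto

lemma last_max_stepline_Suc: "0 < d \<Longrightarrow> last_max d (stepline d (Suc N)) = N mod d"
  unfolding last_max_def vmax_stepline_Suc
  by (rule Max_eqI) (auto simp: stepline_Suc of_bool_def split: if_splits)

context hypergeometric_weights
begin

section \<open>The vectors of type A\<close>

definition nodes :: "nat \<Rightarrow> (nat \<times> nat) set" where
  "nodes N = (SIGMA i:{..<p}. {..<stepline p N i})"

lemma finite_nodes [simp]: "finite (nodes N)"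
  by (auto simp: nodes_def)

lemma card_nodes: "card (nodes N) = N"
  using vsum_stepline[OF p, of N] by (simp add: nodes_def vsum_def)

lemma inj_on_node: "inj_on (\<lambda>(i, v). node i v) (nodes N)"
proof (rule inj_onI, clarify)
  fix i v l w
  assume mem: "(i, v) \<in> nodes N" "(l, w) \<in> nodes N" and eq: "node i v = node l w"
  then have diff: "\<kappa> i - \<kappa> l = of_int (int w - int v)"
    by (simp add: node_def algebra_simps)
  have "i = l"
  proof (rule ccontr)
    assume "i \<noteq> l"
    then have "\<kappa> i - \<kappa> l \<notin> \<int>"
      using mem kappa_diff by (auto simp: nodes_def)
    then show False
      unfolding diff using Ints_of_int by blast
  qed
  then show "i = l \<and> v = w"
    using eq by (simp add: node_def)
qed

lemma sum_nodes: "(\<Sum>(i, v)\<in>nodes N. f i v) = (\<Sum>i<p. \<Sum>v<stepline p N i. f i v)"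
  unfolding nodes_def by (rule sum.Sigma[symmetric]) auto

lemma prod_nodes: "(\<Prod>(i, v)\<in>nodes N. f i v) = (\<Prod>i<p. \<Prod>v<stepline p N i. f i v)"
  unfolding nodes_def by (rule prod.Sigma[symmetric]) auto

lemma sum_nodes_linear: "(\<Sum>v<N. f (v mod p) (v div p)) = (\<Sum>(i, v)\<in>nodes N. f i v)"
  using sum_stepline[OF p] by (simp add: sum_nodes)

lemma kappa_diff_nonzero:
  assumes "i < p" "l < p" "i \<noteq> l"
  shows "\<kappa> i - \<kappa> l + of_int n \<noteq> 0"
proof
  assume "\<kappa> i - \<kappa> l + of_int n = 0"
  then have "\<kappa> i - \<kappa> l = of_int (- n)"
    by (simp add: eq_neg_iff_add_eq_0)
  then show False
    using kappa_diff[OF assms] Ints_of_int by metis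
qed

lemma b_diff_nonzero:
  assumes "h < q" "j < q" "h \<noteq> j"
  shows "b h - b j + of_int n \<noteq> 0"
proof
  assume "b h - b j + of_int n = 0"
  then have "b h - b j = of_int (- n)"
    by (simp add: eq_neg_iff_add_eq_0)
  then show False
    using b_diff[OF assms] Ints_of_int by metis
qed

lemma a_b_nonzero:
  assumes "\<rho> < r" "j < q"
  shows "a \<rho> - b j + of_int n \<noteq> 0"
proof
  assume "a \<rho> - b j + of_int n = 0"
  then have "a \<rho> - b j = of_int (- n)"
    by (simp add: eq_neg_iff_add_eq_0)
  then show False
    using a_b[OF assms] Ints_of_int by metis
qed

text \<open>The derivative, at a node, of the monic polynomial that vanishes exactly at the
  nodes.\<close>

definition node_poly_deriv :: "nat \<Rightarrow> nat \<Rightarrow> nat \<Rightarrow> complex" where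
  "node_poly_deriv N i v = (\<Prod>(l, w)\<in>nodes N - {(i, v)}. node i v - node l w)"

lemma node_poly_deriv_eq:
  assumes "i < p" "v < stepline p N i"
  shows "node_poly_deriv N i v =
    (- 1) ^ (stepline p N i - 1 - v) * fact v * fact (stepline p N i - 1 - v) *
    (\<Prod>l\<in>{..<p} - {i}. pochhammer (\<kappa> i - \<kappa> l - of_nat (stepline p N l) + (of_nat v + 1)) (stepline p N l))"
proof -
  have "node_poly_deriv N i v =
      (\<Prod>w\<in>{..<stepline p N i} - {v}. node i v - node i w) *
      (\<Prod>l\<in>{..<p} - {i}. \<Prod>w<stepline p N l. node i v - node l w)"
    unfolding node_poly_deriv_def nodes_def
    using assms by (subst prod_Sigma_remove) auto
  also have "(\<Prod>w\<in>{..<stepline p N i} - {v}. node i v - node i w) =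
      (\<Prod>w\<in>{..<stepline p N i} - {v}. of_nat v - of_nat w)"
    by (simp add: node_def)
  also have "\<dots> = (- 1) ^ (stepline p N i - 1 - v) * fact v * fact (stepline p N i - 1 - v)"
    using assms by (intro prod_diff_of_nat_except)
  also have "(\<Prod>l\<in>{..<p} - {i}. \<Prod>w<stepline p N l. node i v - node l w) =
      (\<Prod>l\<in>{..<p} - {i}. pochhammer (\<kappa> i - \<kappa> l - of_nat (stepline p N l) + (of_nat v + 1)) (stepline p N l))"
  proof (intro prod.cong refl)
    fix l
    show "(\<Prod>w<stepline p N l. node i v - node l w) =
        pochhammer (\<kappa> i - \<kappa> l - of_nat (stepline p N l) + (of_nat v + 1)) (stepline p N l)"
      using prod_diff_of_nat[of "\<kappa> i - \<kappa> l + of_nat v" "stepline p N l"]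
      by (simp add: node_def algebra_simps)
  qed
  finally show ?thesis .
qed

definition nuA :: "nat \<Rightarrow> complex" where
  "nuA N = nu_A p q r a b \<kappa> (stepline p (Suc N)) (stepline q N)"

text \<open>The type A coefficients in the shape needed for divided differences: after
  multiplication by \<open>W\<close> only a polynomial value over \<open>node_poly_deriv\<close>
  remains. \<open>A_step_eq\<close> recovers the hypergeometric form.\<close>

definition A_coeff :: "nat \<Rightarrow> nat \<Rightarrow> nat \<Rightarrow> complex" where
  "A_coeff N i v = nuA N * (- 1) ^ Suc N *
    (\<Prod>h<q. pochhammer (node i v + b h + 1) (stepline q N h)) /
    (W (node i v) * node_poly_deriv (Suc N) i v)"

definition A_matrix :: "nat \<Rightarrow> nat \<Rightarrow> complex" where
  "A_matrix N v = (if v \<le> N then A_coeff N (v mod p) (v div p) else 0)"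

lemma nuA_eq:
  "nuA N = - (\<Prod>i<p. pochhammer (\<kappa> i + b (N mod q) + of_nat (N div q) + 1) (stepline p (Suc N) i))
    / ((\<Prod>\<rho><r. pochhammer (a \<rho> - b (N mod q) - of_nat (N div q)) (N div q))
       * (\<Prod>h<N mod q. b h - b (N mod q)))"
proof -
  have "{h. h < q \<and> stepline q N h = N div q + 1} = {..<N mod q}"
    using q by (auto simp: stepline_def intro: less_trans[OF _ mod_less_divisor] split: if_splits)
  then show ?thesis
    by (simp add: nuA_def nu_A_def Let_def vmin_stepline[OF q] first_min_stepline[OF q])
qed

lemma kappa_b_nonzero:
  assumes "i < p" "j < q"
  shows "\<kappa> i + b j + of_nat u + 1 + of_nat k \<noteq> 0"
  using node_b_nonzero[OF assms, of "u + k" 0] by (simp add: node_def add_ac)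

lemma pochhammer_b_nonzero:
  assumes "i < p" "h < q"
  shows "pochhammer (node i v + b h + 1) k \<noteq> 0"
  using node_b_nonzero[OF assms] by (intro pochhammer_nonzeroI)

lemma pochhammer_a_nonzero:
  assumes "i < p" "\<rho> < r"
  shows "pochhammer (node i v + a \<rho> + 1) k \<noteq> 0"
  using node_a_nonzero[OF assms] by (intro pochhammer_nonzeroI)

lemma A_coeff_moment:
  assumes "i < p" "j < q"
  shows "A_coeff N i v * (W (node i (v + k)) / (node i (v + k) + b j + 1)) =
    nuA N * (- 1) ^ Suc N * (\<Prod>\<rho><r. pochhammer (node i v + a \<rho> + 1) k) *
    ((\<Prod>h<q. pochhammer (node i v + b h + 1) (stepline q N h)) /
     ((\<Prod>h<q. pochhammer (node i v + b h + 1) k) * (node i v + b j + 1 + of_nat k))) /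
    node_poly_deriv (Suc N) i v"
proof -
  have "node i (v + k) + b j + 1 = node i v + b j + 1 + of_nat k"
    by (simp add: node_def)
  then show ?thesis
    unfolding A_coeff_def W_ratio[OF assms(1)]
    using W_node_nonzero[OF assms(1), of v] by (simp add: mult_ac)
qed

text \<open>For test positions below \<open>N\<close> the numerator contains every denominator
  factor, the linear one because k < m j, so the quotient is a polynomial in the node.\<close>

lemma pochhammer_quotient_poly:
  assumes "i < p" "j < q" and "\<And>h. h < q \<Longrightarrow> k \<le> m h" and "k < m j"
  shows "(\<Prod>h<q. pochhammer (node i v + b h + 1) (m h)) /
      ((\<Prod>h<q. pochhammer (node i v + b h + 1) k) * (node i v + b j + 1 + of_nat k)) =
    (\<Prod>h<q. pochhammer (node i v + (b h + 1 + of_nat k + of_bool (h = j))) (m h - k - of_bool (h = j)))"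
proof -
  let ?x = "\<lambda>h. node i v + b h + 1"
  have eq: "pochhammer (?x h) (m h) = pochhammer (?x h) k * (if h = j then ?x j + of_nat k else 1) *
      pochhammer (node i v + (b h + 1 + of_nat k + of_bool (h = j))) (m h - k - of_bool (h = j))"
    if "h < q" for h
  proof (cases "h = j")
    case True
    then obtain d where d: "m h = k + Suc d"
      using assms(4) less_imp_Suc_add by fastforce
    then show ?thesis
      using True by (simp add: pochhammer_product' pochhammer_rec add_ac mult_ac del: add_Suc_right)
  next
    case False
    then show ?thesis
      using pochhammer_product[OF assms(3)[OF that], of "?x h"] by (simp add: add_ac)
  qed
  have "(\<Prod>h<q. pochhammer (?x h) (m h)) = (\<Prod>h<q. pochhammer (?x h) k *
      (if h = j then ?x j + of_nat k else 1) *
      pochhammer (node i v + (b h + 1 + of_nat k + of_bool (h = j))) (m h - k - of_bool (h = j)))"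
    by (intro prod.cong eq) auto
  also have "\<dots> = (\<Prod>h<q. pochhammer (?x h) k) * (?x j + of_nat k) *
      (\<Prod>h<q. pochhammer (node i v + (b h + 1 + of_nat k + of_bool (h = j))) (m h - k - of_bool (h = j)))"
    using assms(2) by (simp add: prod.distrib)
  finally show ?thesis
    using assms node_b_nonzero pochhammer_b_nonzero by auto
qed

lemma moment_matrix_eq:
  "moment_matrix p q r a b \<kappa> L v =
    W (node (v mod p) (v div p + L div q)) / (node (v mod p) (v div p + L div q) + b (L mod q) + 1)"
  using p q by (simp add: moment_matrix_def moment_eq add.commute)

lemma A_column_sum:
  "(\<Sum>v<Suc N. moment_matrix p q r a b \<kappa> L v * A_matrix N v) =
    (\<Sum>(i, v)\<in>nodes (Suc N). A_coeff N i v *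
      (W (node i (v + L div q)) / (node i (v + L div q) + b (L mod q) + 1)))"
  unfolding sum_nodes_linear[symmetric] moment_matrix_eq
  by (intro sum.cong refl) (auto simp: A_matrix_def mult.commute)

lemma A_orth:
  assumes "L < N"
  shows "(\<Sum>v<Suc N. moment_matrix p q r a b \<kappa> L v * A_matrix N v) = 0"
proof -
  define u j where "u = L div q" and "j = L mod q"
  define m where "m = stepline q N"
  have j: "j < q"
    using q by (simp add: j_def)
  have mj: "u < m j"
    using assms stepline_less_iff[of L q N] by (simp add: u_def j_def m_def)
  have mh: "u \<le> m h" if "h < q" for h
    using assms stepline_ge[of N q h] div_le_mono[of L N q] by (simp add: u_def m_def)
  define P where "P = (\<Prod>\<rho><r. pochhammer_poly (a \<rho> + 1) u) *
    (\<Prod>h<q. pochhammer_poly (b h + 1 + of_nat u + of_bool (h = j)) (m h - u - of_bool (h = j)))"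
  \<comment> \<open>The linear factor cancelled for h = j lowers the degree by one and r < q
    controls the a-factors. The total is at most N - 1, and there are N + 1 nodes.\<close>
  have "degree P \<le> (\<Sum>\<rho><r. u) + (\<Sum>h<q. m h - u - of_bool (h = j))"
    unfolding P_def
    by (rule order_trans[OF degree_mult_le]) (intro add_mono degree_prod_le degree_pochhammer_poly; simp)
  also have "(\<Sum>\<rho><r. u) \<le> (\<Sum>h<q. u)"
    using rq by simp
  also have "(\<Sum>h<q. u) + (\<Sum>h<q. m h - u - of_bool (h = j)) + 1 =
      (\<Sum>h<q. u + (m h - u - of_bool (h = j)) + of_bool (h = j))"
    using j by (simp add: sum.distrib)
  also have "\<dots> = (\<Sum>h<q. m h)"
    using mh mj by (intro sum.cong refl) auto
  also have "\<dots> = N"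
    using vsum_stepline[OF q, of N] by (simp add: vsum_def m_def)
  finally have deg: "degree P + 1 < card (nodes (Suc N))"
    by (simp add: card_nodes)
  have "(\<Sum>v<Suc N. moment_matrix p q r a b \<kappa> L v * A_matrix N v) =
      (\<Sum>x\<in>nodes (Suc N). nuA N * (- 1) ^ Suc N *
        (poly P (case x of (i, v) \<Rightarrow> node i v) /
         (\<Prod>k\<in>nodes (Suc N) - {x}. (case x of (i, v) \<Rightarrow> node i v) - (case k of (i, v) \<Rightarrow> node i v))))"
    unfolding A_column_sum u_def[symmetric] j_def[symmetric]
  proof (intro sum.cong refl, clarify)
    fix i v assume iv: "(i, v) \<in> nodes (Suc N)"
    then have i: "i < p"
      by (auto simp: nodes_def)
    have deriv: "(\<Prod>k\<in>nodes (Suc N) - {(i, v)}. node i v - (case k of (i, v) \<Rightarrow> node i v)) =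
        node_poly_deriv (Suc N) i v"
      by (simp add: node_poly_deriv_def case_prod_unfold)
    have quot: "(\<Prod>h<q. pochhammer (node i v + b h + 1) (m h)) /
        ((\<Prod>h<q. pochhammer (node i v + b h + 1) u) * (node i v + b j + 1 + of_nat u)) =
      (\<Prod>h<q. pochhammer (node i v + (b h + 1 + of_nat u + of_bool (h = j))) (m h - u - of_bool (h = j)))"
      by (intro pochhammer_quotient_poly i j mh mj)
    show "A_coeff N i v * (W (node i (v + u)) / (node i (v + u) + b j + 1)) =
        nuA N * (- 1) ^ Suc N * (poly P (node i v) /
          (\<Prod>k\<in>nodes (Suc N) - {(i, v)}. node i v - (case k of (i, v) \<Rightarrow> node i v)))"
      unfolding A_coeff_moment[OF i j] deriv m_def[symmetric] quot
      by (simp add: P_def poly_prod poly_pochhammer_poly add.assoc)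
  qed
  also have "\<dots> = 0"
    unfolding sum_distrib_left[symmetric]
    using lagrange_sum_eq_0[OF finite_nodes inj_on_node deg] by simp
  finally show ?thesis .
qed

text \<open>Here m j = u, so the linear denominator factor is not cancelled. The sum is a partial
  fraction expansion evaluated at the zero \<open>s\<close> of that factor, and \<open>nuA\<close>
  is the constant that turns its value into 1.\<close>

lemma A_norm: "(\<Sum>v<Suc N. moment_matrix p q r a b \<kappa> N v * A_matrix N v) = 1"
proof -
  define u j where "u = N div q" and "j = N mod q"
  define m where "m = stepline q N"
  define lam where "lam = stepline p (Suc N)"
  have j: "j < q"
    using q by (simp add: j_def)
  have mh: "u \<le> m h" for h
    using stepline_ge[of N q h] by (simp add: u_def m_def)
  define P where "P = (\<Prod>\<rho><r. pochhammer_poly (a \<rho> + 1) u) *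
    (\<Prod>h<q. pochhammer_poly (b h + 1 + of_nat u) (m h - u))"
  define s where "s = - (b j + 1 + of_nat u)"
  have "degree P \<le> (\<Sum>\<rho><r. u) + (\<Sum>h<q. m h - u)"
    unfolding P_def
    by (rule order_trans[OF degree_mult_le]) (intro add_mono degree_prod_le degree_pochhammer_poly; simp)
  also have "(\<Sum>\<rho><r. u) \<le> (\<Sum>h<q. u)"
    using rq by simp
  also have "(\<Sum>h<q. u) + (\<Sum>h<q. m h - u) = (\<Sum>h<q. m h)"
    unfolding sum.distrib[symmetric] using mh by (intro sum.cong refl) auto
  also have "\<dots> = N"
    using vsum_stepline[OF q, of N] by (simp add: vsum_def m_def)
  finally have deg: "degree P < card (nodes (Suc N))"
    by (simp add: card_nodes)
  have s: "s \<notin> (\<lambda>(i, v). node i v) ` nodes (Suc N)"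
  proof clarify
    fix i v assume iv: "(i, v) \<in> nodes (Suc N)" and eq: "s = node i v"
    have "node i v + b j + 1 + of_nat u = 0"
      unfolding eq[symmetric] s_def by simp
    then show False
      using node_b_nonzero[of i j v u] iv j by (auto simp: nodes_def)
  qed
  have "(\<Sum>v<Suc N. moment_matrix p q r a b \<kappa> N v * A_matrix N v) =
      (\<Sum>x\<in>nodes (Suc N). - (nuA N * (- 1) ^ Suc N) *
        (poly P (case x of (i, v) \<Rightarrow> node i v) /
         (\<Prod>k\<in>nodes (Suc N) - {x}. (case x of (i, v) \<Rightarrow> node i v) - (case k of (i, v) \<Rightarrow> node i v)) /
         (s - (case x of (i, v) \<Rightarrow> node i v))))"
    unfolding A_column_sum u_def[symmetric] j_def[symmetric]
  proof (intro sum.cong refl, clarify)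
    fix i v assume iv: "(i, v) \<in> nodes (Suc N)"
    then have i: "i < p"
      by (auto simp: nodes_def)
    have deriv: "(\<Prod>k\<in>nodes (Suc N) - {(i, v)}. node i v - (case k of (i, v) \<Rightarrow> node i v)) =
        node_poly_deriv (Suc N) i v"
      by (simp add: node_poly_deriv_def case_prod_unfold)
    let ?B = "\<Prod>h<q. pochhammer (node i v + b h + 1) u"
    let ?Q = "\<Prod>h<q. pochhammer (node i v + (b h + 1 + of_nat u)) (m h - u)"
    have B: "?B \<noteq> 0"
      using i pochhammer_b_nonzero by auto
    have "(\<Prod>h<q. pochhammer (node i v + b h + 1) (m h)) =
        (\<Prod>h<q. pochhammer (node i v + b h + 1) u *
          pochhammer (node i v + (b h + 1 + of_nat u)) (m h - u))"
    proof (intro prod.cong refl)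
      fix h
      show "pochhammer (node i v + b h + 1) (m h) = pochhammer (node i v + b h + 1) u *
          pochhammer (node i v + (b h + 1 + of_nat u)) (m h - u)"
        using pochhammer_product[OF mh[of h], of "node i v + b h + 1"] by (simp add: add_ac)
    qed
    then have quot: "(\<Prod>h<q. pochhammer (node i v + b h + 1) (m h)) / (?B * x) = ?Q / x" for x
      using B by (simp add: prod.distrib)
    have neg: "node i v + b j + 1 + of_nat u = - (s - node i v)"
      by (simp add: s_def)
    show "A_coeff N i v * (W (node i (v + u)) / (node i (v + u) + b j + 1)) =
        - (nuA N * (- 1) ^ Suc N) * (poly P (node i v) /
          (\<Prod>k\<in>nodes (Suc N) - {(i, v)}. node i v - (case k of (i, v) \<Rightarrow> node i v)) / (s - node i v))"
      unfolding A_coeff_moment[OF i j] deriv m_def[symmetric] quot neg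
      by (simp only: divide_minus_right mult_minus_left mult_minus_right divide_minus_left)
        (simp add: P_def poly_prod poly_pochhammer_poly add.assoc mult_ac)
  qed
  also have "\<dots> = - (nuA N * (- 1) ^ Suc N) * (poly P s / (\<Prod>(i, v)\<in>nodes (Suc N). s - node i v))"
    unfolding sum_distrib_left[symmetric]
    using lagrange_partial_fractions[OF finite_nodes inj_on_node deg s]
    by (simp add: case_prod_unfold)
  also have "(\<Prod>(i, v)\<in>nodes (Suc N). s - node i v) =
      (- 1) ^ Suc N * (\<Prod>i<p. pochhammer (\<kappa> i + b j + of_nat u + 1) (lam i))"
  proof -
    have "(\<Prod>(i, v)\<in>nodes (Suc N). s - node i v) =
        (\<Prod>(i, v)\<in>nodes (Suc N). - 1 * (\<kappa> i + b j + of_nat u + 1 + of_nat v))"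
      by (intro prod.cong) (auto simp: s_def node_def)
    also have "\<dots> = (- 1) ^ Suc N * (\<Prod>(i, v)\<in>nodes (Suc N). \<kappa> i + b j + of_nat u + 1 + of_nat v)"
      by (simp only: case_prod_unfold prod.distrib prod_constant card_nodes)
    finally show ?thesis
      by (simp add: prod_nodes pochhammer_prod lam_def atLeast0LessThan)
  qed
  \<comment> \<open>Only components h < j have m h - u = 1; the others contribute empty
    products.\<close>
  also have "poly P s = (\<Prod>\<rho><r. pochhammer (a \<rho> - b j - of_nat u) u) * (\<Prod>h<j. b h - b j)"
  proof -
    have "(\<Prod>h<q. pochhammer (s + (b h + 1 + of_nat u)) (m h - u)) =
        (\<Prod>h<q. if h < j then b h - b j else 1)"
      by (intro prod.cong) (auto simp: m_def u_def j_def s_def stepline_def)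
    also have "\<dots> = (\<Prod>h<j. b h - b j)"
    proof (rule prod.mono_neutral_cong_right)
      show "{..<j} \<subseteq> {..<q}"
        using j by auto
    qed auto
    finally have "(\<Prod>h<q. pochhammer (s + (b h + 1 + of_nat u)) (m h - u)) = (\<Prod>h<j. b h - b j)" .
    moreover have "s + (a \<rho> + 1) = a \<rho> - b j - of_nat u" for \<rho>
      by (simp add: s_def)
    ultimately show ?thesis
      by (simp only: P_def poly_mult poly_prod poly_pochhammer_poly)
  qed
  also have "- (nuA N * (- 1) ^ Suc N) *
      ((\<Prod>\<rho><r. pochhammer (a \<rho> - b j - of_nat u) u) * (\<Prod>h<j. b h - b j) /
       ((- 1) ^ Suc N * (\<Prod>i<p. pochhammer (\<kappa> i + b j + of_nat u + 1) (lam i)))) = 1"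
  proof -
    have "(\<Prod>i<p. pochhammer (\<kappa> i + b j + of_nat u + 1) (lam i)) \<noteq> 0"
      using kappa_b_nonzero j by (auto simp: pochhammer_eq_0_iff add_eq_0_iff2)
    moreover have "pochhammer (a \<rho> - b j - of_nat u) u \<noteq> 0" if "\<rho> < r" for \<rho>
    proof (rule pochhammer_nonzeroI)
      fix k
      show "a \<rho> - b j - of_nat u + of_nat k \<noteq> 0"
        using a_b_nonzero[OF that j, of "int k - int u"] by (simp add: algebra_simps)
    qed
    then have "(\<Prod>\<rho><r. pochhammer (a \<rho> - b j - of_nat u) u) \<noteq> 0"
      by auto
    moreover have "(\<Prod>h<j. b h - b j) \<noteq> 0"
    proof -
      have "b h - b j \<noteq> 0" if "h < j" for h
        using b_diff_nonzero[of h j 0] that j by auto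
      then show ?thesis
        by auto
    qed
    moreover have "(- 1 :: complex) ^ Suc N \<noteq> 0"
      by simp
    ultimately show ?thesis
      unfolding nuA_eq u_def[symmetric] j_def[symmetric] lam_def[symmetric]
      by (simp add: field_simps del: power_Suc)
  qed
  finally show ?thesis .
qed

text \<open>The two forms agree after exchanging Pochhammer lengths by
  \<open>pochhammer_swap\<close>, once in the products over b and once in the differences of
  \<kappa>.\<close>

lemma A_step_eq:
  assumes i: "i < p"
  shows "A_step p q r a b \<kappa> N i z = (\<Sum>v<stepline p (Suc N) i. A_coeff N i v * z ^ v)"
proof (cases "stepline p (Suc N) i = 0")
  case True
  then show ?thesis
    by (simp add: A_step_def A_vec_def)
next
  case False
  define n m lam where "n = stepline p (Suc N) i" and "m = stepline q N" and "lam = stepline p (Suc N)"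
  define GA GB where "GA = (\<Prod>\<rho><r. Gamma (\<kappa> i + a \<rho> + 1))" and "GB = (\<Prod>h<q. Gamma (\<kappa> i + b h + 1))"
  have node0: "node i 0 = \<kappa> i"
    by (simp add: node_def)
  have nz: "GA \<noteq> 0" "GB \<noteq> 0"
    using i kappa_a kappa_b by (auto simp: GA_def GB_def Gamma_eq_zero_iff)
  have coeff: "C_A p q r a b \<kappa> lam m i * (pochhammer (1 - of_nat n) v
       * (\<Prod>h<q. pochhammer (\<kappa> i + b h + of_nat (m h) + 1) v)
       * (\<Prod>l\<in>{..<p} - {i}. pochhammer (\<kappa> i - \<kappa> l - of_nat (lam l) + 1) v)
       / ((\<Prod>\<rho><r. pochhammer (\<kappa> i + a \<rho> + 1) v)
          * (\<Prod>l\<in>{..<p} - {i}. pochhammer (\<kappa> i - \<kappa> l + 1) v))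
       * (z ^ v / fact v)) =
      (- 1) ^ Suc N * (\<Prod>h<q. pochhammer (node i v + b h + 1) (m h)) /
      (W (node i v) * node_poly_deriv (Suc N) i v) * z ^ v" if v: "v < n" for v
  proof -
    define PM where "PM = (\<Prod>h<q. pochhammer (\<kappa> i + b h + 1) (m h))"
    define PBm where "PBm = (\<Prod>h<q. pochhammer (\<kappa> i + b h + of_nat (m h) + 1) v)"
    define PA where "PA = (\<Prod>\<rho><r. pochhammer (\<kappa> i + a \<rho> + 1) v)"
    define PB where "PB = (\<Prod>h<q. pochhammer (\<kappa> i + b h + 1) v)"
    define PMv where "PMv = (\<Prod>h<q. pochhammer (node i v + b h + 1) (m h))"
    let ?x = "\<lambda>l. \<kappa> i - \<kappa> l - of_nat (lam l) + 1"
    define X1 where "X1 = (\<Prod>l\<in>{..<p} - {i}. pochhammer (?x l) (lam l))"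
    define X2 where "X2 = (\<Prod>l\<in>{..<p} - {i}. pochhammer (?x l) v)"
    define X3 where "X3 = (\<Prod>l\<in>{..<p} - {i}. pochhammer (\<kappa> i - \<kappa> l + 1) v)"
    define X4 where "X4 = (\<Prod>l\<in>{..<p} - {i}.
      pochhammer (\<kappa> i - \<kappa> l - of_nat (lam l) + (of_nat v + 1)) (lam l))"
    define s2 F' where "s2 = (- 1 :: complex) ^ (n - 1 - v)" and "F' = (fact (n - 1 - v) :: complex)"
    have swapB: "PM * PBm = PB * PMv"
      unfolding PM_def PBm_def PB_def PMv_def prod.distrib[symmetric]
    proof (intro prod.cong refl)
      fix h
      show "pochhammer (\<kappa> i + b h + 1) (m h) * pochhammer (\<kappa> i + b h + of_nat (m h) + 1) v =
          pochhammer (\<kappa> i + b h + 1) v * pochhammer (node i v + b h + 1) (m h)"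
        using pochhammer_swap[of "\<kappa> i + b h + 1" "m h" v] by (simp add: node_def add_ac)
    qed
    have swapX: "X1 * X3 = X2 * X4"
      unfolding X1_def X2_def X3_def X4_def prod.distrib[symmetric]
    proof (intro prod.cong refl)
      fix l
      show "pochhammer (?x l) (lam l) * pochhammer (\<kappa> i - \<kappa> l + 1) v =
          pochhammer (?x l) v * pochhammer (\<kappa> i - \<kappa> l - of_nat (lam l) + (of_nat v + 1)) (lam l)"
        using pochhammer_swap[of "?x l" "lam l" v] by (simp add: algebra_simps)
    qed
    have knz: "pochhammer (\<kappa> i - \<kappa> l + of_int c) k \<noteq> 0" if "l < p" "l \<noteq> i" for l c k
    proof (rule pochhammer_nonzeroI)
      fix k'
      show "\<kappa> i - \<kappa> l + of_int c + of_nat k' \<noteq> 0"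
        using kappa_diff_nonzero[OF i that(1), of "c + int k'"] that(2) by (simp add: add_ac)
    qed
    have Xnz: "X1 \<noteq> 0" "X2 \<noteq> 0" "X3 \<noteq> 0"
    proof -
      have "pochhammer (?x l) k \<noteq> 0" "pochhammer (\<kappa> i - \<kappa> l + 1) k \<noteq> 0"
        if "l \<in> {..<p} - {i}" for l k
        using knz[of l "1 - int (lam l)" k] knz[of l 1 k] that by (auto simp: algebra_simps)
      then show "X1 \<noteq> 0" "X2 \<noteq> 0" "X3 \<noteq> 0"
        by (auto simp: X1_def X2_def X3_def)
    qed
    have Pnz: "PA \<noteq> 0" "PB \<noteq> 0"
      using pochhammer_a_nonzero[OF i, of _ 0] pochhammer_b_nonzero[OF i, of _ 0]
      by (auto simp: PA_def PB_def node0)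
    have Wv: "W (node i v) = GA / GB * PA / PB"
      using W_ratio[OF i, of 0 v] by (simp add: node0 W_def GA_def GB_def PA_def PB_def)
    have deriv: "node_poly_deriv (Suc N) i v = s2 * fact v * F' * X4"
      using node_poly_deriv_eq[OF i v[unfolded n_def]]
      by (simp add: s2_def F'_def X4_def lam_def n_def)
    have poch1: "pochhammer (1 - of_nat n) v = (- 1) ^ v * fact (n - 1) / F'"
      unfolding F'_def using v by (rule pochhammer_one_minus_of_nat)
    have "(- 1 :: complex) ^ (n - 1) = (- 1) ^ v * s2"
      using v by (simp add: s2_def flip: power_add)
    then have C: "C_A p q r a b \<kappa> lam m i =
        (- 1) ^ Suc N * (GB / GA) * (PM / ((- 1) ^ v * s2 * fact (n - 1) * X1))"
      using vsum_stepline[OF p, of "Suc N"]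
      by (simp add: C_A_def GA_def GB_def PM_def X1_def lam_def n_def)
    have PMv': "PMv = PM * PBm / PB" and X4': "X4 = X1 * X3 / X2"
      using swapB swapX Pnz Xnz by (simp_all add: field_simps)
    have s2nz: "s2 \<noteq> 0" and F'nz: "F' \<noteq> 0"
      by (simp_all add: s2_def F'_def)
    \<comment> \<open>With all Pochhammer products abbreviated by letters the claim is a field
      identity.\<close>
    have alg: "S * (GB / GA) * (PM / (s1 * s2 * F * X1)) *
        (s1 * F / F' * PBm * X2 / (PA * X3) * (zz / fv)) =
        S * PMv / (GA / GB * PA / PB * (s2 * fv * F' * X4)) * zz"
      if "s1 \<noteq> 0" "F \<noteq> 0" "fv \<noteq> 0" for S s1 F fv zz :: complex
      unfolding PMv' X4' using that nz Pnz Xnz s2nz F'nz by (simp add: divide_simps)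
    show ?thesis
      unfolding C poch1 deriv Wv PBm_def[symmetric] X2_def[symmetric] X3_def[symmetric]
        PA_def[symmetric] PMv_def[symmetric]
      by (rule alg) auto
  qed
  have "A_step p q r a b \<kappa> N i z = nuA N * C_A p q r a b \<kappa> lam m i * (\<Sum>v<n. pochhammer (1 - of_nat n) v
       * (\<Prod>h<q. pochhammer (\<kappa> i + b h + of_nat (m h) + 1) v)
       * (\<Prod>l\<in>{..<p} - {i}. pochhammer (\<kappa> i - \<kappa> l - of_nat (lam l) + 1) v)
       / ((\<Prod>\<rho><r. pochhammer (\<kappa> i + a \<rho> + 1) v)
          * (\<Prod>l\<in>{..<p} - {i}. pochhammer (\<kappa> i - \<kappa> l + 1) v))
       * (z ^ v / fact v))"
  proof -
    have "{0..n - 1} = {..<n}"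
      using False by (auto simp: n_def)
    then show ?thesis
      using False by (simp add: A_step_def A_vec_def lam_def n_def m_def nuA_def)
  qed
  also have "\<dots> = (\<Sum>v<n. A_coeff N i v * z ^ v)"
    unfolding sum_distrib_left mult.assoc[of "nuA N" "C_A p q r a b \<kappa> lam m i"]
  proof (intro sum.cong refl)
    fix v assume "v \<in> {..<n}"
    then show "nuA N * (C_A p q r a b \<kappa> lam m i * (pochhammer (1 - of_nat n) v
       * (\<Prod>h<q. pochhammer (\<kappa> i + b h + of_nat (m h) + 1) v)
       * (\<Prod>l\<in>{..<p} - {i}. pochhammer (\<kappa> i - \<kappa> l - of_nat (lam l) + 1) v)
       / ((\<Prod>\<rho><r. pochhammer (\<kappa> i + a \<rho> + 1) v)
          * (\<Prod>l\<in>{..<p} - {i}. pochhammer (\<kappa> i - \<kappa> l + 1) v))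
       * (z ^ v / fact v))) = A_coeff N i v * z ^ v"
      by (subst coeff) (auto simp: A_coeff_def m_def)
  qed
  finally show ?thesis
    by (simp add: n_def)
qed

section \<open>The vectors of type B\<close>

text \<open>The residue at t = - b j - 1 of the ratio of \<open>W\<close> at t + 1 and t.\<close>

definition residue_weight :: "nat \<Rightarrow> complex" where
  "residue_weight j = (\<Prod>\<rho><r. a \<rho> - b j) / (\<Prod>h\<in>{..<q} - {j}. b h - b j)"

lemma inj_on_neg_b: "inj_on (\<lambda>j. - b j - 1) {..<q}"
proof (rule inj_onI, rule ccontr)
  fix x y assume "x \<in> {..<q}" "y \<in> {..<q}" "- b x - 1 = - b y - 1" "x \<noteq> y"
  then show False
    using b_diff_nonzero[of x y 0] by auto
qed

lemma a_poly_expansion: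
  "(\<Prod>\<rho><r. t + a \<rho> + 1) = (\<Sum>j<q. residue_weight j * (\<Prod>h\<in>{..<q} - {j}. t + b h + 1))"
proof -
  define P where "P = (\<Prod>\<rho><r. [:a \<rho> + 1, 1:])"
  have "degree P \<le> (\<Sum>\<rho><r. 1)"
    unfolding P_def by (rule degree_prod_le) auto
  then have "degree P < card {..<q}"
    using rq by simp
  from lagrange_interpolation[OF finite_lessThan inj_on_neg_b this, of t]
  show ?thesis
    by (simp add: P_def poly_prod residue_weight_def algebra_simps)
qed

lemma ab_quotient_expansion:
  assumes "\<And>h. h < q \<Longrightarrow> t + b h + 1 \<noteq> 0"
  shows "(\<Prod>\<rho><r. t + a \<rho> + 1) / (\<Prod>h<q. t + b h + 1) = (\<Sum>j<q. residue_weight j / (t + b j + 1))"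
  unfolding a_poly_expansion sum_divide_distrib
proof (intro sum.cong refl)
  fix j assume j: "j \<in> {..<q}"
  have "(\<Prod>h\<in>{..<q} - {j}. t + b h + 1) \<noteq> 0"
    using assms by auto
  then show "residue_weight j * (\<Prod>h\<in>{..<q} - {j}. t + b h + 1) / (\<Prod>h<q. t + b h + 1) =
      residue_weight j / (t + b j + 1)"
    by (subst prod.remove[OF finite_lessThan j]) simp
qed

text \<open>The left side vanishes at t = c. Expanding both terms with the same residues exposes the
  factor t - c in every summand.\<close>

lemma ab_difference_expansion:
  assumes "\<And>h. h < q \<Longrightarrow> t + b h + 1 \<noteq> 0"
  shows "(\<Prod>\<rho><r. c + a \<rho> + 1) - (\<Prod>h<q. c + b h + 1) * ((\<Prod>\<rho><r. t + a \<rho> + 1) / (\<Prod>h<q. t + b h + 1)) =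
    (t - c) * (\<Sum>j<q. residue_weight j * (\<Prod>h\<in>{..<q} - {j}. c + b h + 1) / (t + b j + 1))"
proof -
  have quot: "(\<Prod>\<rho><r. t + a \<rho> + 1) / (\<Prod>h<q. t + b h + 1) =
      (\<Sum>j<q. residue_weight j / (t + b j + 1))"
    using assms by (rule ab_quotient_expansion)
  show ?thesis
    unfolding quot a_poly_expansion[of c] sum_distrib_left sum_subtractf[symmetric]
  proof (intro sum.cong refl)
    fix j assume j: "j \<in> {..<q}"
    have "(\<Prod>h<q. c + b h + 1) = (c + b j + 1) * (\<Prod>h\<in>{..<q} - {j}. c + b h + 1)"
      using j by (subst prod.remove) auto
    then show "residue_weight j * (\<Prod>h\<in>{..<q} - {j}. c + b h + 1) -
        (\<Prod>h<q. c + b h + 1) * (residue_weight j / (t + b j + 1)) =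
        (t - c) * (residue_weight j * (\<Prod>h\<in>{..<q} - {j}. c + b h + 1) / (t + b j + 1))"
      using assms[of j] j by (simp add: field_simps)
  qed
qed

section \<open>Expansion of a simple pole in moment functions\<close>

definition pole :: "nat \<Rightarrow> nat \<Rightarrow> complex" where
  "pole H K = - (b H + of_nat K + 1)"

definition poles :: "nat \<Rightarrow> (nat \<times> nat) set" where
  "poles N = (SIGMA H:{..<q}. {..<stepline q N H})"

text \<open>
  \<open>pole_coeff H K j \<beta>\<close> is the coefficient with which the moment \<open>W (s + \<beta>) / (s + \<beta> + b j + 1)\<close>,
  divided by \<open>W s\<close>, enters the expansion of \<open>1 / (s - pole H K)\<close>.
\<close>
definition pole_coeff :: "nat \<Rightarrow> nat \<Rightarrow> nat \<Rightarrow> nat \<Rightarrow> complex" where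
  "pole_coeff H K j \<beta> = residue_weight j *
    (\<Prod>h<q. pochhammer (b h - (b H + of_nat K)) (\<beta> + of_bool (h \<noteq> j))) /
    (\<Prod>\<rho><r. pochhammer (a \<rho> - (b H + of_nat K)) (Suc \<beta>))"

text \<open>The factor h = H is a Pochhammer symbol of - K whose length exceeds K. Its length
  depends on whether j = H, hence the two ranges of \<beta> in the pairing block.\<close>

lemma pole_coeff_eq_0:
  assumes "H < q" "if j = H then K < \<beta> else K \<le> \<beta>"
  shows "pole_coeff H K j \<beta> = 0"
proof -
  have "pochhammer (b H - (b H + of_nat K)) (\<beta> + of_bool (H \<noteq> j)) = 0"
    unfolding pochhammer_eq_0_iff using assms(2) by (intro exI[of _ K]) (auto split: if_splits)
  then have "(\<Prod>h<q. pochhammer (b h - (b H + of_nat K)) (\<beta> + of_bool (h \<noteq> j))) = 0"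
    using assms(1) by (intro prod_zero bexI[of _ H]) auto
  then show ?thesis
    by (simp add: pole_coeff_def)
qed

lemma pochhammer_ab_nonzero:
  assumes "\<rho> < r" "H < q"
  shows "pochhammer (a \<rho> - (b H + of_nat K)) n \<noteq> 0"
proof (rule pochhammer_nonzeroI)
  fix k
  show "a \<rho> - (b H + of_nat K) + of_nat k \<noteq> 0"
    using a_b_nonzero[OF assms, of "int k - int K"] by (simp add: algebra_simps)
qed

lemma pochhammer_bb_nonzero:
  assumes "h < q" "H < q" "h \<noteq> H"
  shows "pochhammer (b h - (b H + of_nat K)) n \<noteq> 0"
proof (rule pochhammer_nonzeroI)
  fix k
  show "b h - (b H + of_nat K) + of_nat k \<noteq> 0"
    using b_diff_nonzero[OF assms, of "int k - int K"] by (simp add: algebra_simps)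
qed

text \<open>\<open>g \<beta>\<close> is the ratio of \<open>W\<close> at s + \<beta> and s, and
  \<open>e \<beta>\<close> is formally the reciprocal of the same function at the pole. The product,
  divided by s - c, telescopes: its differences expand into moment functions, it starts at 1 / (s -
  c), and it ends at zero because \<open>e (Suc K) = 0\<close>.\<close>

lemma pole_expansion:
  fixes v :: nat
  assumes i: "i < p" and H: "H < q"
  defines "s \<equiv> node i v"
  shows "(\<Sum>\<beta><Suc K. \<Sum>j<q. pole_coeff H K j \<beta> *
      ((\<Prod>\<rho><r. pochhammer (s + a \<rho> + 1) \<beta>) / (\<Prod>h<q. pochhammer (s + b h + 1) \<beta>) /
       (s + b j + 1 + of_nat \<beta>))) = 1 / (s - pole H K)"
proof -
  define c where "c = pole H K"
  define g where "g = (\<lambda>\<beta>. (\<Prod>\<rho><r. pochhammer (s + a \<rho> + 1) \<beta>) / (\<Prod>h<q. pochhammer (s + b h + 1) \<beta>))"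
  define e where "e = (\<lambda>\<beta>. (\<Prod>h<q. pochhammer (b h - (b H + of_nat K)) \<beta>) /
      (\<Prod>\<rho><r. pochhammer (a \<rho> - (b H + of_nat K)) \<beta>))"
  have "s - c = node i v + b H + 1 + of_nat K"
    by (simp add: c_def pole_def s_def)
  then have sc: "s - c \<noteq> 0"
    using node_b_nonzero[OF i H, of v K] by simp
  have step: "(\<Sum>j<q. pole_coeff H K j \<beta> * (g \<beta> / (s + b j + 1 + of_nat \<beta>))) =
      e \<beta> * g \<beta> / (s - c) - e (Suc \<beta>) * g (Suc \<beta>) / (s - c)" for \<beta>
  proof -
    \<comment> \<open>Each step is the difference identity with both arguments translated by
      \<beta>, which leaves their distance s - c unchanged.\<close>
    define t c' where "t = s + of_nat \<beta>" and "c' = c + of_nat \<beta>"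
    define At Bt Ac Bc where "At = (\<Prod>\<rho><r. t + a \<rho> + 1)" and "Bt = (\<Prod>h<q. t + b h + 1)"
      and "Ac = (\<Prod>\<rho><r. c' + a \<rho> + 1)" and "Bc = (\<Prod>h<q. c' + b h + 1)"
    have tnz: "t + b h + 1 \<noteq> 0" if "h < q" for h
      using node_b_nonzero[OF i that, of v \<beta>] by (simp add: t_def s_def add_ac)
    have cx: "c' + x + 1 = x - (b H + of_nat K) + of_nat \<beta>" for x
      by (simp add: c'_def c_def pole_def)
    have "c' + a \<rho> + 1 \<noteq> 0" if "\<rho> < r" for \<rho>
      using a_b_nonzero[OF that H, of "int \<beta> - int K"] unfolding cx by (simp add: algebra_simps)
    then have Acnz: "Ac \<noteq> 0"
      by (auto simp: Ac_def)
    have g_Suc: "g (Suc \<beta>) = g \<beta> * (At / Bt)"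
      by (simp add: g_def pochhammer_Suc prod.distrib At_def Bt_def t_def add_ac)
    have e_Suc: "e (Suc \<beta>) = e \<beta> * (Bc / Ac)"
      by (simp add: e_def pochhammer_Suc prod.distrib Ac_def Bc_def cx)
    have pc: "pole_coeff H K j \<beta> =
        e \<beta> / Ac * (residue_weight j * (\<Prod>h\<in>{..<q} - {j}. c' + b h + 1))" if "j < q" for j
    proof -
      have "(\<Prod>h<q. pochhammer (b h - (b H + of_nat K)) (\<beta> + of_bool (h \<noteq> j))) =
          (\<Prod>h<q. pochhammer (b h - (b H + of_nat K)) \<beta> * (if h \<noteq> j then c' + b h + 1 else 1))"
        by (intro prod.cong refl) (auto simp: pochhammer_Suc cx)
      also have "\<dots> = (\<Prod>h<q. pochhammer (b h - (b H + of_nat K)) \<beta>) *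
          (\<Prod>h\<in>{..<q} - {j}. c' + b h + 1)"
        unfolding prod.distrib by (intro arg_cong2[where f = "(*)"] refl prod.mono_neutral_cong_right) auto
      finally show ?thesis
        by (simp add: pole_coeff_def e_def pochhammer_Suc prod.distrib Ac_def cx)
    qed
    have "(\<Sum>j<q. pole_coeff H K j \<beta> * (g \<beta> / (s + b j + 1 + of_nat \<beta>))) =
        (\<Sum>j<q. e \<beta> * g \<beta> / Ac *
          (residue_weight j * (\<Prod>h\<in>{..<q} - {j}. c' + b h + 1) / (t + b j + 1)))"
    proof (intro sum.cong refl)
      fix j assume "j \<in> {..<q}"
      then have "j < q"
        by simp
      have den: "s + b j + 1 + of_nat \<beta> = t + b j + 1"
        by (simp add: t_def)
      show "pole_coeff H K j \<beta> * (g \<beta> / (s + b j + 1 + of_nat \<beta>)) = e \<beta> * g \<beta> / Ac *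
          (residue_weight j * (\<Prod>h\<in>{..<q} - {j}. c' + b h + 1) / (t + b j + 1))"
        unfolding den pc[OF \<open>j < q\<close>] by (simp add: mult_ac)
    qed
    also have "\<dots> = e \<beta> * g \<beta> / Ac * ((Ac - Bc * (At / Bt)) / (s - c))"
    proof -
      have "t - c' = s - c"
        by (simp add: t_def c'_def)
      then show ?thesis
        unfolding sum_distrib_left[symmetric]
        using ab_difference_expansion[OF tnz, of c'] sc
        by (simp add: Ac_def Bc_def At_def Bt_def)
    qed
    also have "\<dots> = e \<beta> * g \<beta> / (s - c) - e (Suc \<beta>) * g (Suc \<beta>) / (s - c)"
    proof -
      have "x * y / Ac * ((Ac - Bc * w) / z) = x * y / z - x * (Bc / Ac) * (y * w) / z"
        if "z \<noteq> 0" for x y z w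
        using that Acnz by (simp add: field_simps)
      then show ?thesis
        unfolding g_Suc e_Suc using sc by blast
    qed
    finally show ?thesis .
  qed
  have "(\<Sum>\<beta><Suc K. \<Sum>j<q. pole_coeff H K j \<beta> * (g \<beta> / (s + b j + 1 + of_nat \<beta>))) =
      e 0 * g 0 / (s - c) - e (Suc K) * g (Suc K) / (s - c)"
    unfolding step by (rule sum_lessThan_telescope')
  also have "e (Suc K) = 0"
  proof -
    have "pochhammer (b H - (b H + of_nat K)) (Suc K) = 0"
      unfolding pochhammer_eq_0_iff by (intro exI[of _ K]) auto
    then have "(\<Prod>h<q. pochhammer (b h - (b H + of_nat K)) (Suc K)) = 0"
      using H by (intro prod_zero bexI[of _ H]) auto
    then show ?thesis
      by (simp add: e_def)
  qed
  finally show ?thesis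
    by (simp add: g_def e_def c_def)
qed

lemma finite_poles [simp]: "finite (poles N)"
  by (auto simp: poles_def)

lemma card_poles: "card (poles N) = N"
  using vsum_stepline[OF q, of N] by (simp add: poles_def vsum_def)

lemma inj_on_pole: "inj_on (\<lambda>(H, K). pole H K) (poles N)"
proof (rule inj_onI, clarify)
  fix H K h k
  assume mem: "(H, K) \<in> poles N" "(h, k) \<in> poles N" and eq: "pole H K = pole h k"
  have "H = h"
  proof (rule ccontr)
    assume "H \<noteq> h"
    then show False
      using b_diff_nonzero[of H h "int K - int k"] mem eq
      by (auto simp: poles_def pole_def algebra_simps)
  qed
  then show "H = h \<and> K = k"
    using eq by (simp add: pole_def)
qed

section \<open>Type B coefficients from partial fractions\<close>

definition pole_poly_deriv :: "nat \<Rightarrow> nat \<Rightarrow> nat \<Rightarrow> complex" where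
  "pole_poly_deriv N H K = (\<Prod>(h, k)\<in>poles N - {(H, K)}. pole H K - pole h k)"

text \<open>Poles in one progression run in the direction opposite to nodes. Reversing each
  difference turns the sign of \<open>prod_diff_of_nat_except\<close> into (- 1)^K.\<close>

lemma pole_poly_deriv_eq:
  assumes "H < q" "K < stepline q N H"
  shows "pole_poly_deriv N H K = (- 1) ^ K * fact K * fact (stepline q N H - K - 1) *
    (\<Prod>h\<in>{..<q} - {H}. pochhammer (b h - (b H + of_nat K)) (stepline q N h))"
proof -
  let ?n = "stepline q N H"
  have "pole_poly_deriv N H K = (\<Prod>k\<in>{..<?n} - {K}. pole H K - pole H k) *
      (\<Prod>h\<in>{..<q} - {H}. \<Prod>k<stepline q N h. pole H K - pole h k)"
    unfolding pole_poly_deriv_def poles_def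
    using assms by (subst prod_Sigma_remove) auto
  also have "(\<Prod>k\<in>{..<?n} - {K}. pole H K - pole H k) =
      (\<Prod>k\<in>{..<?n} - {K}. - 1 * (of_nat K - of_nat k))"
    by (simp add: pole_def)
  also have "\<dots> = (- 1) ^ (?n - 1) * ((- 1) ^ (?n - 1 - K) * fact K * fact (?n - 1 - K))"
    unfolding prod.distrib prod_diff_of_nat_except[OF assms(2)] using assms(2) by simp
  also have "(- 1 :: complex) ^ (?n - 1) = (- 1) ^ K * (- 1) ^ (?n - 1 - K)"
    using assms(2) by (simp flip: power_add)
  also have "(\<Prod>h\<in>{..<q} - {H}. \<Prod>k<stepline q N h. pole H K - pole h k) =
      (\<Prod>h\<in>{..<q} - {H}. pochhammer (b h - (b H + of_nat K)) (stepline q N h))"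
    by (intro prod.cong refl) (simp add: pole_def pochhammer_prod atLeast0LessThan algebra_simps)
  finally have "pole_poly_deriv N H K = (- 1) ^ K * ((- 1) ^ (?n - 1 - K) * (- 1) ^ (?n - 1 - K)) *
      fact K * fact (?n - 1 - K) *
      (\<Prod>h\<in>{..<q} - {H}. pochhammer (b h - (b H + of_nat K)) (stepline q N h))"
    by (simp only: mult_ac)
  also have "(- 1 :: complex) ^ (?n - 1 - K) * (- 1) ^ (?n - 1 - K) = 1"
    by (simp flip: power_mult_distrib)
  finally show ?thesis
    by (simp add: diff_commute)
qed

text \<open>Up to the sign (- 1)^N, the residue of the rational function with the nodes as zeros and
  these poles. It is minus the \<pi> with indices H, K of the normalized vectors.\<close>

definition pole_weight :: "nat \<Rightarrow> nat \<Rightarrow> nat \<Rightarrow> complex" where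
  "pole_weight N H K = (\<Prod>i<p. pochhammer (\<kappa> i + (b H + of_nat K + 1)) (stepline p N i)) /
    pole_poly_deriv (Suc N) H K"

lemma node_neq_pole:
  assumes "i < p" "H < q"
  shows "node i v \<noteq> pole H K"
  using node_b_nonzero[OF assms, of v K] by (auto simp: pole_def)

text \<open>The numerator has degree N, below the number N + 1 of poles, so its partial fractions
  reproduce it, and it vanishes at the nodes.\<close>

lemma sum_pole_weight:
  assumes iv: "(i, v) \<in> nodes N"
  shows "(\<Sum>(H, K)\<in>poles (Suc N). pole_weight N H K / (node i v - pole H K)) = 0"
proof -
  define P where "P = (\<Prod>(l, w)\<in>nodes N. [:- node l w, 1:])"
  have "degree P \<le> (\<Sum>x\<in>nodes N. 1)"
    unfolding P_def by (rule degree_prod_le) auto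
  then have deg: "degree P < card (poles (Suc N))"
    by (simp add: card_poles card_nodes)
  have i: "i < p"
    using iv by (auto simp: nodes_def)
  have notin: "node i v \<notin> (\<lambda>(H, K). pole H K) ` poles (Suc N)"
    using node_neq_pole[OF i] by (auto simp: poles_def)
  have P_pole: "poly P (pole H K) =
      (- 1) ^ N * (\<Prod>i<p. pochhammer (\<kappa> i + (b H + of_nat K + 1)) (stepline p N i))" for H K
  proof -
    have "poly P (pole H K) = (\<Prod>(l, w)\<in>nodes N. - 1 * (\<kappa> l + (b H + of_nat K + 1) + of_nat w))"
      by (simp add: P_def poly_prod case_prod_unfold pole_def node_def algebra_simps)
    also have "\<dots> = (- 1) ^ N * (\<Prod>(l, w)\<in>nodes N. \<kappa> l + (b H + of_nat K + 1) + of_nat w)"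
      by (simp only: case_prod_unfold prod.distrib prod_constant card_nodes)
    finally show ?thesis
      by (simp add: prod_nodes pochhammer_prod atLeast0LessThan)
  qed
  have "(\<Sum>(H, K)\<in>poles (Suc N). pole_weight N H K / (node i v - pole H K)) =
      (\<Sum>x\<in>poles (Suc N). (- 1) ^ N * (poly P (case x of (H, K) \<Rightarrow> pole H K) /
        (\<Prod>y\<in>poles (Suc N) - {x}. (case x of (H, K) \<Rightarrow> pole H K) - (case y of (H, K) \<Rightarrow> pole H K)) /
        (node i v - (case x of (H, K) \<Rightarrow> pole H K))))"
    by (intro sum.cong refl)
      (auto simp: pole_weight_def P_pole pole_poly_deriv_def case_prod_unfold simp flip: power_add mult_2)
  also have "\<dots> = (- 1) ^ N * (poly P (node i v) /
      (\<Prod>y\<in>poles (Suc N). node i v - (case y of (H, K) \<Rightarrow> pole H K)))"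
    unfolding sum_distrib_left[symmetric]
    by (simp only: lagrange_partial_fractions[OF finite_poles inj_on_pole deg notin])
  also have "poly P (node i v) = 0"
    unfolding P_def poly_prod by (intro prod_zero bexI[OF _ iv]) auto
  finally show ?thesis
    by simp
qed

text \<open>Collects the contribution of all poles to one moment function after each partial
  fraction has been expanded.\<close>

definition B_unnormalized :: "nat \<Rightarrow> nat \<Rightarrow> nat \<Rightarrow> complex" where
  "B_unnormalized N j \<beta> = (\<Sum>(H, K)\<in>poles (Suc N). pole_weight N H K * pole_coeff H K j \<beta>)"

text \<open>The coefficient at linear position \<open>N\<close>, the last of the vector; dividing by
  it makes \<open>B_matrix\<close> unitriangular.\<close>

definition B_lead :: "nat \<Rightarrow> complex" where
  "B_lead N = B_unnormalized N (N mod q) (N div q)"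

definition B_matrix :: "nat \<Rightarrow> nat \<Rightarrow> complex" where
  "B_matrix N L = (if L \<le> N then B_unnormalized N (L mod q) (L div q) / B_lead N else 0)"

lemma pole_le:
  assumes "(H, K) \<in> poles (Suc N)"
  shows "K \<le> N div q"
proof -
  have "K < stepline q (Suc N) H" "H < q"
    using assms by (auto simp: poles_def)
  then show ?thesis
    using stepline_Suc[OF q, of H N] by (auto split: if_splits simp: of_bool_def)
qed

text \<open>Every pole has K <= N div q, so by \<open>pole_coeff_eq_0\<close> a single pole reaches
  the top coefficient; the rest is cancellation in that term.\<close>

lemma B_lead_eq:
  "B_lead N = (\<Prod>i<p. pochhammer (\<kappa> i + (b (N mod q) + of_nat (N div q) + 1)) (stepline p N i)) /
    ((\<Prod>\<rho><r. pochhammer (a \<rho> - (b (N mod q) + of_nat (N div q))) (N div q)) *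
     (\<Prod>h<N mod q. b h - b (N mod q)))"
proof -
  define u J where "u = N div q" and "J = N mod q"
  have J: "J < q"
    using q by (simp add: J_def)
  have muJ: "stepline q (Suc N) J = Suc u"
    using stepline_Suc[OF q J, of N] by (simp add: u_def J_def)
  have mem: "(J, u) \<in> poles (Suc N)"
    using J muJ by (auto simp: poles_def)
  have "B_lead N = (\<Sum>x\<in>poles (Suc N). if x = (J, u) then pole_weight N J u * pole_coeff J u J u else 0)"
    unfolding B_lead_def B_unnormalized_def
  proof (intro sum.cong refl, clarify)
    fix H K assume HK: "(H, K) \<in> poles (Suc N)"
    have K: "K \<le> u"
      using pole_le[OF HK] by (simp add: u_def)
    have "pole_coeff H K J u = 0" if "(H, K) \<noteq> (J, u)"
      using HK K that by (intro pole_coeff_eq_0) (auto simp: poles_def)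
    then show "pole_weight N H K * pole_coeff H K (N mod q) (N div q) =
        (if (H, K) = (J, u) then pole_weight N J u * pole_coeff J u J u else 0)"
      by (auto simp: u_def J_def)
  qed
  also have "\<dots> = pole_weight N J u * pole_coeff J u J u"
    using mem by simp
  finally have lead: "B_lead N = pole_weight N J u * pole_coeff J u J u" .
  let ?x = "\<lambda>h. b h - (b J + of_nat u)"
  have low: "(\<Prod>h\<in>{..<q} - {J}. b h - b J) = (\<Prod>h<J. b h - b J) * (\<Prod>h\<in>{J<..<q}. b h - b J)"
  proof -
    have split: "{..<q} - {J} = {..<J} \<union> {J<..<q}"
      using J by auto
    show ?thesis
      unfolding split by (rule prod.union_disjoint) auto
  qed
  \<comment> \<open>For h > J the step-line component is \<open>u\<close>, one short of
    \<open>Suc u\<close>. The extra factors b h - b J cancel the part h > J of the denominator of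
    \<open>residue_weight\<close>.\<close>
  have quot: "(\<Prod>h\<in>{..<q} - {J}. pochhammer (?x h) (Suc u)) =
      (\<Prod>h\<in>{..<q} - {J}. pochhammer (?x h) (stepline q (Suc N) h)) * (\<Prod>h\<in>{J<..<q}. b h - b J)"
  proof -
    have "(\<Prod>h\<in>{..<q} - {J}. pochhammer (?x h) (Suc u)) =
        (\<Prod>h\<in>{..<q} - {J}. pochhammer (?x h) (stepline q (Suc N) h) * (if J < h then b h - b J else 1))"
      by (intro prod.cong refl) (auto simp: stepline_Suc[OF q] u_def J_def pochhammer_Suc)
    moreover have "(\<Prod>h\<in>{..<q} - {J}. if J < h then b h - b J else 1) = (\<Prod>h\<in>{J<..<q}. b h - b J)"
      by (rule prod.mono_neutral_cong_right) auto
    ultimately show ?thesis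
      by (simp only: prod.distrib)
  qed
  have num: "(\<Prod>h<q. pochhammer (?x h) (u + of_bool (h \<noteq> J))) =
      (- 1) ^ u * fact u * (\<Prod>h\<in>{..<q} - {J}. pochhammer (?x h) (Suc u))"
  proof -
    have "(\<Prod>h<q. pochhammer (?x h) (u + of_bool (h \<noteq> J))) =
        pochhammer (- of_nat u) u * (\<Prod>h\<in>{..<q} - {J}. pochhammer (?x h) (u + of_bool (h \<noteq> J)))"
      using J by (subst prod.remove[of _ J]) auto
    also have "(\<Prod>h\<in>{..<q} - {J}. pochhammer (?x h) (u + of_bool (h \<noteq> J))) =
        (\<Prod>h\<in>{..<q} - {J}. pochhammer (?x h) (Suc u))"
      by (intro prod.cong) auto
    also have "pochhammer (- of_nat u :: complex) u = (- 1) ^ u * fact u"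
      using pochhammer_one_minus_of_nat[of u "Suc u", where 'a = complex] by simp
    finally show ?thesis .
  qed
  have a_prod: "(\<Prod>\<rho><r. pochhammer (a \<rho> - (b J + of_nat u)) (Suc u)) =
      (\<Prod>\<rho><r. pochhammer (a \<rho> - (b J + of_nat u)) u) * (\<Prod>\<rho><r. a \<rho> - b J)"
    by (simp add: pochhammer_Suc prod.distrib)
  have deriv: "pole_poly_deriv (Suc N) J u = (- 1) ^ u * fact u *
      (\<Prod>h\<in>{..<q} - {J}. pochhammer (?x h) (stepline q (Suc N) h))"
    using pole_poly_deriv_eq[OF J, of u "Suc N"] muJ by simp
  have nz1: "(\<Prod>\<rho><r. a \<rho> - b J) \<noteq> 0"
    using a_b_nonzero[OF _ J, of _ 0] by auto
  have nz2: "(\<Prod>h\<in>{..<q} - {J}. pochhammer (?x h) (stepline q (Suc N) h)) \<noteq> 0"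
    using pochhammer_bb_nonzero[OF _ J] by auto
  have nz3: "(\<Prod>h\<in>{J<..<q}. b h - b J) \<noteq> 0"
    using b_diff_nonzero[OF _ J, of _ 0] by auto
  have nz4: "(- 1 :: complex) ^ u * fact u \<noteq> 0"
    by simp
  have alg: "X / (f * D) * (A / (lo * hi) * (f * (D * hi)) / (PA * A)) = X / (PA * lo)"
    if "A \<noteq> 0" "D \<noteq> 0" "hi \<noteq> 0" "f \<noteq> 0" for X f D A lo hi PA :: complex
    using that by (cases "lo = 0"; cases "PA = 0") (auto simp: field_simps)
  show ?thesis
    unfolding lead pole_weight_def deriv pole_coeff_def residue_weight_def num low a_prod quot
      u_def[symmetric] J_def[symmetric]
    by (rule alg) (use nz1 nz2 nz3 nz4 in auto)
qed

lemma B_lead_nonzero: "B_lead N \<noteq> 0"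
proof -
  define u J where "u = N div q" and "J = N mod q"
  have J: "J < q"
    using q by (simp add: J_def)
  have "(\<Prod>i<p. pochhammer (\<kappa> i + (b J + of_nat u + 1)) (stepline p N i)) \<noteq> 0"
  proof -
    have "pochhammer (\<kappa> i + (b J + of_nat u + 1)) k \<noteq> 0" if "i < p" for i k
      using kappa_b_nonzero[OF that J, of u] by (intro pochhammer_nonzeroI) (simp add: add_ac)
    then show ?thesis
      by auto
  qed
  moreover have "(\<Prod>\<rho><r. pochhammer (a \<rho> - (b J + of_nat u)) u) \<noteq> 0"
    using pochhammer_ab_nonzero[OF _ J] by auto
  moreover have "(\<Prod>h<J. b h - b J) \<noteq> 0"
  proof -
    have "b h - b J \<noteq> 0" if "h < J" for h
      using b_diff_nonzero[of h J 0] that J by auto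
    then show ?thesis
      by auto
  qed
  ultimately show ?thesis
    by (simp add: B_lead_eq u_def J_def)
qed

text \<open>Adapts the \<beta>-range to the component lengths. Those are larger than K for j = H and
  at least K otherwise, and all terms by which the ranges differ vanish by
  \<open>pole_coeff_eq_0\<close>.\<close>

lemma pole_expansion_stepline:
  fixes v :: nat
  assumes i: "i < p" and HK: "(H, K) \<in> poles (Suc N)"
  defines "s \<equiv> node i v"
  shows "(\<Sum>j<q. \<Sum>\<beta><stepline q (Suc N) j. pole_coeff H K j \<beta> *
      ((\<Prod>\<rho><r. pochhammer (s + a \<rho> + 1) \<beta>) / (\<Prod>h<q. pochhammer (s + b h + 1) \<beta>) /
       (s + b j + 1 + of_nat \<beta>))) = 1 / (s - pole H K)"
proof -
  have H: "H < q" and K: "K < stepline q (Suc N) H"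
    using HK by (auto simp: poles_def)
  define f where "f = (\<lambda>j \<beta>. (\<Prod>\<rho><r. pochhammer (s + a \<rho> + 1) \<beta>) /
    (\<Prod>h<q. pochhammer (s + b h + 1) \<beta>) / (s + b j + 1 + of_nat \<beta>))"
  have "(\<Sum>\<beta><stepline q (Suc N) j. pole_coeff H K j \<beta> * f j \<beta>) =
      (\<Sum>\<beta><Suc K. pole_coeff H K j \<beta> * f j \<beta>)" if "j < q" for j
  proof (cases "j = H")
    case True
    show ?thesis
      using K True pole_coeff_eq_0[OF H, of H K] by (intro sum.mono_neutral_right) auto
  next
    case False
    have "K \<le> stepline q (Suc N) j"
      using pole_le[OF HK] stepline_Suc[OF q that, of N] by simp
    then have "(\<Sum>\<beta><stepline q (Suc N) j. pole_coeff H K j \<beta> * f j \<beta>) =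
        (\<Sum>\<beta><K. pole_coeff H K j \<beta> * f j \<beta>)"
      using False pole_coeff_eq_0[OF H, of j K] by (intro sum.mono_neutral_right) auto
    then show ?thesis
      using pole_coeff_eq_0[OF H, of j K K] False by simp
  qed
  note inner = this
  have "(\<Sum>j<q. \<Sum>\<beta><stepline q (Suc N) j. pole_coeff H K j \<beta> * f j \<beta>) =
      (\<Sum>j<q. \<Sum>\<beta><Suc K. pole_coeff H K j \<beta> * f j \<beta>)"
    by (rule sum.cong[OF refl]) (simp only: inner lessThan_iff)
  also have "\<dots> = (\<Sum>\<beta><Suc K. \<Sum>j<q. pole_coeff H K j \<beta> * f j \<beta>)"
    by (rule sum.swap)
  also have "\<dots> = 1 / (s - pole H K)"
    unfolding f_def s_def by (rule pole_expansion[OF i H])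
  finally show ?thesis
    by (simp only: f_def)
qed

lemma B_unitriangular: "lower_unitriangular B_matrix"
  using B_lead_nonzero by (auto simp: lower_unitriangular_def B_matrix_def B_lead_def[symmetric])

text \<open>At a node the pairing is \<open>W\<close> times the partial fraction sum divided by
  \<open>B_lead\<close>; column positions v < N correspond exactly to the nodes where that sum
  vanishes.\<close>

lemma B_orth:
  assumes "v < N"
  shows "(\<Sum>L<Suc N. B_matrix N L * moment_matrix p q r a b \<kappa> L v) = 0"
proof -
  define i w where "i = v mod p" and "w = v div p"
  define s where "s = node i w"
  define f where "f = (\<lambda>j \<beta>. (\<Prod>\<rho><r. pochhammer (s + a \<rho> + 1) \<beta>) /
    (\<Prod>h<q. pochhammer (s + b h + 1) \<beta>) / (s + b j + 1 + of_nat \<beta>))"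
  have i: "i < p"
    using p by (simp add: i_def)
  have iw: "(i, w) \<in> nodes N"
    using i assms stepline_less_iff[of v p N] by (simp add: nodes_def i_def w_def)
  have "(\<Sum>L<Suc N. B_matrix N L * moment_matrix p q r a b \<kappa> L v) =
      (\<Sum>L<Suc N. W s / B_lead N * (B_unnormalized N (L mod q) (L div q) * f (L mod q) (L div q)))"
  proof (intro sum.cong refl)
    fix L assume "L \<in> {..<Suc N}"
    moreover have "moment_matrix p q r a b \<kappa> L v = W s * f (L mod q) (L div q)"
    proof -
      have "node i (w + L div q) + b (L mod q) + 1 = s + b (L mod q) + 1 + of_nat (L div q)"
        by (simp add: s_def node_def)
      then show ?thesis
        unfolding moment_matrix_eq i_def[symmetric] w_def[symmetric] W_ratio[OF i]
        by (simp add: f_def s_def)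
    qed
    ultimately show "B_matrix N L * moment_matrix p q r a b \<kappa> L v =
        W s / B_lead N * (B_unnormalized N (L mod q) (L div q) * f (L mod q) (L div q))"
      by (simp add: B_matrix_def)
  qed
  also have "\<dots> = W s / B_lead N *
      (\<Sum>j<q. \<Sum>\<beta><stepline q (Suc N) j. B_unnormalized N j \<beta> * f j \<beta>)"
    unfolding sum_distrib_left[symmetric]
    using sum_stepline[OF q, of "\<lambda>j \<beta>. B_unnormalized N j \<beta> * f j \<beta>" "Suc N"] by simp
  also have "(\<Sum>j<q. \<Sum>\<beta><stepline q (Suc N) j. B_unnormalized N j \<beta> * f j \<beta>) =
      (\<Sum>x\<in>poles (Suc N). \<Sum>j<q. \<Sum>\<beta><stepline q (Suc N) j.
        (case x of (H, K) \<Rightarrow> pole_weight N H K * pole_coeff H K j \<beta>) * f j \<beta>)"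
    unfolding B_unnormalized_def sum_distrib_right
    by (subst sum.swap[of _ "poles (Suc N)"]) (intro sum.cong refl sum.swap)
  also have "\<dots> = (\<Sum>(H, K)\<in>poles (Suc N). pole_weight N H K / (s - pole H K))"
  proof (intro sum.cong refl, clarify)
    fix H K assume HK: "(H, K) \<in> poles (Suc N)"
    have "(\<Sum>j<q. \<Sum>\<beta><stepline q (Suc N) j. pole_weight N H K * pole_coeff H K j \<beta> * f j \<beta>) =
        pole_weight N H K * (\<Sum>j<q. \<Sum>\<beta><stepline q (Suc N) j. pole_coeff H K j \<beta> * f j \<beta>)"
      by (simp add: sum_distrib_left mult.assoc)
    also have "\<dots> = pole_weight N H K / (s - pole H K)"
      using pole_expansion_stepline[OF i HK, of w] by (simp add: f_def s_def)
    finally show "(\<Sum>j<q. \<Sum>\<beta><stepline q (Suc N) j. pole_weight N H K * pole_coeff H K j \<beta> * f j \<beta>) =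
        pole_weight N H K / (s - pole H K)" .
  qed
  also have "\<dots> = 0"
    unfolding s_def by (rule sum_pole_weight[OF iw])
  finally show ?thesis
    by simp
qed

end

section \<open>The recurrence matrix\<close>

text \<open>Subscripts in the pairing block may be negative; away from zeros one quotient formula
  serves both signs.\<close>

lemma gpoch_quotient:
  assumes "\<And>k. x + of_nat k \<noteq> 0"
  shows "gpoch (x + of_nat k) (int m - int k) = pochhammer x m / pochhammer x k"
proof (cases "k \<le> m")
  case True
  then show ?thesis
    using pochhammer_product[OF True, of x] pochhammer_nonzeroI[of k x] assms
    by (simp add: of_nat_diff flip: of_nat_diff)
next
  case False
  then have "int m - int k < 0" and d: "nat (- (int m - int k)) = k - m"
      and eq: "x + of_nat k + of_int (int m - int k) = x + of_nat m"
    by auto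
  then have "gpoch (x + of_nat k) (int m - int k) = 1 / pochhammer (x + of_nat m) (k - m)"
    by (simp add: gpoch_def)
  also have "\<dots> = pochhammer x m / pochhammer x k"
    using pochhammer_product[of m k x] pochhammer_nonzeroI[of m x] assms False by simp
  finally show ?thesis .
qed

lemma gpoch_one [simp]: "gpoch x 1 = x"
  using gpoch_of_nat[of x 1] by simp

lemma minus_one_powi: "(- 1 :: complex) powi n = (if even n then 1 else - 1)"
  using power_int_minus_left[of "1 :: complex" n] by simp

context hypergeometric_weights
begin

section \<open>The summands of the pairing block\<close>

definition moment_core :: "nat \<Rightarrow> nat \<Rightarrow> nat \<Rightarrow> nat \<Rightarrow> nat \<Rightarrow> complex" where
  "moment_core M i j \<alpha> k = (- 1) ^ Suc M * (\<Prod>\<rho><r. pochhammer (node i \<alpha> + a \<rho> + 1) k) *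
    ((\<Prod>h<q. pochhammer (node i \<alpha> + b h + 1) (stepline q M h)) /
     ((\<Prod>h<q. pochhammer (node i \<alpha> + b h + 1) k) * (node i \<alpha> + b j + 1 + of_nat k))) /
    node_poly_deriv (Suc M) i \<alpha>"

lemma A_coeff_moment_core:
  assumes "i < p" "j < q"
  shows "A_coeff M i \<alpha> * (W (node i (\<alpha> + k)) / (node i (\<alpha> + k) + b j + 1)) =
    nuA M * moment_core M i j \<alpha> k"
  unfolding A_coeff_moment[OF assms] moment_core_def by (simp add: mult_ac)

lemma b_quotient_gpoch:
  assumes i: "i < p" and j: "j < q"
  shows "(\<Prod>h<q. gpoch (\<kappa> i + b h + (of_nat d + of_nat \<alpha> + of_nat \<beta> + 1) + of_bool (h = j))
      (int (m h) - (int d + int \<beta>) - of_bool (h = j))) =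
    (\<Prod>h<q. pochhammer (node i \<alpha> + b h + 1) (m h)) /
     ((\<Prod>h<q. pochhammer (node i \<alpha> + b h + 1) (d + \<beta>)) * (node i \<alpha> + b j + 1 + of_nat (d + \<beta>)))"
proof -
  let ?x = "\<lambda>h. node i \<alpha> + b h + 1"
  have eq: "gpoch (\<kappa> i + b h + (of_nat d + of_nat \<alpha> + of_nat \<beta> + 1) + of_bool (h = j))
      (int (m h) - (int d + int \<beta>) - of_bool (h = j)) =
      pochhammer (?x h) (m h) /
        (pochhammer (?x h) (d + \<beta>) * (if h = j then ?x j + of_nat (d + \<beta>) else 1))"
    if h: "h < q" for h
  proof -
    let ?k = "d + \<beta> + of_bool (h = j)"
    have "\<kappa> i + b h + (of_nat d + of_nat \<alpha> + of_nat \<beta> + 1) + of_bool (h = j) = ?x h + of_nat ?k"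
      by (simp add: node_def)
    moreover have "int (m h) - (int d + int \<beta>) - of_bool (h = j) = int (m h) - int ?k"
      by simp
    moreover have "gpoch (?x h + of_nat ?k) (int (m h) - int ?k) =
        pochhammer (?x h) (m h) / pochhammer (?x h) ?k"
      using node_b_nonzero[OF i h] by (rule gpoch_quotient)
    moreover have "pochhammer (?x h) ?k =
        pochhammer (?x h) (d + \<beta>) * (if h = j then ?x j + of_nat (d + \<beta>) else 1)"
      by (auto simp: pochhammer_Suc)
    ultimately show ?thesis
      by (simp only:)
  qed
  have "(\<Prod>h<q. gpoch (\<kappa> i + b h + (of_nat d + of_nat \<alpha> + of_nat \<beta> + 1) + of_bool (h = j))
      (int (m h) - (int d + int \<beta>) - of_bool (h = j))) =
    (\<Prod>h<q. pochhammer (?x h) (m h) /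
        (pochhammer (?x h) (d + \<beta>) * (if h = j then ?x j + of_nat (d + \<beta>) else 1)))"
    by (intro prod.cong eq) auto
  also have "\<dots> = (\<Prod>h<q. pochhammer (?x h) (m h)) /
      ((\<Prod>h<q. pochhammer (?x h) (d + \<beta>)) * (\<Prod>h<q. if h = j then ?x j + of_nat (d + \<beta>) else 1))"
    unfolding prod_dividef prod.distrib ..
  finally show ?thesis
    using j by simp
qed

lemma pochhammer_neg_of_nat:
  "\<beta> \<le> K \<Longrightarrow> pochhammer (- of_nat K :: complex) \<beta> = (- 1) ^ \<beta> * fact K / fact (K - \<beta>)"
  using pochhammer_one_minus_of_nat[of \<beta> "Suc K", where 'a = complex] by simp

text \<open>The leading minus sign compensates the one by which \<open>pairing_norm\<close> differs
  from a multiple of \<open>nuA\<close>, see \<open>pairing_norm_ratio\<close>.\<close>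

lemma S_diag_eq:
  fixes M N :: nat
  defines "lam \<equiv> stepline p (Suc M)" and "\<eta> \<equiv> stepline q M" and "\<nu> \<equiv> stepline p N"
    and "\<mu> \<equiv> stepline q (Suc N)"
  assumes i: "i < p" and H: "H < q" and \<alpha>: "\<alpha> < lam i" and K: "K < \<mu> H" and \<beta>: "\<beta> \<le> K"
  shows "S_diag p q r a b \<kappa> d lam \<eta> \<nu> \<mu> i H K \<alpha> \<beta> =
    - (pole_coeff H K H \<beta> / pole_poly_deriv (Suc N) H K * moment_core M i H \<alpha> (d + \<beta>))
    * pairing_ratio p q b \<kappa> \<nu> \<mu> H K"
proof -
  define PAk where "PAk = (\<Prod>\<rho><r. pochhammer (node i \<alpha> + a \<rho> + 1) (d + \<beta>))"
  define Q where "Q = (\<Prod>h<q. pochhammer (node i \<alpha> + b h + 1) (\<eta> h)) /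
     ((\<Prod>h<q. pochhammer (node i \<alpha> + b h + 1) (d + \<beta>)) * (node i \<alpha> + b H + 1 + of_nat (d + \<beta>)))"
  define X4 where "X4 = (\<Prod>l\<in>{..<p} - {i}.
    pochhammer (\<kappa> i - \<kappa> l - of_nat (lam l) + (of_nat \<alpha> + 1)) (lam l))"
  let ?y = "\<lambda>\<rho>. a \<rho> - (b H + of_nat K)"
  let ?x = "\<lambda>h. b h - (b H + of_nat K)"
  define A1 where "A1 = (\<Prod>\<rho><r. a \<rho> - b H)"
  define AK where "AK = (\<Prod>\<rho><r. pochhammer (?y \<rho>) K)"
  define AS where "AS = (\<Prod>\<rho><r. pochhammer (?y \<rho>) (Suc \<beta>))"
  define P1 where "P1 = (\<Prod>h\<in>{..<q} - {H}. pochhammer (?x h) (Suc \<beta>))"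
  define PD where "PD = (\<Prod>h\<in>{..<q} - {H}. pochhammer (?x h) (\<mu> h))"
  define R1 where "R1 = (\<Prod>h\<in>{..<q} - {H}. b h - b H)"
  define sM sl sK s\<beta> :: complex where "sM = (- 1) ^ Suc M" and "sl = (- 1) ^ (lam i - 1 - \<alpha>)"
    and "sK = (- 1) ^ K" and "s\<beta> = (- 1) ^ \<beta>"
  have nz: "AK \<noteq> 0" "AS \<noteq> 0" "P1 \<noteq> 0" "PD \<noteq> 0" "sl \<noteq> 0" "sK \<noteq> 0"
    using pochhammer_ab_nonzero[OF _ H] pochhammer_bb_nonzero[OF _ H]
    by (auto simp: AK_def AS_def P1_def PD_def sl_def sK_def)
  have vsum: "vsum p lam = Suc M"
    by (simp add: lam_def vsum_stepline[OF p])
  \<comment> \<open>Only parities matter; \<open>t\<close> is the exponent lam i - 1 - \<alpha>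
    occurring in \<open>sl\<close>.\<close>
  have sign: "(- 1) powi (int (vsum p lam) - int (lam i) + int \<alpha> + int \<beta> - int K) =
      - (sM * s\<beta> / (sK * sl))"
  proof -
    obtain t where t: "lam i = Suc (\<alpha> + t)"
      using \<alpha> less_imp_Suc_add by blast
    show ?thesis
      unfolding vsum by (simp add: t minus_one_powi sM_def s\<beta>_def sK_def sl_def minus_one_power_iff)
  qed
  have gA: "(\<Prod>\<rho><r. gpoch (\<kappa> i + a \<rho> + (of_nat \<alpha> + 1)) (int d + int \<beta>)) = PAk"
    unfolding PAk_def of_nat_add[symmetric] gpoch_of_nat by (simp add: node_def add_ac)
  \<comment> \<open>Extending the symbol of length K by one factor gives a - b H, the numerator of
    \<open>residue_weight\<close>; the first \<beta> + 1 factors are then divided out.\<close>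
  have gA2: "(\<Prod>\<rho><r. gpoch (?y \<rho> + (of_nat \<beta> + 1)) (int K - int \<beta>)) = AK * A1 / AS"
    unfolding AK_def A1_def AS_def prod.distrib[symmetric] prod_dividef[symmetric]
  proof (intro prod.cong refl)
    fix \<rho> assume "\<rho> \<in> {..<r}"
    then have "pochhammer (?y \<rho>) (Suc \<beta>) \<noteq> 0"
      using pochhammer_ab_nonzero[OF _ H] by auto
    moreover have "pochhammer (?y \<rho>) (Suc K) = pochhammer (?y \<rho>) (Suc \<beta>) *
        pochhammer (?y \<rho> + of_nat (Suc \<beta>)) (K - \<beta>)"
      using pochhammer_product[of "Suc \<beta>" "Suc K" "?y \<rho>"] \<beta> by simp
    moreover have "pochhammer (?y \<rho>) (Suc K) = pochhammer (?y \<rho>) K * (a \<rho> - b H)"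
      by (simp add: pochhammer_Suc)
    moreover have "gpoch (?y \<rho> + (of_nat \<beta> + 1)) (int K - int \<beta>) =
        pochhammer (?y \<rho> + of_nat (Suc \<beta>)) (K - \<beta>)"
      using \<beta> gpoch_of_nat[of "?y \<rho> + (of_nat \<beta> + 1)" "K - \<beta>"]
      by (simp add: of_nat_diff add_ac)
    ultimately show "gpoch (?y \<rho> + (of_nat \<beta> + 1)) (int K - int \<beta>) =
        pochhammer (?y \<rho>) K * (a \<rho> - b H) / pochhammer (?y \<rho>) (Suc \<beta>)"
      by (metis nonzero_mult_div_cancel_left)
  qed
  have gAK: "(\<Prod>\<rho><r. gpoch (?y \<rho>) (int K)) = AK"
    by (simp add: AK_def)
  have gP: "(\<Prod>h\<in>{..<q} - {H}. gpoch (?x h + (of_nat \<beta> + 1)) (int (\<mu> h) - (int \<beta> + 1))) = PD / P1"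
    unfolding PD_def P1_def prod_dividef[symmetric]
  proof (intro prod.cong refl)
    fix h assume "h \<in> {..<q} - {H}"
    then have h: "h < q" "h \<noteq> H"
      by auto
    have nz: "?x h + of_nat k \<noteq> 0" for k
      using b_diff_nonzero[OF h(1) H h(2), of "int k - int K"] by (simp add: algebra_simps)
    show "gpoch (?x h + (of_nat \<beta> + 1)) (int (\<mu> h) - (int \<beta> + 1)) =
        pochhammer (?x h) (\<mu> h) / pochhammer (?x h) (Suc \<beta>)"
      using gpoch_quotient[OF nz, of "Suc \<beta>" "\<mu> h"] by (simp add: add_ac)
  qed
  have gX: "(\<Prod>l\<in>{..<p} - {i}.
      gpoch (\<kappa> i - \<kappa> l - of_nat (lam l) + (of_nat \<alpha> + 1)) (int (lam l))) = X4"
    by (simp add: X4_def)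
  have gQ: "(\<Prod>h<q. gpoch (\<kappa> i + b h + (of_nat d + of_nat \<alpha> + of_nat \<beta> + 1) + of_bool (h = H))
      (int (\<eta> h) - (int d + int \<beta>) - of_bool (h = H))) = Q"
    unfolding Q_def by (rule b_quotient_gpoch[OF i H])
  have num: "(\<Prod>h<q. pochhammer (?x h) (\<beta> + of_bool (h \<noteq> H))) = s\<beta> * fact K / fact (K - \<beta>) * P1"
  proof -
    have "(\<Prod>h<q. pochhammer (?x h) (\<beta> + of_bool (h \<noteq> H))) =
        pochhammer (- of_nat K) \<beta> * (\<Prod>h\<in>{..<q} - {H}. pochhammer (?x h) (\<beta> + of_bool (h \<noteq> H)))"
      using H by (subst prod.remove[of _ H]) auto
    also have "(\<Prod>h\<in>{..<q} - {H}. pochhammer (?x h) (\<beta> + of_bool (h \<noteq> H))) = P1"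
      unfolding P1_def by (intro prod.cong) auto
    finally show ?thesis
      using \<beta> by (simp add: pochhammer_neg_of_nat s\<beta>_def)
  qed
  have pc: "pole_coeff H K H \<beta> = A1 / R1 * (s\<beta> * fact K / fact (K - \<beta>) * P1) / AS"
    unfolding pole_coeff_def residue_weight_def num A1_def R1_def AS_def ..
  have pd: "pole_poly_deriv (Suc N) H K = sK * fact K * fact (\<mu> H - K - 1) * PD"
    using pole_poly_deriv_eq[OF H K[unfolded \<mu>_def]] by (simp add: sK_def PD_def \<mu>_def)
  have nd: "node_poly_deriv (Suc M) i \<alpha> = sl * fact \<alpha> * fact (lam i - 1 - \<alpha>) * X4"
    using node_poly_deriv_eq[OF i \<alpha>[unfolded lam_def]] by (simp add: sl_def X4_def lam_def)
  have core: "moment_core M i H \<alpha> (d + \<beta>) = sM * PAk * Q / (sl * fact \<alpha> * fact (lam i - 1 - \<alpha>) * X4)"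
    by (simp add: moment_core_def nd sM_def PAk_def Q_def \<eta>_def)
  have alg: "- (sM * s\<beta> / (sK * sl)) / (fa * fl * fKb * fm) * (PAk * (AK * A1 / AS) / (X4 * AK)) * R *
        (Q / (R1 * (PD / P1))) =
      - (A1 / R1 * (s\<beta> * fK / fKb * P1) / AS / (sK * fK * fm * PD) *
        (sM * PAk * Q / (sl * fa * fl * X4))) * R"
    if "fK \<noteq> 0" for fa fl fKb fm fK R :: complex
    using nz that by (simp add: divide_simps)
  show ?thesis
    unfolding S_diag_def sign gA gA2 gAK gX gQ gP gpoch_one R1_def[symmetric]
      pc pd core
    by (rule alg) simp
qed

text \<open>Since H differs from j, the factor h = H of \<open>pole_coeff\<close> now has length
  \<beta> + 1, which accounts for the factorial of K - 1 - \<beta> and the additional sign.\<close>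

lemma S_offdiag_eq:
  fixes M N :: nat
  defines "lam \<equiv> stepline p (Suc M)" and "\<eta> \<equiv> stepline q M" and "\<nu> \<equiv> stepline p N"
    and "\<mu> \<equiv> stepline q (Suc N)"
  assumes i: "i < p" and j: "j < q" and H: "H < q" and Hj: "H \<noteq> j"
    and \<alpha>: "\<alpha> < lam i" and K: "K < \<mu> H" and \<beta>: "\<beta> < K"
  shows "S_offdiag p q r a b \<kappa> d lam \<eta> \<nu> \<mu> i j H K \<alpha> \<beta> =
    - (pole_coeff H K j \<beta> / pole_poly_deriv (Suc N) H K * moment_core M i j \<alpha> (d + \<beta>))
    * pairing_ratio p q b \<kappa> \<nu> \<mu> H K"
proof -
  define PAk where "PAk = (\<Prod>\<rho><r. pochhammer (node i \<alpha> + a \<rho> + 1) (d + \<beta>))"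
  define Q where "Q = (\<Prod>h<q. pochhammer (node i \<alpha> + b h + 1) (\<eta> h)) /
     ((\<Prod>h<q. pochhammer (node i \<alpha> + b h + 1) (d + \<beta>)) * (node i \<alpha> + b j + 1 + of_nat (d + \<beta>)))"
  define X4 where "X4 = (\<Prod>l\<in>{..<p} - {i}.
    pochhammer (\<kappa> i - \<kappa> l - of_nat (lam l) + (of_nat \<alpha> + 1)) (lam l))"
  let ?y = "\<lambda>\<rho>. a \<rho> - (b H + of_nat K)"
  let ?x = "\<lambda>h. b h - (b H + of_nat K)"
  define A1 where "A1 = (\<Prod>\<rho><r. a \<rho> - b j)"
  define AS where "AS = (\<Prod>\<rho><r. pochhammer (?y \<rho>) (Suc \<beta>))"
  define P1 where "P1 = (\<Prod>h\<in>{..<q} - {H}. pochhammer (?x h) (\<beta> + of_bool (h \<noteq> j)))"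
  define PD where "PD = (\<Prod>h\<in>{..<q} - {H}. pochhammer (?x h) (\<mu> h))"
  define R1 where "R1 = (\<Prod>h\<in>{..<q} - {j}. b h - b j)"
  define sM sl sK s\<beta> :: complex where "sM = (- 1) ^ Suc M" and "sl = (- 1) ^ (lam i - 1 - \<alpha>)"
    and "sK = (- 1) ^ K" and "s\<beta> = (- 1) ^ Suc \<beta>"
  have nz: "AS \<noteq> 0" "P1 \<noteq> 0" "PD \<noteq> 0" "sl \<noteq> 0" "sK \<noteq> 0"
    using pochhammer_ab_nonzero[OF _ H] pochhammer_bb_nonzero[OF _ H]
    by (auto simp: AS_def P1_def PD_def sl_def sK_def)
  have vsum: "vsum p lam = Suc M"
    by (simp add: lam_def vsum_stepline[OF p])
  have sign: "(- 1) powi (int (vsum p lam) - int (lam i) + 1 + int \<alpha> + int K + int \<beta>) =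
      - (sM * s\<beta> / (sK * sl))"
  proof -
    obtain t where t: "lam i = Suc (\<alpha> + t)"
      using \<alpha> less_imp_Suc_add by blast
    show ?thesis
      unfolding vsum by (simp add: t minus_one_powi sM_def s\<beta>_def sK_def sl_def minus_one_power_iff)
  qed
  have gA: "(\<Prod>\<rho><r. gpoch (\<kappa> i + a \<rho> + (of_nat \<alpha> + 1)) (int d + int \<beta>)) = PAk"
    unfolding PAk_def of_nat_add[symmetric] gpoch_of_nat by (simp add: node_def add_ac)
  have gAS: "(\<Prod>\<rho><r. gpoch (?y \<rho>) (int \<beta> + 1)) = AS"
    unfolding AS_def using gpoch_of_nat[of _ "Suc \<beta>"] by (simp add: add.commute)
  have gP: "(\<Prod>h\<in>{..<q} - {H}. gpoch (?x h + (of_nat \<beta> + 1) - of_bool (h = j))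
      (int (\<mu> h) - (int \<beta> + 1) + of_bool (h = j))) = PD / P1"
    unfolding PD_def P1_def prod_dividef[symmetric]
  proof (intro prod.cong refl)
    fix h assume "h \<in> {..<q} - {H}"
    then have h: "h < q" "h \<noteq> H"
      by auto
    have nz: "?x h + of_nat k \<noteq> 0" for k
      using b_diff_nonzero[OF h(1) H h(2), of "int k - int K"] by (simp add: algebra_simps)
    have "?x h + (of_nat \<beta> + 1) - of_bool (h = j) = ?x h + of_nat (\<beta> + of_bool (h \<noteq> j))"
      and "int (\<mu> h) - (int \<beta> + 1) + of_bool (h = j) = int (\<mu> h) - int (\<beta> + of_bool (h \<noteq> j))"
      by auto
    then show "gpoch (?x h + (of_nat \<beta> + 1) - of_bool (h = j))
        (int (\<mu> h) - (int \<beta> + 1) + of_bool (h = j)) =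
        pochhammer (?x h) (\<mu> h) / pochhammer (?x h) (\<beta> + of_bool (h \<noteq> j))"
      using gpoch_quotient[OF nz, of "\<beta> + of_bool (h \<noteq> j)" "\<mu> h"] by (simp only:)
  qed
  have gX: "(\<Prod>l\<in>{..<p} - {i}.
      gpoch (\<kappa> i - \<kappa> l - of_nat (lam l) + (of_nat \<alpha> + 1)) (int (lam l))) = X4"
    by (simp add: X4_def)
  have gQ: "(\<Prod>h<q. gpoch (\<kappa> i + b h + (of_nat d + of_nat \<alpha> + of_nat \<beta> + 1) + of_bool (h = j))
      (int (\<eta> h) - (int d + int \<beta>) - of_bool (h = j))) = Q"
    unfolding Q_def by (rule b_quotient_gpoch[OF i j])
  have num: "(\<Prod>h<q. pochhammer (?x h) (\<beta> + of_bool (h \<noteq> j))) = s\<beta> * fact K / fact (K - 1 - \<beta>) * P1"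
  proof -
    have "(\<Prod>h<q. pochhammer (?x h) (\<beta> + of_bool (h \<noteq> j))) = pochhammer (- of_nat K) (Suc \<beta>) * P1"
      unfolding P1_def using H Hj by (subst prod.remove[of _ H]) auto
    then show ?thesis
      using \<beta> by (simp add: pochhammer_neg_of_nat s\<beta>_def)
  qed
  have pc: "pole_coeff H K j \<beta> = A1 / R1 * (s\<beta> * fact K / fact (K - 1 - \<beta>) * P1) / AS"
    unfolding pole_coeff_def residue_weight_def num A1_def R1_def AS_def ..
  have pd: "pole_poly_deriv (Suc N) H K = sK * fact K * fact (\<mu> H - K - 1) * PD"
    using pole_poly_deriv_eq[OF H K[unfolded \<mu>_def]] by (simp add: sK_def PD_def \<mu>_def)
  have nd: "node_poly_deriv (Suc M) i \<alpha> = sl * fact \<alpha> * fact (lam i - 1 - \<alpha>) * X4"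
    using node_poly_deriv_eq[OF i \<alpha>[unfolded lam_def]] by (simp add: sl_def X4_def lam_def)
  have core: "moment_core M i j \<alpha> (d + \<beta>) = sM * PAk * Q / (sl * fact \<alpha> * fact (lam i - 1 - \<alpha>) * X4)"
    by (simp add: moment_core_def nd sM_def PAk_def Q_def \<eta>_def)
  have alg: "- (sM * s\<beta> / (sK * sl)) / (fa * fl * fKb * fm) * (A1 * PAk / (X4 * AS)) * R *
        (Q / (R1 * (PD / P1))) =
      - (A1 / R1 * (s\<beta> * fK / fKb * P1) / AS / (sK * fK * fm * PD) *
        (sM * PAk * Q / (sl * fa * fl * X4))) * R"
    if "fK \<noteq> 0" for fa fl fKb fm fK R :: complex
    using nz that by (simp add: divide_simps)
  show ?thesis
    unfolding S_offdiag_def sign gA gAS gX gQ gP gpoch_one A1_def[symmetric] R1_def[symmetric]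
      pc pd core
    by (rule alg) simp
qed

text \<open>The case distinction in \<open>S_term\<close> matches the vanishing pattern of
  \<open>pole_coeff\<close>, so one formula covers every \<beta>.\<close>

lemma S_term_eq:
  fixes M N :: nat
  defines "lam \<equiv> stepline p (Suc M)" and "\<eta> \<equiv> stepline q M" and "\<nu> \<equiv> stepline p N"
    and "\<mu> \<equiv> stepline q (Suc N)"
  assumes i: "i < p" and j: "j < q" and \<alpha>: "\<alpha> < lam i" and HK: "(H, K) \<in> poles (Suc N)"
  shows "S_term p q r a b \<kappa> d lam \<eta> \<nu> \<mu> i j H K \<alpha> \<beta> =
    - (pole_coeff H K j \<beta> / pole_poly_deriv (Suc N) H K * moment_core M i j \<alpha> (d + \<beta>))
    * pairing_ratio p q b \<kappa> \<nu> \<mu> H K"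
proof -
  have H: "H < q" and K: "K < \<mu> H"
    using HK by (auto simp: poles_def \<mu>_def)
  have "(H = j \<and> \<beta> \<le> K) \<or> (H \<noteq> j \<and> \<beta> < K) \<or> (if j = H then K < \<beta> else K \<le> \<beta>)"
    by auto
  then consider (diag) "H = j" "\<beta> \<le> K" | (off) "H \<noteq> j" "\<beta> < K" | (zero) "if j = H then K < \<beta> else K \<le> \<beta>"
    by blast
  then show ?thesis
  proof cases
    case diag
    then show ?thesis
      using S_diag_eq[OF i H, of \<alpha> M K N \<beta> d] \<alpha> K
      by (simp add: S_term_def lam_def \<eta>_def \<nu>_def \<mu>_def)
  next
    case off
    then show ?thesis
      using S_offdiag_eq[OF i j H, of \<alpha> M K N \<beta> d] \<alpha> K
      by (simp add: S_term_def lam_def \<eta>_def \<nu>_def \<mu>_def)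
  next
    case zero
    have "S_term p q r a b \<kappa> d lam \<eta> \<nu> \<mu> i j H K \<alpha> \<beta> = 0"
      using zero by (auto simp: S_term_def split: if_splits)
    then show ?thesis
      using pole_coeff_eq_0[OF H zero] by simp
  qed
qed

text \<open>\<open>B_lead N\<close> is split between the two factors: its product over \<kappa> is
  the denominator of \<open>pairing_ratio\<close>, the rest sits in
  \<open>pairing_norm\<close>.\<close>

lemma pairing_norm_ratio:
  "pairing_norm p q r a b \<kappa> (stepline p (Suc M)) (stepline q M) (stepline q (Suc N)) *
    pairing_ratio p q b \<kappa> (stepline p N) (stepline q (Suc N)) H K =
    - nuA M * (\<Prod>i<p. pochhammer (\<kappa> i + (b H + of_nat K + 1)) (stepline p N i)) / B_lead N"
proof -
  define u J where "u = N div q" and "J = N mod q"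
  define e jm where "e = M div q" and "jm = M mod q"
  have J: "J < q" and jm: "jm < q"
    using q by (auto simp: J_def jm_def)
  have up: "{h. h < q \<and> stepline q M h = e + 1} = {..<jm}"
    using jm by (auto simp: stepline_def e_def jm_def split: if_splits)
  have lo: "{h. h < q \<and> h \<noteq> J \<and> stepline q (Suc N) h = Suc u} = {..<J}"
    using J by (auto simp: stepline_Suc[OF q] u_def J_def of_bool_def split: if_splits)
  define ZK where "ZK = (\<Prod>i<p. pochhammer (\<kappa> i + (b J + of_nat u + 1)) (stepline p N i))"
  define PA where "PA = (\<Prod>\<rho><r. pochhammer (a \<rho> - (b J + of_nat u)) u)"
  define LO where "LO = (\<Prod>h<J. b h - b J)"
  have lead: "B_lead N = ZK / (PA * LO)"
    unfolding B_lead_eq ZK_def PA_def LO_def u_def J_def ..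
  have nz: "ZK \<noteq> 0" "PA \<noteq> 0" "LO \<noteq> 0"
    using B_lead_nonzero[of N] unfolding lead by auto
  have nuA: "nuA M = - (\<Prod>i<p. pochhammer (\<kappa> i + (b jm + of_nat e + 1)) (stepline p (Suc M) i))
    / ((\<Prod>\<rho><r. pochhammer (a \<rho> - (b jm + of_nat e)) e) * (\<Prod>h<jm. b h - b jm))"
    by (simp add: nuA_eq e_def jm_def add_ac diff_diff_eq)
  have norm: "pairing_norm p q r a b \<kappa> (stepline p (Suc M)) (stepline q M) (stepline q (Suc N)) =
      - nuA M * PA * LO"
    using up lo
    by (simp add: pairing_norm_def Let_def vmin_stepline[OF q] first_min_stepline[OF q]
        vmax_stepline_Suc[OF q] last_max_stepline_Suc[OF q] nuA PA_def LO_def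
        flip: u_def J_def e_def jm_def)
  have ratio: "pairing_ratio p q b \<kappa> (stepline p N) (stepline q (Suc N)) H K =
      (\<Prod>i<p. pochhammer (\<kappa> i + (b H + of_nat K + 1)) (stepline p N i)) / ZK"
    by (simp add: pairing_ratio_def Let_def vmax_stepline_Suc[OF q] last_max_stepline_Suc[OF q]
        ZK_def flip: u_def J_def)
  show ?thesis
    unfolding norm ratio lead using nz by simp
qed

lemma sum_poles: "(\<Sum>(H, K)\<in>poles N. f H K) = (\<Sum>H<q. \<Sum>K<stepline q N H. f H K)"
  unfolding poles_def by (rule sum.Sigma[symmetric]) auto

text \<open>Summation over the poles rebuilds one type B coefficient, leaving one term of the
  pairing: type B coefficient times type A coefficient times moment.\<close>

lemma pairing_norm_sum_S_term:
  assumes i: "i < p" and j: "j < q" and \<alpha>: "\<alpha> < stepline p (Suc M) i"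
  shows "pairing_norm p q r a b \<kappa> (stepline p (Suc M)) (stepline q M) (stepline q (Suc N)) *
    (\<Sum>H<q. \<Sum>K<stepline q (Suc N) H.
      S_term p q r a b \<kappa> d (stepline p (Suc M)) (stepline q M) (stepline p N) (stepline q (Suc N))
        i j H K \<alpha> \<beta>) =
    B_unnormalized N j \<beta> / B_lead N *
      (A_coeff M i \<alpha> * (W (node i (\<alpha> + (d + \<beta>))) / (node i (\<alpha> + (d + \<beta>)) + b j + 1)))"
  (is "?norm * _ = _")
proof -
  let ?c = "nuA M * moment_core M i j \<alpha> (d + \<beta>)"
  have "?norm * (\<Sum>H<q. \<Sum>K<stepline q (Suc N) H.
      S_term p q r a b \<kappa> d (stepline p (Suc M)) (stepline q M) (stepline p N) (stepline q (Suc N))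
        i j H K \<alpha> \<beta>) =
    (\<Sum>(H, K)\<in>poles (Suc N). ?norm *
      S_term p q r a b \<kappa> d (stepline p (Suc M)) (stepline q M) (stepline p N) (stepline q (Suc N))
        i j H K \<alpha> \<beta>)"
    by (simp add: sum_poles sum_distrib_left)
  also have "\<dots> = (\<Sum>(H, K)\<in>poles (Suc N). pole_weight N H K * pole_coeff H K j \<beta> * (?c / B_lead N))"
  proof (intro sum.cong refl, clarify)
    fix H K assume HK: "(H, K) \<in> poles (Suc N)"
    let ?R = "pairing_ratio p q b \<kappa> (stepline p N) (stepline q (Suc N)) H K"
    have "?norm * S_term p q r a b \<kappa> d (stepline p (Suc M)) (stepline q M) (stepline p N)
        (stepline q (Suc N)) i j H K \<alpha> \<beta> =
      (?norm * ?R) * - (pole_coeff H K j \<beta> / pole_poly_deriv (Suc N) H K * moment_core M i j \<alpha> (d + \<beta>))"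
      unfolding S_term_eq[OF i j \<alpha> HK] by (simp only: mult_ac)
    also have "\<dots> = pole_weight N H K * pole_coeff H K j \<beta> * (?c / B_lead N)"
      unfolding pairing_norm_ratio pole_weight_def by (simp add: mult_ac)
    finally show "?norm * S_term p q r a b \<kappa> d (stepline p (Suc M)) (stepline q M) (stepline p N)
        (stepline q (Suc N)) i j H K \<alpha> \<beta> =
      pole_weight N H K * pole_coeff H K j \<beta> * (?c / B_lead N)" .
  qed
  also have "\<dots> = B_unnormalized N j \<beta> * (?c / B_lead N)"
    unfolding B_unnormalized_def sum_distrib_right by (simp add: case_prod_unfold)
  finally show ?thesis
    unfolding A_coeff_moment_core[OF i j] by simp
qed

section \<open>Entries of the recurrence matrix and the dual recurrence\<close>

sublocale biorthogonal_system "moment_matrix p q r a b \<kappa>" B_matrix A_matrix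
proof
  show "lower_unitriangular B_matrix"
    by (rule B_unitriangular)
  show "lower_triangular A_matrix"
    by (simp add: lower_triangular_def A_matrix_def)
qed (fact B_orth A_orth A_norm)+

lemma recurrence_matrix_eq:
  "recurrence_matrix p q r a b \<kappa> =
    sm_mult (sm_mult B_matrix (block_shift q)) (sm_inverse B_matrix)"
  by (simp add: recurrence_matrix_def gauss_borel_left_eq Let_def)

lemma moment_matrix_hankel:
  "moment_matrix p q r a b \<kappa> (L + q) v = moment_matrix p q r a b \<kappa> L (v + p)"
  using p q by (simp add: moment_matrix_eq)

theorem recurrence_matrix_entry:
  "recurrence_matrix p q r a b \<kappa> N M =
    pairing_block p q r a b \<kappa> 1 (stepline p (M + 1)) (stepline q M) (stepline p N) (stepline q (N + 1))"
proof -
  let ?c = "\<lambda>i j v \<beta>. W (node i (v + (1 + \<beta>))) / (node i (v + (1 + \<beta>)) + b j + 1)"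
  have "recurrence_matrix p q r a b \<kappa> N M = (\<Sum>L<Suc N. B_matrix N L * Y (L + q) M)"
    by (rule shifted_eq[OF recurrence_matrix_eq])
  also have "\<dots> = (\<Sum>L<Suc N. B_unnormalized N (L mod q) (L div q) / B_lead N *
      (\<Sum>(i, v)\<in>nodes (Suc M). A_coeff M i v * ?c i (L mod q) v (L div q)))"
  proof (intro sum.cong refl)
    fix L assume "L \<in> {..<Suc N}"
    \<comment> \<open>A shift by \<open>q\<close> rows raises the block index by one and keeps the
      component, which is the case d = 1 of the pairing block.\<close>
    moreover have "(L + q) div q = 1 + L div q" "(L + q) mod q = L mod q"
      using q by auto
    then have "Y (L + q) M = (\<Sum>(i, v)\<in>nodes (Suc M). A_coeff M i v * ?c i (L mod q) v (L div q))"
      unfolding Y_def A_column_sum by (simp only:)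
    ultimately show "B_matrix N L * Y (L + q) M = B_unnormalized N (L mod q) (L div q) / B_lead N *
        (\<Sum>(i, v)\<in>nodes (Suc M). A_coeff M i v * ?c i (L mod q) v (L div q))"
      by (simp add: B_matrix_def)
  qed
  also have "\<dots> = (\<Sum>j<q. \<Sum>\<beta><stepline q (Suc N) j. B_unnormalized N j \<beta> / B_lead N *
      (\<Sum>(i, v)\<in>nodes (Suc M). A_coeff M i v * ?c i j v \<beta>))"
    by (rule sum_stepline[OF q])
  also have "\<dots> = (\<Sum>j<q. \<Sum>i<p. \<Sum>\<beta><stepline q (Suc N) j. \<Sum>\<alpha><stepline p (Suc M) i.
      B_unnormalized N j \<beta> / B_lead N * (A_coeff M i \<alpha> * ?c i j \<alpha> \<beta>))"
    unfolding sum_nodes sum_distrib_left by (intro sum.cong refl sum.swap)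
  also have "\<dots> = (\<Sum>j<q. \<Sum>i<p. \<Sum>\<beta><stepline q (Suc N) j. \<Sum>\<alpha><stepline p (Suc M) i.
      pairing_norm p q r a b \<kappa> (stepline p (Suc M)) (stepline q M) (stepline q (Suc N)) *
      (\<Sum>H<q. \<Sum>K<stepline q (Suc N) H.
        S_term p q r a b \<kappa> 1 (stepline p (Suc M)) (stepline q M) (stepline p N) (stepline q (Suc N))
          i j H K \<alpha> \<beta>))"
    by (intro sum.cong refl pairing_norm_sum_S_term[symmetric]) auto
  also have "\<dots> = pairing_block p q r a b \<kappa> 1 (stepline p (M + 1)) (stepline q M) (stepline p N)
      (stepline q (N + 1))"
    unfolding pairing_block_def Suc_eq_plus1 sum_distrib_left[symmetric] ..
  finally show ?thesis .
qed

lemma A_step_eq_sum: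
  assumes i: "i < p" and U: "stepline p (Suc N) i \<le> U"
  shows "A_step p q r a b \<kappa> N i z = (\<Sum>u<U. A_matrix N (u * p + i) * z ^ u)"
proof -
  have "A_matrix N (u * p + i) = (if u < stepline p (Suc N) i then A_coeff N i u else 0)" for u
    using stepline_less_iff[of "u * p + i" p "Suc N"] i by (simp add: A_matrix_def less_Suc_eq_le)
  then have "(\<Sum>u<U. A_matrix N (u * p + i) * z ^ u) =
      (\<Sum>u<stepline p (Suc N) i. A_coeff N i u * z ^ u)"
    using U by (intro sum.mono_neutral_cong_right) auto
  then show ?thesis
    by (simp add: A_step_eq[OF i])
qed

lemma stepline_le: "stepline d N h \<le> Suc N"
proof -
  have "N div d \<le> N"
    by simp
  then show ?thesis
    by (simp add: stepline_def of_bool_def del: div_le_dividend)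
qed

theorem A_step_recurrence:
  assumes i: "i < p"
  shows "z * A_step p q r a b \<kappa> N i z =
    (\<Sum>k | k \<in> {- int q..int p} \<and> 0 \<le> int N + k.
      recurrence_matrix p q r a b \<kappa> (nat (int N + k)) N * A_step p q r a b \<kappa> (nat (int N + k)) i z)"
proof -
  let ?T = "recurrence_matrix p q r a b \<kappa>"
  \<comment> \<open>Large enough to bound all component lengths for M <= N + p, so that the vectors
    share one padded range of powers.\<close>
  define U where "U = N + p + 3"
  have A: "A_step p q r a b \<kappa> M i z = (\<Sum>u<V. A_matrix M (u * p + i) * z ^ u)"
    if "M \<le> N + p" "U \<le> V" for M V
  proof (rule A_step_eq_sum[OF i])
    show "stepline p (Suc M) i \<le> V"
      using stepline_le[of p "Suc M" i] that by (simp add: U_def)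
  qed
  have "z * A_step p q r a b \<kappa> N i z = (\<Sum>u<U. A_matrix N (u * p + i) * z ^ Suc u)"
    by (simp add: A[of N U] sum_distrib_left mult_ac)
  \<comment> \<open>The new term u = 0 is zero because i < p; for positive u, subtracting p lowers
    the block index by one.\<close>
  also have "\<dots> = (\<Sum>u<Suc U. (if p \<le> u * p + i then A_matrix N (u * p + i - p) else 0) * z ^ u)"
    unfolding sum.lessThan_Suc_shift using i by (auto simp: add_ac intro!: sum.cong)
  also have "\<dots> = (\<Sum>u<Suc U. (\<Sum>M<Suc (N + p). ?T M N * A_matrix M (u * p + i)) * z ^ u)"
    unfolding dual_recurrence[OF recurrence_matrix_eq moment_matrix_hankel] ..
  also have "\<dots> = (\<Sum>M<Suc (N + p). ?T M N * (\<Sum>u<Suc U. A_matrix M (u * p + i) * z ^ u))"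
    by (simp only: sum_distrib_left sum_distrib_right mult.assoc) (rule sum.swap)
  also have "\<dots> = (\<Sum>M<Suc (N + p). ?T M N * A_step p q r a b \<kappa> M i z)"
    by (intro sum.cong refl) (simp add: A[of _ "Suc U"])
  \<comment> \<open>For N < q the truncated lower end is 0, in agreement with the condition that N +
    k be nonnegative.\<close>
  also have "\<dots> = (\<Sum>M\<in>{N - q..N + p}. ?T M N * A_step p q r a b \<kappa> M i z)"
    using T_below_band[OF recurrence_matrix_eq moment_matrix_hankel]
    by (intro sum.mono_neutral_right) auto
  also have "\<dots> = (\<Sum>k | k \<in> {- int q..int p} \<and> 0 \<le> int N + k.
      ?T (nat (int N + k)) N * A_step p q r a b \<kappa> (nat (int N + k)) i z)"
    by (rule sum.reindex_bij_witness[where i = "\<lambda>k. nat (int N + k)" and j = "\<lambda>M. int M - int N"]) auto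
  finally show ?thesis .
qed

end

text \<open>At positions N = q * m all components equal m, so a - b j - m + 1 is no nonpositive
  integer for any m >= 1. Letting m vary excludes every integer value of a - b j.\<close>

lemma hypergeometric_weightsI:
  assumes "p \<ge> 1" "q \<ge> 1" "r < q" and reg: "regular_parameters p q b \<kappa>"
    and adm: "\<And>N. admissible p q r a b \<kappa> (stepline q N)"
  shows "hypergeometric_weights p q r a b \<kappa>"
proof
  fix \<rho> j assume "\<rho> < r" "j < q"
  show "a \<rho> - b j \<notin> \<int>"
  proof
    assume "a \<rho> - b j \<in> \<int>"
    then obtain n where n: "a \<rho> - b j = of_int n"
      by (elim Ints_cases)
    \<comment> \<open>Chosen so that n - m + 1 is the minimum of n and 0, with m >= 1 even for
      negative n.\<close>
    define m where "m = Suc (nat n)"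
    have "stepline q (q * m) j = m"
      using assms(2) by (simp add: stepline_def)
    then have "a \<rho> - b j - of_nat m + 1 \<notin> \<int>\<^sub>\<le>\<^sub>0"
      using adm[of "q * m"] \<open>\<rho> < r\<close> \<open>j < q\<close> by (auto simp: admissible_def m_def)
    moreover have "a \<rho> - b j - of_nat m + 1 = of_int (n - int (nat n))"
      by (simp add: n m_def)
    moreover have "(of_int (n - int (nat n)) :: complex) \<in> \<int>\<^sub>\<le>\<^sub>0"
      by (rule nonpos_Ints_of_int) simp
    ultimately show False
      by simp
  qed
qed (use assms adm[of 0] in \<open>auto simp: regular_parameters_def admissible_def\<close>)

theorem corollary7p3:
  fixes p q r :: nat and a b \<kappa> :: "nat \<Rightarrow> complex" and T :: "nat \<Rightarrow> nat \<Rightarrow> complex"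
  assumes "p \<ge> 1" and "q \<ge> 1" and "r < q"
    and "regular_parameters p q b \<kappa>"
    and "\<And>N. admissible p q r a b \<kappa> (stepline q N)"
    and "\<And>n. Determinant.det (leading_truncation (moment_matrix p q r a b \<kappa>) n) \<noteq> 0"
    and "T = recurrence_matrix p q r a b \<kappa>"
  shows
    "(\<forall>N k. k \<in> {- int p..int q} \<and> int N + k \<ge> 0 \<longrightarrow>
        band_entry T N k =
          pairing_block p q r a b \<kappa> 1
            (stepline p (nat (int N + k) + 1)) (stepline q (nat (int N + k)))
            (stepline p N) (stepline q (N + 1)))
     \<and> (\<forall>N. \<forall>i<p. \<forall>z.
        z * A_step p q r a b \<kappa> N i z =
          (\<Sum>k | k \<in> {- int q..int p} \<and> int N + k \<ge> 0.
             band_entry T (nat (int N + k)) (- k) * A_step p q r a b \<kappa> (nat (int N + k)) i z))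
     \<and> (\<forall>N k. k \<in> {- int q..int p} \<and> int N + k \<ge> 0 \<longrightarrow>
        band_entry T (nat (int N + k)) (- k) =
          pairing_block p q r a b \<kappa> 1
            (stepline p (N + 1)) (stepline q N)
            (stepline p (nat (int N + k))) (stepline q (nat (int N + k) + 1)))"
proof -
  interpret hypergeometric_weights p q r a b \<kappa>
    using assms by (intro hypergeometric_weightsI)
  have band: "band_entry T (nat (int N + k)) (- k) = recurrence_matrix p q r a b \<kappa> (nat (int N + k)) N"
    if "int N + k \<ge> 0" for N k
    using that by (simp add: band_entry_def assms(7))
  show ?thesis
  proof (intro conjI allI impI)
    fix N k
    show "band_entry T N k =
        pairing_block p q r a b \<kappa> 1
          (stepline p (nat (int N + k) + 1)) (stepline q (nat (int N + k)))
          (stepline p N) (stepline q (N + 1))"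
      unfolding band_entry_def assms(7) by (rule recurrence_matrix_entry)
  next
    fix N i z assume "i < p"
    show "z * A_step p q r a b \<kappa> N i z =
        (\<Sum>k | k \<in> {- int q..int p} \<and> int N + k \<ge> 0.
           band_entry T (nat (int N + k)) (- k) * A_step p q r a b \<kappa> (nat (int N + k)) i z)"
      unfolding A_step_recurrence[OF \<open>i < p\<close>] by (intro sum.cong refl) (simp add: band)
  next
    fix N k assume "k \<in> {- int q..int p} \<and> int N + k \<ge> 0"
    then show "band_entry T (nat (int N + k)) (- k) =
        pairing_block p q r a b \<kappa> 1
          (stepline p (N + 1)) (stepline q N)
          (stepline p (nat (int N + k))) (stepline q (nat (int N + k) + 1))"
      by (simp only: band recurrence_matrix_entry)
  qed
qed

end
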